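(* Let $G$ be an odd unicyclic graph on the vertex set $[n]=\{1,\dots,n\}$. Then $$\beta_2(S/L_G)=\beta_{2,4}(S/L_G)=\binom{n}{2}+\sum_{i\in[n]}\binom{\deg_G(i)}{3}.$$
   Context: Let $\mathbb{K}$ be any field and $S=\mathbb{K}[x_1,\dots,x_n,y_1,\dots,y_n]$ with the standard grading. For a finite simple graph $G$ on $[n]$, the Lovász-Saks-Schrijver (LSS) ideal is $L_G=(x_ix_j+y_iy_j : \{i,j\}\in E(G))\subset S$. A unicyclic graph is a graph containing exactly one cycle; it is odd unicyclic if its girth (the length of that cycle) is odd. $\deg_G(i)$ is the number of neighbours of $i$ in $G$. $\beta_{i,j}(M)$ denotes the $(i,j)$-th graded Betti number of a finitely generated graded $S$-module $M$ (the number of generators of degree $j$ in homological position $i$ of the minimal graded free resolution), and $\beta_i(M)=\sum_j\beta_{i,j}(M)$.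
   Formalization: The graph G is additionally assumed to be connected; for disconnected graphs with exactly one cycle the formula fails, e.g. a triangle plus an isolated vertex has β_2 = 3 while the formula gives 6. *)

theory Defs
  imports "HOL-Library.Cardinality" "HOL-Library.Poly_Mapping" "Jordan_Normal_Form.Matrix_Kernel"
begin

section \<open>Simple graphs\<close>

text \<open>A graph is given by its edge set; the vertex set is the whole finite type \<open>'n\<close>,
  which plays the role of \<open>[n]\<close> with \<open>n = CARD('n)\<close>.\<close>

definition simple_graph :: "'n set set \<Rightarrow> bool" where
  "simple_graph E \<longleftrightarrow> (\<forall>e\<in>E. card e = 2)"

definition vertex_deg :: "'n set set \<Rightarrow> 'n \<Rightarrow> nat" where
  "vertex_deg E i = card {j. {i, j} \<in> E}"

definition connected_graph :: "'n set set \<Rightarrow> bool" where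
  "connected_graph E \<longleftrightarrow> (\<forall>u v. (u, v) \<in> {(a, b). {a, b} \<in> E}\<^sup>*)"

definition closed_edges :: "'n list \<Rightarrow> 'n set set" where
  "closed_edges vs = {{vs ! i, vs ! (Suc i mod length vs)} | i. i < length vs}"

text \<open>A cycle is identified with its edge set, so that the different cyclic vertex sequences
  obtained from one another by rotation and reversal describe the same cycle. Its length is the
  number of its edges.\<close>

definition cycles :: "'n set set \<Rightarrow> 'n set set set" where
  "cycles E = {closed_edges vs | vs. 3 \<le> length vs \<and> distinct vs \<and> closed_edges vs \<subseteq> E}"

definition girth :: "'n set set \<Rightarrow> nat" where
  "girth E = (LEAST l. \<exists>C\<in>cycles E. card C = l)"

definition unicyclic :: "'n set set \<Rightarrow> bool" where
  "unicyclic E \<longleftrightarrow> (\<exists>!C. C \<in> cycles E)"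

text \<open>Unicyclic graphs are usually understood to be connected; here connectedness is a separate
  predicate. It matters for formulas that use that the number of edges equals \<open>n\<close>.\<close>

definition odd_unicyclic :: "'n set set \<Rightarrow> bool" where
  "odd_unicyclic E \<longleftrightarrow> unicyclic E \<and> odd (girth E)"


section \<open>Polynomial rings with the standard grading\<close>

text \<open>\<open>('v, 'k) mpoly\<close> is the polynomial ring over \<open>'k\<close> in variables indexed by \<open>'v\<close>.\<close>

type_synonym ('v, 'k) mpoly = "('v \<Rightarrow>\<^sub>0 nat) \<Rightarrow>\<^sub>0 'k"

definition Var :: "'v \<Rightarrow> ('v, 'k::field) mpoly" where
  "Var v = Poly_Mapping.single (Poly_Mapping.single v 1) 1"

definition mdeg :: "('v \<Rightarrow>\<^sub>0 nat) \<Rightarrow> nat" where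
  "mdeg t = (\<Sum>v\<in>Poly_Mapping.keys t. Poly_Mapping.lookup t v)"

definition ideal_gen :: "('v, 'k::field) mpoly set \<Rightarrow> ('v, 'k) mpoly set" where
  "ideal_gen B = module.span (*) B"

definition irrelevant_ideal :: "('v, 'k::field) mpoly set" where
  "irrelevant_ideal = ideal_gen (range Var)"

text \<open>\<open>homog_map_entry p a b\<close>: multiplication by \<open>p\<close> is a homomorphism \<open>S(-b) \<rightarrow> S(-a)\<close> of
  degree 0, i.e. \<open>p\<close> is homogeneous of degree \<open>b - a\<close> or zero (necessarily zero if \<open>b < a\<close>).\<close>

definition homog_map_entry :: "('v, 'k::field) mpoly \<Rightarrow> nat \<Rightarrow> nat \<Rightarrow> bool" where
  "homog_map_entry p a b \<longleftrightarrow> (\<forall>t\<in>Poly_Mapping.keys p. a + mdeg t = b)"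


section \<open>Minimal graded free resolutions and Betti numbers of \<open>S/I\<close>\<close>

text \<open>Data of a graded complex \<open>\<dots> \<rightarrow> F\<^sub>2 \<rightarrow> F\<^sub>1 \<rightarrow> F\<^sub>0 \<rightarrow> S/I\<close> of finitely generated free modules.
  The list \<open>shifts F i\<close> contains the degrees of the basis elements of
  \<open>F\<^sub>i = \<Oplus>\<^sub>k S(-shifts F i ! k)\<close>; the matrix \<open>differential F i\<close> is the differential
  \<open>F\<^bsub>i+1\<^esub> \<rightarrow> F\<^sub>i\<close>; and \<open>aug F\<close> lists representatives in \<open>S\<close> of the images of the basis
  elements under the augmentation \<open>F\<^sub>0 \<rightarrow> S/I\<close>. For a homogeneous ideal \<open>I\<close> these
  representatives can be taken homogeneous. Degrees are natural numbers because
  \<open>S/I\<close> lives in nonnegative degrees.\<close>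

record (overloaded) ('v, 'k) free_complex =
  shifts :: "nat \<Rightarrow> nat list"
  aug :: "('v, 'k) mpoly vec"
  differential :: "nat \<Rightarrow> ('v, 'k) mpoly mat"

definition free_module :: "('v, 'k::field) free_complex \<Rightarrow> nat \<Rightarrow> ('v, 'k) mpoly vec set" where
  "free_module F i = carrier_vec (length (shifts F i))"

definition graded_complex_data :: "('v, 'k::field) free_complex \<Rightarrow> bool" where
  "graded_complex_data F \<longleftrightarrow>
     aug F \<in> free_module F 0 \<and>
     (\<forall>k < length (shifts F 0). homog_map_entry (aug F $ k) 0 (shifts F 0 ! k)) \<and>
     (\<forall>i. differential F i \<in> carrier_mat (length (shifts F i)) (length (shifts F (Suc i))) \<and>
       (\<forall>k < length (shifts F i). \<forall>l < length (shifts F (Suc i)).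
          homog_map_entry (differential F i $$ (k, l)) (shifts F i ! k) (shifts F (Suc i) ! l)))"

definition image_diff :: "('v, 'k::field) free_complex \<Rightarrow> nat \<Rightarrow> ('v, 'k) mpoly vec set" where
  "image_diff F i = (\<lambda>v. differential F i *\<^sub>v v) ` free_module F (Suc i)"

definition graded_free_resolution ::
    "('v, 'k::field) mpoly set \<Rightarrow> ('v, 'k) free_complex \<Rightarrow> bool" where
  "graded_free_resolution I F \<longleftrightarrow> graded_complex_data F \<and>
     (\<forall>p. \<exists>v\<in>free_module F 0. p - aug F \<bullet> v \<in> I) \<and>
     {v \<in> free_module F 0. aug F \<bullet> v \<in> I} = image_diff F 0 \<and>
     (\<forall>i. mat_kernel (differential F i) = image_diff F (Suc i))"

text \<open>The image of every differential is contained in \<open>\<mm>F\<^sub>i\<close>, where \<open>\<mm>\<close> is the irrelevant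
  ideal. For \<open>i = 0\<close> this includes the minimality of the augmentation.\<close>

definition minimal_graded_free_resolution ::
    "('v, 'k::field) mpoly set \<Rightarrow> ('v, 'k) free_complex \<Rightarrow> bool" where
  "minimal_graded_free_resolution I F \<longleftrightarrow> graded_free_resolution I F \<and>
     (\<forall>i. \<forall>v\<in>image_diff F i. \<forall>k < length (shifts F i). v $ k \<in> irrelevant_ideal)"

text \<open>The graded Betti number \<open>\<beta>\<^sub>i\<^sub>,\<^sub>j(S/I)\<close> of the quotient by a homogeneous ideal \<open>I\<close>. For
  finitely many variables a minimal graded free resolution of \<open>S/I\<close> exists and is unique up
  to isomorphism, so its choice is immaterial.\<close>

definition graded_betti :: "('v, 'k::field) mpoly set \<Rightarrow> nat \<Rightarrow> nat \<Rightarrow> nat" where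
  "graded_betti I i j =
     count_list (shifts (SOME F. minimal_graded_free_resolution I F) i) j"

definition betti :: "('v, 'k::field) mpoly set \<Rightarrow> nat \<Rightarrow> nat" where
  "betti I i = Sum_any (\<lambda>j. graded_betti I i j)"


section \<open>Lovasz-Saks-Schrijver ideals\<close>

text \<open>The variables of \<open>S\<close> are indexed by the disjoint sum \<open>'n + 'n\<close>.\<close>

abbreviation x_var :: "'n \<Rightarrow> ('n + 'n, 'k::field) mpoly" where
  "x_var i \<equiv> Var (Inl i)"

abbreviation y_var :: "'n \<Rightarrow> ('n + 'n, 'k::field) mpoly" where
  "y_var i \<equiv> Var (Inr i)"

definition LSS_ideal :: "'n set set \<Rightarrow> ('n + 'n, 'k::field) mpoly set" where
  "LSS_ideal E = ideal_gen {x_var i * x_var j + y_var i * y_var j | i j. {i, j} \<in> E}"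

end

theory Submission
  imports Defs "HOL-Library.Function_Algebras"
begin

text \<open>
  Order the edges as a spanning tree grown leaf by leaf, followed by the edge that closes the odd
  cycle. Then each edge \<open>{a, b}\<close> joins two vertices of equal colour in a 2-colouring of the
  earlier edges. Rotating one colour class turns the earlier generators into the 2-minors of a
  binomial edge ideal, while \<open>f = x\<^sub>a x\<^sub>b + y\<^sub>a y\<^sub>b\<close> is unchanged. After
  completing the neighbourhoods of \<open>a\<close> and \<open>b\<close> to cliques, both vertices are simplicial, so
  they avoid every cut set in the prime decomposition of the ideal and \<open>f\<close> is a nonzerodivisor
  modulo it, in every characteristic. Hence the colon ideal of the earlier generators by \<open>f\<close> is
  generated by them and the determinants of pairs of neighbours of \<open>a\<close> or of \<open>b\<close>: the
  first syzygies are the Koszul syzygies, one for each pair of edges, and the Pluecker relations of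
  the claws. Their leading entries have distinct vertex supports (there is no 4-cycle), so they
  are minimal generators, all of degree 4.
\<close>

text \<open>No single 2-colouring serves all edges, since the graph has an odd cycle; the colouring
  is therefore chosen anew for every edge and has to fit the earlier edges only. The prime
  decomposition is not written out: Ohtani's lemma is applied at one non-simplicial vertex at a
  time, until only disjoint cliques remain and the ideal is the kernel of a map to a domain. The
  Betti numbers are defined through a resolution taken by Hilbert choice. So a minimal graded free
  resolution has to be shown to exist, and its shifts in position 2 have to be the same for every
  choice. All generators have degree 2 and all minimal first syzygies degree 4; hence base changes
  between minimal systems are invertible matrices of constants, which keeps the comparison
  elementary. Count: an edge preceded by k others contributes k Koszul syzygies and, at each of its
  ends of current degree d, \<open>d choose 2\<close> claws. Pascal's rule sums these to the two
  binomial terms; connectedness enters because a connected unicyclic graph has exactly n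
  edges.\<close>

abbreviation "lookup \<equiv> Poly_Mapping.lookup"
abbreviation "keys \<equiv> Poly_Mapping.keys"
abbreviation "single \<equiv> Poly_Mapping.single"

section \<open>Polynomials over finitely many variables\<close>

lemma mdeg_UNIV: "mdeg (t :: 'v::finite \<Rightarrow>\<^sub>0 nat) = (\<Sum>v\<in>UNIV. lookup t v)"
  unfolding mdeg_def by (rule sum.mono_neutral_left) (auto simp: in_keys_iff)

lemma mdeg_zero [simp]: "mdeg 0 = 0"
  by (simp add: mdeg_def)

lemma mdeg_add [simp]: "mdeg (s + t) = mdeg s + mdeg (t :: 'v::finite \<Rightarrow>\<^sub>0 nat)"
  by (simp add: mdeg_UNIV lookup_add sum.distrib)

lemma mdeg_single [simp]: "mdeg (single v n) = n"
  by (cases "n = 0") (simp_all add: mdeg_def)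

lemma mdeg_eq_0_iff [simp]: "mdeg t = 0 \<longleftrightarrow> t = (0 :: 'v::finite \<Rightarrow>\<^sub>0 nat)"
  by (auto simp: mdeg_UNIV intro!: poly_mapping_eqI)

lemma finite_mdeg_eq: "finite {t :: 'v::finite \<Rightarrow>\<^sub>0 nat. mdeg t = d}"
proof (rule finite_imageD)
  have "lookup ` {t :: 'v \<Rightarrow>\<^sub>0 nat. mdeg t = d} \<subseteq> UNIV \<rightarrow>\<^sub>E {..d}"
  proof (intro image_subsetI PiE_I)
    fix t :: "'v \<Rightarrow>\<^sub>0 nat" and v :: 'v
    assume "t \<in> {t. mdeg t = d}"
    then show "lookup t v \<in> {..d}"
      by (auto simp: mdeg_UNIV member_le_sum)
  qed simp
  then show "finite (lookup ` {t :: 'v \<Rightarrow>\<^sub>0 nat. mdeg t = d})"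
    by (rule finite_subset) (simp add: finite_PiE)
  show "inj_on lookup {t :: 'v \<Rightarrow>\<^sub>0 nat. mdeg t = d}"
    by (rule inj_onI) (simp only: poly_mapping_eq_iff)
qed

lemma poly_mapping_sum_single: "p = (\<Sum>t\<in>keys p. single t (lookup p t))"
proof (rule poly_mapping_eqI)
  fix k
  have "lookup (\<Sum>t\<in>keys p. single t (lookup p t)) k = (\<Sum>t\<in>keys p. if t = k then lookup p t else 0)"
    by (simp add: lookup_sum lookup_single when_def)
  also have "\<dots> = lookup p k"
    by (simp add: in_keys_iff)
  finally show "lookup p k = lookup (\<Sum>t\<in>keys p. single t (lookup p t)) k" ..
qed

lemma mpoly_mult_sum:
  fixes p q :: "('v, 'k::field) mpoly"
  shows "p * q = (\<Sum>s\<in>keys p. \<Sum>t\<in>keys q. single (s + t) (lookup p s * lookup q t))"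
  by (subst (1) poly_mapping_sum_single[of p], subst (1) poly_mapping_sum_single[of q])
     (simp add: sum_product mult_single)

lemma single_eq_Var_mult:
  fixes t :: "'v \<Rightarrow>\<^sub>0 nat"
  assumes "lookup t v \<noteq> 0"
  shows "single t c = Var v * single (t - single v 1) (c::'k::field)"
proof -
  have "single v 1 + (t - single v 1) = t"
    using assms by (intro poly_mapping_eqI) (auto simp: lookup_add lookup_minus lookup_single when_def)
  then show ?thesis by (simp add: Var_def mult_single)
qed

lemma mpoly_induct [case_names Const Var add]:
  fixes p :: "('v::finite, 'k::field) mpoly"
  assumes C: "\<And>c. P (single 0 c)" and V: "\<And>v p. P p \<Longrightarrow> P (Var v * p)"
    and A: "\<And>p q. P p \<Longrightarrow> P q \<Longrightarrow> P (p + q)"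
  shows "P p"
proof -
  have mon: "P (single t c)" for t c
  proof (induction "mdeg t" arbitrary: t)
    case 0
    then have "t = 0" by (metis mdeg_eq_0_iff)
    then show ?case using C by simp
  next
    case (Suc n)
    then obtain v where v: "lookup t v \<noteq> 0"
      by (metis Zero_neq_Suc mdeg_zero poly_mapping_eqI lookup_zero)
    have "single v 1 + (t - single v 1) = t"
      using v by (intro poly_mapping_eqI) (auto simp: lookup_add lookup_minus lookup_single when_def)
    then have "mdeg t = Suc (mdeg (t - single v 1))"
      by (metis mdeg_add mdeg_single plus_1_eq_Suc)
    then show ?case using Suc v by (simp add: single_eq_Var_mult V)
  qed
  have "P (\<Sum>t\<in>A. single t (f t))" if "finite A" for A f
    using that
  proof (induction A rule: finite_induct)
    case empty
    then show ?case using C[of 0] by simp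
  next
    case (insert x F)
    then show ?case by (simp add: A mon)
  qed
  then show ?thesis
    by (subst poly_mapping_sum_single) simp
qed

text \<open>Exponent vectors add up to 0 only if both are 0. Taking constant coefficients is thus
  reduction modulo the irrelevant ideal, on which all minimality arguments run.\<close>

lemma lookup_mult_0:
  fixes p q :: "('v::finite, 'k::field) mpoly"
  shows "lookup (p * q) 0 = lookup p 0 * lookup q 0"
proof (induction p rule: mpoly_induct)
  case (Const c)
  have "lookup (single 0 c * q) 0 = c * lookup q 0"
    by (subst mult_map_scale_conv_mult[symmetric]) (simp add: Poly_Mapping.map.rep_eq when_def)
  then show ?case by simp
next
  case (Var v p)
  have "lookup (Var v * r) 0 = 0" for r :: "('v, 'k) mpoly"
  proof -
    have "0 \<notin> keys (Var v * r)"
    proof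
      assume "0 \<in> keys (Var v * r)"
      then obtain t :: "'v \<Rightarrow>\<^sub>0 nat" where "0 = single v 1 + t"
        using keys_mult[of "Var v" r] by (force simp: Var_def)
      then have "mdeg (0 :: 'v \<Rightarrow>\<^sub>0 nat) = 1 + mdeg t" by (metis mdeg_add mdeg_single)
      then show False by simp
    qed
    then show ?thesis by (simp add: in_keys_iff)
  qed
  then show ?case by (simp add: mult.assoc)
next
  case (add p q)
  then show ?case by (simp add: distrib_right lookup_add)
qed

text \<open>The ring as a module over itself: \<open>im.span\<close> is the generated ideal and
  \<open>im.subspace\<close> means being an ideal.\<close>

interpretation im: module "(*) :: 'a::comm_ring_1 \<Rightarrow> 'a \<Rightarrow> 'a"
  by unfold_locales (auto simp: algebra_simps)

declare im.scale_scale [simp del] \<comment> \<open>reverses \<open>mult.assoc\<close>, so the simplifier would loop\<close>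

lemma irrelevant_ideal_iff:
  fixes p :: "('v::finite, 'k::field) mpoly"
  shows "p \<in> irrelevant_ideal \<longleftrightarrow> lookup p 0 = 0"
proof
  assume "p \<in> irrelevant_ideal"
  then have "p \<in> im.span (range Var)" by (simp add: irrelevant_ideal_def ideal_gen_def)
  then show "lookup p 0 = 0"
  proof (induction rule: im.span_induct_alt)
    case base
    then show ?case by simp
  next
    case (step c x y)
    have "lookup x 0 = 0"
      using step(1) by (auto simp: Var_def lookup_single when_def dest!: arg_cong[where f = mdeg])
    then show ?case using step by (simp add: lookup_add lookup_mult_0)
  qed
next
  assume p: "lookup p 0 = 0"
  have "single t c \<in> im.span (range Var)" if "t \<noteq> 0" for t :: "'v \<Rightarrow>\<^sub>0 nat" and c :: 'k
  proof -
    obtain v where "lookup t v \<noteq> 0" using \<open>t \<noteq> 0\<close> by (metis poly_mapping_eqI lookup_zero)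
    then show ?thesis
      by (subst single_eq_Var_mult, assumption, subst mult.commute)
         (intro im.span_scale im.span_base rangeI)
  qed
  then have "(\<Sum>t\<in>keys p. single t (lookup p t)) \<in> im.span (range Var)"
    using p by (intro im.span_sum) (metis in_keys_iff)
  then show "p \<in> irrelevant_ideal"
    by (simp add: irrelevant_ideal_def ideal_gen_def flip: poly_mapping_sum_single)
qed

subsection \<open>Homogeneous components\<close>

definition homog :: "nat \<Rightarrow> ('v, 'k::field) mpoly \<Rightarrow> bool" where
  "homog d p \<longleftrightarrow> (\<forall>t\<in>keys p. mdeg t = d)"

definition hcomp :: "nat \<Rightarrow> ('v, 'k::field) mpoly \<Rightarrow> ('v, 'k) mpoly" where
  "hcomp d p = (\<Sum>t | t \<in> keys p \<and> mdeg t = d. single t (lookup p t))"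

lemma lookup_hcomp: "lookup (hcomp d p) t = (if mdeg t = d then lookup p t else 0)"
proof -
  have "lookup (hcomp d p) t = (\<Sum>s | s \<in> keys p \<and> mdeg s = d. if s = t then lookup p s else 0)"
    by (simp add: hcomp_def lookup_sum lookup_single when_def)
  also have "\<dots> = (if mdeg t = d then lookup p t else 0)"
    by (auto simp: in_keys_iff)
  finally show ?thesis .
qed

lemma homog_0 [simp]: "homog d 0"
  by (simp add: homog_def)

lemma homog_add: "homog d p \<Longrightarrow> homog d q \<Longrightarrow> homog d (p + q)"
  unfolding homog_def using Poly_Mapping.keys_add[of p q] by blast

lemma homog_minus: "homog d p \<Longrightarrow> homog d (- p)"
  unfolding homog_def by (simp add: in_keys_iff)

lemma homog_diff: "homog d p \<Longrightarrow> homog d q \<Longrightarrow> homog d (p - q)"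
  using homog_add[of d p "- q"] homog_minus[of d q] by simp

lemma homog_mult:
  fixes p q :: "('v::finite, 'k::field) mpoly"
  shows "homog d p \<Longrightarrow> homog e q \<Longrightarrow> homog (d + e) (p * q)"
  unfolding homog_def using keys_mult[of p q] by fastforce

lemma homog_Var: "homog 1 (Var v)"
  by (simp add: homog_def Var_def)

lemma homog_single: "homog d (single t c) \<longleftrightarrow> mdeg t = d \<or> c = 0"
  by (auto simp: homog_def)

lemma homog_hcomp: "homog d (hcomp d p)"
  unfolding homog_def
proof
  fix t
  assume "t \<in> keys (hcomp d p)"
  then have "lookup (hcomp d p) t \<noteq> 0" by (simp only: in_keys_iff not_False_eq_True)
  then show "mdeg t = d" by (metis lookup_hcomp)
qed

lemma hcomp_homog: "homog e p \<Longrightarrow> hcomp d p = (if d = e then p else 0)"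
  by (rule poly_mapping_eqI) (auto simp: lookup_hcomp homog_def in_keys_iff)

lemma hcomp_0 [simp]: "hcomp d 0 = 0"
  by (rule poly_mapping_eqI) (simp add: lookup_hcomp)

lemma hcomp_add: "hcomp d (p + q) = hcomp d p + hcomp d q"
  by (rule poly_mapping_eqI) (simp add: lookup_hcomp lookup_add)

lemma hcomp_sum: "hcomp d (sum f A) = (\<Sum>x\<in>A. hcomp d (f x))"
  by (induction A rule: infinite_finite_induct) (auto simp: hcomp_add)

lemma hcomp_degree_0: "hcomp 0 p = single 0 (lookup (p :: ('v::finite, 'k::field) mpoly) 0)"
  by (rule poly_mapping_eqI) (auto simp: lookup_hcomp lookup_single when_def)

text \<open>Multiplication by a homogeneous \<open>q\<close> shifts degrees by \<open>e\<close>. The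
  guard \<open>e \<le> d\<close> is needed because \<open>d - e\<close> is truncated
  subtraction.\<close>

lemma hcomp_mult:
  fixes p q :: "('v::finite, 'k::field) mpoly"
  assumes q: "homog e q"
  shows "hcomp d (p * q) = (if e \<le> d then hcomp (d - e) p * q else 0)"
proof -
  have *: "hcomp d (single t c * q) = (if d = mdeg t + e then single t c * q else 0)" for t c
    by (rule hcomp_homog) (intro homog_mult q, simp add: homog_single)
  have "p * q = (\<Sum>t\<in>keys p. single t (lookup p t) * q)"
    by (subst (1) poly_mapping_sum_single[of p]) (simp add: sum_distrib_right)
  then have "hcomp d (p * q) = (\<Sum>t\<in>keys p. if d = mdeg t + e then single t (lookup p t) * q else 0)"
    by (simp add: hcomp_sum *)
  also have "\<dots> = (if e \<le> d then hcomp (d - e) p * q else 0)"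
  proof (cases "e \<le> d")
    case True
    then have "(\<Sum>t\<in>keys p. if d = mdeg t + e then single t (lookup p t) * q else 0)
      = (\<Sum>t\<in>keys p. if mdeg t = d - e then single t (lookup p t) * q else 0)"
      by (intro sum.cong) auto
    also have "\<dots> = hcomp (d - e) p * q"
      unfolding hcomp_def sum_distrib_right by (subst sum.inter_filter) auto
    finally show ?thesis using True by simp
  qed auto
  finally show ?thesis .
qed

lemma homog_map_entry_iff: "homog_map_entry p a b \<longleftrightarrow> p = 0 \<or> a \<le> b \<and> homog (b - a) p"
proof
  assume *: "homog_map_entry p a b"
  show "p = 0 \<or> a \<le> b \<and> homog (b - a) p"
  proof (cases "p = 0")
    case False
    then obtain t where "t \<in> keys p" by (metis keys_eq_empty all_not_in_conv)
    with * show ?thesis by (auto simp: homog_map_entry_def homog_def)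
  qed simp
next
  assume "p = 0 \<or> a \<le> b \<and> homog (b - a) p"
  then show "homog_map_entry p a b" by (auto simp: homog_map_entry_def homog_def)
qed

subsection \<open>Substitution homomorphisms\<close>

definition subst :: "('v \<Rightarrow> ('w, 'k) mpoly) \<Rightarrow> ('v::finite, 'k::field) mpoly \<Rightarrow> ('w, 'k) mpoly" where
  "subst h p = (\<Sum>t\<in>keys p. single 0 (lookup p t) * (\<Prod>v\<in>UNIV. h v ^ lookup t v))"

lemma subst_superset:
  assumes "finite A" "keys p \<subseteq> A"
  shows "subst h p = (\<Sum>t\<in>A. single 0 (lookup p t) * (\<Prod>v\<in>UNIV. h v ^ lookup t v))"
  unfolding subst_def using assms by (intro sum.mono_neutral_left) (auto simp: in_keys_iff)

lemma subst_0 [simp]: "subst h 0 = 0"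
  by (simp add: subst_def)

lemma subst_add [simp]: "subst h (p + q) = subst h p + subst h q"
proof -
  have fin: "finite (keys p \<union> keys q)" by simp
  show ?thesis
    by (simp add: subst_superset[OF fin, of p] subst_superset[OF fin, of q]
        subst_superset[OF fin, of "p + q"] Poly_Mapping.keys_add lookup_add single_add
        distrib_right sum.distrib)
qed

lemma subst_uminus [simp]: "subst h (- p) = - subst h p"
  using subst_add[of h p "- p"] by (simp add: eq_neg_iff_add_eq_0 add.commute)

lemma subst_diff [simp]: "subst h (p - q) = subst h p - subst h q"
  using subst_add[of h p "- q"] by simp

lemma subst_sum: "subst h (sum f A) = (\<Sum>x\<in>A. subst h (f x))"
  by (induction A rule: infinite_finite_induct) auto

lemma subst_single: "subst h (single t c) = single 0 c * (\<Prod>v\<in>UNIV. h v ^ lookup t v)"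
  by (cases "c = 0") (simp_all add: subst_def)

lemma subst_Const [simp]: "subst h (single 0 c) = single 0 c"
  by (simp add: subst_single)

lemma Const_mult: "single 0 (a * b) = single 0 a * (single 0 b :: ('v, 'k::field) mpoly)"
  by (simp add: mult_single)

lemma subst_mult [simp]: "subst h (p * q) = subst h p * subst h q"
proof -
  have "subst h (p * q) = (\<Sum>s\<in>keys p. \<Sum>t\<in>keys q. subst h (single (s + t) (lookup p s * lookup q t)))"
    by (simp add: mpoly_mult_sum subst_sum)
  also have "\<dots> = subst h p * subst h q"
    unfolding subst_def[of h p] subst_def[of h q] sum_product subst_single lookup_add power_add prod.distrib Const_mult
    by (simp only: mult.assoc mult.left_commute)
  finally show ?thesis .
qed

lemma subst_Var [simp]: "subst h (Var v) = h v"
proof -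
  have "(\<Prod>w\<in>UNIV. h w ^ lookup (single v 1) w) = (\<Prod>w\<in>UNIV. if w = v then h w else 1)"
    by (rule prod.cong) (auto simp: lookup_single when_def)
  then show ?thesis by (simp add: Var_def subst_single)
qed

lemma subst_subst:
  fixes p :: "('v::finite, 'k::field) mpoly" and g :: "'v \<Rightarrow> ('w::finite, 'k) mpoly"
  assumes "\<And>v. subst h (g v) = h' v"
  shows "subst h (subst g p) = subst h' p"
  by (induction p rule: mpoly_induct) (simp_all add: assms)

lemma subst_Var_id [simp]: "subst Var p = p"
  by (induction p rule: mpoly_induct) simp_all

lemma subst_in_span:
  assumes "p \<in> im.span B"
  shows "subst h p \<in> im.span (subst h ` B)"
  using assms
  by (induction rule: im.span_induct_alt)
     (auto intro: im.span_add im.span_scale im.span_base im.span_zero)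

text \<open>A substitution that is the identity on variables modulo an ideal is the identity on all
  polynomials modulo it.\<close>

lemma diff_subst_in_span:
  fixes p :: "('v::finite, 'k::field) mpoly"
  assumes "\<And>v. Var v - h v \<in> im.span B"
  shows "p - subst h p \<in> im.span B"
proof (induction p rule: mpoly_induct)
  case (Const c)
  then show ?case by (simp add: im.span_zero)
next
  case (Var v p)
  have "Var v * p - subst h (Var v * p) = Var v * (p - subst h p) + subst h p * (Var v - h v)"
    by (simp add: algebra_simps)
  then show ?case
    using im.span_add[OF im.span_scale[OF Var] im.span_scale[OF assms]] by metis
next
  case (add p q)
  have "p + q - subst h (p + q) = (p - subst h p) + (q - subst h q)" by simp
  then show ?case using add by (metis im.span_add)
qed

section \<open>Colon ideals\<close>

definition det_poly :: "'n \<Rightarrow> 'n \<Rightarrow> ('n + 'n, 'k::field) mpoly" where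
  "det_poly i j = x_var i * y_var j - x_var j * y_var i"

definition dot_poly :: "'n \<Rightarrow> 'n \<Rightarrow> ('n + 'n, 'k::field) mpoly" where
  "dot_poly i j = x_var i * x_var j + y_var i * y_var j"

text \<open>The binomial edge ideal of \<open>R\<close> together with the variables of the deleted
  vertices \<open>D\<close>: the shape stable under both operations of Ohtani's lemma, completing a
  neighbourhood and deleting a vertex.\<close>

definition det_ideal :: "'n set \<Rightarrow> ('n \<times> 'n) set \<Rightarrow> ('n + 'n, 'k::field) mpoly set" where
  "det_ideal D R = im.span (x_var ` D \<union> y_var ` D \<union> (\<lambda>(i, j). det_poly i j) ` R)"

lemma dot_poly_commute: "dot_poly i j = dot_poly j i"
  by (simp add: dot_poly_def mult.commute)

lemma det_poly_self [simp]: "det_poly i i = 0"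
  by (simp add: det_poly_def)

lemma det_poly_swap: "det_poly i j = - det_poly j i"
  by (simp add: det_poly_def)

lemma det_ideal_mono: "D \<subseteq> D' \<Longrightarrow> R \<subseteq> R' \<Longrightarrow> det_ideal D R \<subseteq> det_ideal D' R'"
  unfolding det_ideal_def by (intro im.span_mono) blast

lemma det_poly_in_det_ideal: "(i, j) \<in> R \<Longrightarrow> det_poly i j \<in> det_ideal D R"
  unfolding det_ideal_def by (intro im.span_base) force

lemma Var_in_det_ideal: "i \<in> D \<Longrightarrow> x_var i \<in> det_ideal D R" "i \<in> D \<Longrightarrow> y_var i \<in> det_ideal D R"
  unfolding det_ideal_def by (intro im.span_base; force)+

lemma det_ideal_subspace: "im.subspace (det_ideal D R)"
  by (simp add: det_ideal_def)

lemmas det_ideal_add = im.subspace_add[OF det_ideal_subspace]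
lemmas det_ideal_diff = im.subspace_diff[OF det_ideal_subspace]
lemmas det_ideal_scale = im.subspace_scale[OF det_ideal_subspace]
lemmas det_ideal_zero = im.subspace_0[OF det_ideal_subspace]
lemmas det_ideal_sum = im.subspace_sum[OF det_ideal_subspace]

text \<open>For reflexive \<open>R\<close> this is a closed neighbourhood in the graph without
  \<open>D\<close>, so \<open>simplicial\<close> says that it is a clique.\<close>

definition nbrs :: "'n set \<Rightarrow> ('n \<times> 'n) set \<Rightarrow> 'n \<Rightarrow> 'n set" where
  "nbrs D R q = {j. j \<notin> D \<and> (q, j) \<in> R}"

definition simplicial :: "'n set \<Rightarrow> ('n \<times> 'n) set \<Rightarrow> 'n \<Rightarrow> bool" where
  "simplicial D R q \<longleftrightarrow> nbrs D R q \<times> nbrs D R q \<subseteq> R"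

text \<open>Expansions of 3 by 3 determinants with a repeated row.\<close>

lemma pluecker:
  fixes x y x1 y1 x2 y2 :: "'a::comm_ring_1"
  shows "x * (x1 * y2 - x2 * y1) = x1 * (x * y2 - x2 * y) - x2 * (x * y1 - x1 * y)"
    and "y * (x1 * y2 - x2 * y1) = y1 * (x * y2 - x2 * y) - y2 * (x * y1 - x1 * y)"
  by (simp_all add: algebra_simps)

text \<open>By \<open>pluecker\<close>, a variable of \<open>q\<close> times
  \<open>det_poly j k\<close> is a combination of \<open>det_poly q j\<close> and
  \<open>det_poly q k\<close>, which already lie in the ideal.\<close>

lemma det_ideal_vertex_mult:
  fixes p :: "('n::finite + 'n, 'k::field) mpoly"
  assumes "sym R" "j \<in> nbrs D R q" "k \<in> nbrs D R q"
    and p: "p \<in> im.span {x_var q, y_var q}"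
  shows "p * det_poly j k \<in> det_ideal D R"
  using p
proof (induction rule: im.span_induct_alt)
  case base
  then show ?case by (simp add: det_ideal_zero)
next
  case (step c v p)
  have qj: "det_poly q j \<in> det_ideal D R" "det_poly q k \<in> det_ideal D R"
    using assms(2,3) by (auto simp: nbrs_def intro: det_poly_in_det_ideal)
  have eq: "x_var q * det_poly j k = x_var j * det_poly q k - x_var k * det_poly q j"
    "y_var q * det_poly j k = y_var j * det_poly q k - y_var k * det_poly q j"
    unfolding det_poly_def by (rule pluecker)+
  have "x_var q * det_poly j k \<in> det_ideal D R" "y_var q * det_poly j k \<in> det_ideal D R"
    unfolding eq by (intro det_ideal_diff det_ideal_scale qj)+
  then have "v * det_poly j k \<in> det_ideal D R"
    using step(1) by blast
  moreover have "(c * v + p) * det_poly j k = c * (v * det_poly j k) + p * det_poly j k"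
    by (simp only: distrib_right mult.assoc)
  ultimately show ?case
    using step(2) by (simp add: det_ideal_add det_ideal_scale)
qed

text \<open>Ohtani's lemma for binomial edge ideals. The new generators are annihilated by the variables
  of \<open>q\<close>, so modulo the ideal one may set these variables to zero in their coefficients.\<close>

lemma det_ideal_Int:
  fixes h :: "('n::finite + 'n, 'k::field) mpoly"
  assumes R: "sym R"
    and h1: "h \<in> det_ideal D (R \<union> nbrs D R q \<times> nbrs D R q)" and h2: "h \<in> det_ideal (insert q D) R"
  shows "h \<in> det_ideal D R"
proof -
  define e :: "'n + 'n \<Rightarrow> ('n + 'n, 'k) mpoly"
    where "e v = (if v = Inl q \<or> v = Inr q then 0 else Var v)" for v
  have e_simps: "e (Inl i) = (if i = q then 0 else x_var i)" "e (Inr i) = (if i = q then 0 else y_var i)" for i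
    by (auto simp: e_def)
  have diff_e: "p - subst e p \<in> im.span {x_var q, y_var q}" for p
    by (rule diff_subst_in_span) (auto simp: e_def im.span_zero intro: im.span_base)
  have e_e: "subst e (subst e p) = subst e p" for p
    by (rule subst_subst) (simp add: e_def)
  have det_e: "subst e (det_poly i j) = (if i = q \<or> j = q then 0 else det_poly i j)" for i j
    by (simp add: det_poly_def e_simps)
  \<comment> \<open>\<open>h0\<close> collects the new determinants with the variables of
    \<open>q\<close> set to zero in their coefficients, so it is free of these variables.\<close>
  have "\<exists>h0. subst e h0 = h0 \<and> h - h0 \<in> det_ideal D R"
    using h1[unfolded det_ideal_def]
  proof (induction rule: im.span_induct_alt)
    case base
    show ?case by (intro exI[of _ 0]) (simp add: det_ideal_zero)
  next
    case (step c x y)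
    then obtain h0 where h0: "subst e h0 = h0" "y - h0 \<in> det_ideal D R" by blast
    show ?case
    proof (cases "x \<in> det_ideal D R")
      case True
      have "c * x + y - h0 = c * x + (y - h0)" by simp
      then show ?thesis using h0 True by (metis det_ideal_add det_ideal_scale)
    next
      case False
      then obtain j k where x: "x = det_poly j k" "j \<in> nbrs D R q" "k \<in> nbrs D R q"
        using step(1) by (auto simp: Var_in_det_ideal intro: det_poly_in_det_ideal)
      have "j \<noteq> q" "k \<noteq> q"
        using False x R by (auto simp: nbrs_def intro: det_poly_in_det_ideal dest: symD)
      then have "subst e (subst e c * x + h0) = subst e c * x + h0"
        using x(1) by (simp add: e_e h0(1) det_e)
      moreover have "c * x + y - (subst e c * x + h0) = (c - subst e c) * x + (y - h0)"
        by (simp add: algebra_simps)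
      moreover have "(c - subst e c) * x \<in> det_ideal D R"
        unfolding x(1) by (rule det_ideal_vertex_mult[OF R x(2,3) diff_e])
      ultimately show ?thesis using h0(2) by (metis det_ideal_add)
    qed
  qed
  then obtain h0 where h0: "subst e h0 = h0" "h - h0 \<in> det_ideal D R" by blast
  have "h - h0 \<in> det_ideal (insert q D) R"
    using h0(2) det_ideal_mono[of D "insert q D" R R] by blast
  then have "h - (h - h0) \<in> det_ideal (insert q D) R"
    by (rule det_ideal_diff[OF h2])
  then have "h0 \<in> det_ideal (insert q D) R" by simp
  \<comment> \<open>Setting the variables of \<open>q\<close> to zero fixes \<open>h0\<close>, kills
    the generators that involve \<open>q\<close>, and leaves the others, which belong to
    \<open>det_ideal D R\<close>.\<close>
  then have "subst e h0 \<in> im.span (subst e ` (x_var ` insert q D \<union> y_var ` insert q D \<union> (\<lambda>(i, j). det_poly i j) ` R))"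
    unfolding det_ideal_def by (rule subst_in_span)
  also have "\<dots> \<subseteq> det_ideal D R"
    by (rule im.span_minimal[OF _ det_ideal_subspace])
       (auto simp: e_simps det_e det_ideal_zero Var_in_det_ideal det_poly_in_det_ideal)
  finally have "(h - h0) + h0 \<in> det_ideal D R"
    using h0 by (metis det_ideal_add)
  then show ?thesis by simp
qed

section \<open>Disjoint cliques: monomial maps to a domain\<close>

lemma single_power: "single e (1::'k::field) ^ n = single (\<Sum>k<n. e) (1 :: 'k)"
  by (induction n) (simp_all add: mult_single add.commute)

lemma prod_single: "(\<Prod>v\<in>A. single (f v) (1::'k::field)) = single (\<Sum>v\<in>A. f v) 1"
  by (induction A rule: infinite_finite_induct) (simp_all add: mult_single)

lemma single_sum: "single m (sum f A) = (\<Sum>t\<in>A. single m (f t))"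
  by (induction A rule: infinite_finite_induct) (simp_all add: single_add)

lemma sum_UNIV_Plus:
  fixes f :: "'n::finite + 'n \<Rightarrow> nat"
  shows "(\<Sum>v\<in>UNIV. f v) = (\<Sum>i\<in>UNIV. f (Inl i)) + (\<Sum>i\<in>UNIV. f (Inr i))"
  by (simp add: sum.Plus flip: UNIV_Plus_UNIV)

abbreviation vertex :: "'n + 'n \<Rightarrow> 'n" where
  "vertex \<equiv> case_sum (\<lambda>i. i) (\<lambda>i. i)"

text \<open>For an equivalence relation the ideal is the kernel of the monomial map
  \<open>x\<^sub>i \<mapsto> t\<^sub>i p\<^bsub>[i]\<^esub>\<close>, \<open>y\<^sub>i \<mapsto> t\<^sub>i\<close> to a domain, where \<open>[i]\<close> is the class of \<open>i\<close>.\<close>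

lemma dot_poly_nzd_equiv:
  fixes h :: "('n::finite + 'n, 'k::field) mpoly"
  assumes reflR: "Id \<subseteq> R" and sym: "sym R"
    and trans: "\<And>i j k. i \<notin> D \<Longrightarrow> j \<notin> D \<Longrightarrow> k \<notin> D \<Longrightarrow> (i, j) \<in> R \<Longrightarrow> (j, k) \<in> R \<Longrightarrow> (i, k) \<in> R"
    and ab: "a \<notin> D" "b \<notin> D"
    and h: "dot_poly a b * h \<in> det_ideal D R"
  shows "h \<in> det_ideal D R"
proof -
  \<comment> \<open>Numbering the variables gives the target ring exponents over \<open>nat\<close>,
    whose linear order excludes zero divisors. \<open>idx (Inl i)\<close> plays the role of t_i, and
    \<open>idx (Inr r)\<close> that of p_r.\<close>
  obtain idx :: "'n + 'n \<Rightarrow> nat" where idx: "inj idx"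
    using finite_imp_inj_to_nat_seg[of "UNIV :: ('n + 'n) set"] by (metis finite)
  have idx_eq [simp]: "idx u = idx v \<longleftrightarrow> u = v" for u v
    using idx by (simp add: inj_eq)
  define rep where "rep i = (SOME j. j \<notin> D \<and> (i, j) \<in> R)" for i
  have rep: "rep i \<notin> D \<and> (i, rep i) \<in> R" if "i \<notin> D" for i
    unfolding rep_def by (rule someI[of _ i]) (use that reflR in auto)
  have rep_eq: "rep i = rep j \<longleftrightarrow> (i, j) \<in> R" if "i \<notin> D" "j \<notin> D" for i j
  proof
    assume "rep i = rep j"
    then show "(i, j) \<in> R" using rep[OF that(1)] rep[OF that(2)] trans that sym
      by (metis symD)
  next
    assume ij: "(i, j) \<in> R"
    have ji: "(j, i) \<in> R" using ij sym by (rule symD[rotated])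
    have "(\<lambda>k. k \<notin> D \<and> (i, k) \<in> R) = (\<lambda>k. k \<notin> D \<and> (j, k) \<in> R)"
      by (intro ext conj_cong refl iffI) (auto intro: trans[OF that(2,1) _ ji] trans[OF that _ ij])
    then show "rep i = rep j" by (simp add: rep_def)
  qed
  define E :: "'n + 'n \<Rightarrow> nat \<Rightarrow>\<^sub>0 nat" where
    "E v = (case v of Inl i \<Rightarrow> single (idx (Inl i)) 1 + single (idx (Inr (rep i))) 1
      | Inr i \<Rightarrow> single (idx (Inl i)) 1)" for v
  define F :: "'n + 'n \<Rightarrow> (nat, 'k) mpoly" where
    "F v = (if vertex v \<in> D then 0 else single (E v) 1)" for v
  define good :: "('n + 'n \<Rightarrow>\<^sub>0 nat) \<Rightarrow> bool" where
    "good t \<longleftrightarrow> (\<forall>v. vertex v \<in> D \<longrightarrow> lookup t v = 0)" for t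
  define \<mu> :: "('n + 'n \<Rightarrow>\<^sub>0 nat) \<Rightarrow> nat \<Rightarrow>\<^sub>0 nat" where
    "\<mu> t = (\<Sum>v\<in>UNIV. \<Sum>k<lookup t v. E v)" for t
  have lookup_\<mu>: "lookup (\<mu> t) m = (\<Sum>v\<in>UNIV. lookup t v * lookup (E v) m)" for t m
    unfolding \<mu>_def lookup_sum by simp
  have \<mu>_add: "\<mu> (s + t) = \<mu> s + \<mu> t" for s t
    by (rule poly_mapping_eqI) (simp add: lookup_\<mu> lookup_add distrib_right sum.distrib)
  have \<mu>_single: "\<mu> (single v 1) = E v" for v
  proof (rule poly_mapping_eqI)
    fix m
    have "lookup (\<mu> (single v 1)) m = (\<Sum>w\<in>UNIV. if w = v then lookup (E w) m else 0)"
      unfolding lookup_\<mu> by (rule sum.cong) (auto simp: lookup_single when_def)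
    then show "lookup (\<mu> (single v 1)) m = lookup (E v) m" by simp
  qed
  have E_Inl_at: "lookup (E (Inl j)) (idx (Inl i)) = (if j = i then 1 else 0)"
    "lookup (E (Inr j)) (idx (Inl i)) = (if j = i then 1 else 0)" for i j
    by (simp_all add: E_def lookup_add lookup_single)
  have lookup_\<mu>_Inl: "lookup (\<mu> t) (idx (Inl i)) = lookup t (Inl i) + lookup t (Inr i)" for t i
    by (simp add: lookup_\<mu> sum_UNIV_Plus E_Inl_at if_distrib[where f = "(*) _"] cong: if_cong)
  have lookup_\<mu>_Inr: "lookup (\<mu> t) (idx (Inr r)) = (\<Sum>j | rep j = r. lookup t (Inl j))" for t r
    by (simp add: lookup_\<mu> sum_UNIV_Plus E_def lookup_add lookup_single when_def if_distrib
        sum.If_cases cong: if_cong)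
  have subst_F: "subst F (single t c) = (if good t then single (\<mu> t) c else 0)" for t c
  proof (cases "good t")
    case True
    have "(\<Prod>v\<in>UNIV. F v ^ lookup t v) = (\<Prod>v\<in>UNIV. single (\<Sum>k<lookup t v. E v) 1)"
    proof (rule prod.cong[OF refl])
      fix v :: "'n + 'n"
      show "F v ^ lookup t v = single (\<Sum>k<lookup t v. E v) 1"
        using True by (cases "vertex v \<in> D") (simp_all add: F_def good_def single_power)
    qed
    then show ?thesis using True by (simp add: subst_single prod_single \<mu>_def mult_single)
  next
    case False
    then obtain v where "vertex v \<in> D" "lookup t v \<noteq> 0" by (auto simp: good_def)
    then have "F v ^ lookup t v = 0" by (simp add: F_def)
    then have "(\<Prod>v\<in>UNIV. F v ^ lookup t v) = 0" by (meson UNIV_I finite prod_zero)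
    then show ?thesis using False by (simp add: subst_single)
  qed
  \<comment> \<open>Equal images mean equal x-plus-y exponents at each vertex and equal x-exponent
    sums on each class. The induction is on the total surplus of x-exponents of \<open>t\<close>
    over \<open>t'\<close>; without surplus the class sums force \<open>t = t'\<close>.\<close>
  have exchange: "single t c - single t' c \<in> det_ideal D R" if "good t" "good t'" "\<mu> t = \<mu> t'" for t t' c
    using that
  proof (induction "\<Sum>i\<in>UNIV. lookup t (Inl i) - lookup t' (Inl i)" arbitrary: t rule: less_induct)
    case less
    have tot: "lookup t (Inl i) + lookup t (Inr i) = lookup t' (Inl i) + lookup t' (Inr i)" for i
      using lookup_\<mu>_Inl[of t i] lookup_\<mu>_Inl[of t' i] less.prems(3) by simp
    have cls: "(\<Sum>j | rep j = r. lookup t (Inl j)) = (\<Sum>j | rep j = r. lookup t' (Inl j))" for r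
      using lookup_\<mu>_Inr[of t r] lookup_\<mu>_Inr[of t' r] less.prems(3) by simp
    show ?case
    proof (cases "\<exists>i. lookup t (Inl i) > lookup t' (Inl i)")
      case False
      then have le: "lookup t (Inl i) \<le> lookup t' (Inl i)" for i by (simp add: not_less)
      have eq: "lookup t (Inl i) = lookup t' (Inl i)" for i
      proof (rule ccontr)
        assume "lookup t (Inl i) \<noteq> lookup t' (Inl i)"
        then have "(\<Sum>j | rep j = rep i. lookup t (Inl j)) < (\<Sum>j | rep j = rep i. lookup t' (Inl j))"
          using le by (intro sum_strict_mono_ex1) (auto simp: order_less_le)
        then show False using cls by simp
      qed
      have "t = t'"
      proof (rule poly_mapping_eqI)
        fix v :: "'n + 'n"
        show "lookup t v = lookup t' v"
        proof (cases v)
          case (Inr i)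
          then show ?thesis using eq[of i] tot[of i] by simp
        qed (simp add: eq)
      qed
      then show ?thesis by (simp add: det_ideal_zero)
    next
      case True
      then obtain i where i: "lookup t (Inl i) > lookup t' (Inl i)" by blast
      have "\<exists>j. rep j = rep i \<and> lookup t (Inl j) < lookup t' (Inl j)"
      proof (rule ccontr)
        assume "\<not> ?thesis"
        then have "(\<Sum>j | rep j = rep i. lookup t' (Inl j)) < (\<Sum>j | rep j = rep i. lookup t (Inl j))"
          using i by (intro sum_strict_mono_ex1) (auto simp: not_less)
        then show False using cls by simp
      qed
      then obtain j where j: "rep j = rep i" "lookup t (Inl j) < lookup t' (Inl j)" by blast
      have "i \<noteq> j" using i j by auto
      have iD: "i \<notin> D" using i less.prems(1) by (auto simp: good_def)
      have jD: "j \<notin> D" using j less.prems(2) by (auto simp: good_def)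
      have ijR: "(i, j) \<in> R" using rep_eq[OF iD jD] j(1) by simp
      \<comment> \<open>A factor x_i y_j of \<open>t\<close> is traded for x_j y_i. This costs a
        multiple of \<open>det_poly i j\<close>, keeps the image, and lowers the surplus.\<close>
      define w where "w = t - (single (Inl i) 1 + single (Inr j) 1)"
      define t2 where "t2 = w + single (Inl j) 1 + single (Inr i) 1"
      have "lookup t (Inr j) > 0" using tot[of j] j(2) by linarith
      then have t: "t = w + single (Inl i) 1 + single (Inr j) 1"
        using i by (intro poly_mapping_eqI)
          (auto simp: w_def lookup_add lookup_minus lookup_single when_def)
      have "single t c - single t2 c = single w c * det_poly i j"
        by (simp add: t t2_def det_poly_def Var_def mult_single right_diff_distrib add.assoc)
      then have 1: "single t c - single t2 c \<in> det_ideal D R"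
        using ijR by (simp add: det_ideal_scale det_poly_in_det_ideal)
      have "E (Inl i) + E (Inr j) = E (Inl j) + E (Inr i)"
        using j(1) by (simp add: E_def ac_simps)
      then have \<mu>2: "\<mu> t2 = \<mu> t"
        unfolding t t2_def \<mu>_add \<mu>_single by (simp add: add.assoc)
      have good2: "good t2"
        unfolding good_def
      proof (intro allI impI)
        fix v :: "'n + 'n"
        assume v: "vertex v \<in> D"
        then have "lookup t v = 0" using less.prems(1) by (simp add: good_def)
        then show "lookup t2 v = 0"
          using v iD jD unfolding t t2_def by (cases v) (auto simp: lookup_add lookup_single when_def)
      qed
      have l2: "lookup t2 (Inl k) + (if k = i then 1 else 0) = lookup t (Inl k) + (if k = j then 1 else 0)" for k
        unfolding t t2_def by (simp add: lookup_add lookup_single when_def)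
      have "(\<Sum>i\<in>UNIV. lookup t2 (Inl i) - lookup t' (Inl i)) < (\<Sum>i\<in>UNIV. lookup t (Inl i) - lookup t' (Inl i))"
      proof (rule sum_strict_mono_ex1)
        show "\<forall>k\<in>UNIV. lookup t2 (Inl k) - lookup t' (Inl k) \<le> lookup t (Inl k) - lookup t' (Inl k)"
        proof
          fix k
          show "lookup t2 (Inl k) - lookup t' (Inl k) \<le> lookup t (Inl k) - lookup t' (Inl k)"
            using l2[of k] j(2) by (auto split: if_splits)
        qed
        show "\<exists>k\<in>UNIV. lookup t2 (Inl k) - lookup t' (Inl k) < lookup t (Inl k) - lookup t' (Inl k)"
          using l2[of i] i \<open>i \<noteq> j\<close> by (intro bexI[of _ i]) auto
      qed simp
      then have "single t2 c - single t' c \<in> det_ideal D R"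
        using less.hyps good2 less.prems \<mu>2 by simp
      from det_ideal_add[OF 1 this] show ?thesis by simp
    qed
  qed
  \<comment> \<open>In each fibre of \<open>\<mu>\<close> the coefficients of \<open>p\<close> sum
    to zero, so replacing every monomial by the representative \<open>\<rho>\<close> of its fibre
    turns the good part of \<open>p\<close> into 0, at the cost of \<open>exchange\<close>
    differences.\<close>
  have kernel: "p \<in> det_ideal D R" if p0: "subst F p = 0" for p
  proof -
    define K where "K = {t \<in> keys p. good t}"
    define \<rho> where "\<rho> m = (SOME t. t \<in> K \<and> \<mu> t = m)" for m
    have \<rho>: "\<rho> (\<mu> t) \<in> K \<and> \<mu> (\<rho> (\<mu> t)) = \<mu> t" if "t \<in> K" for t
      unfolding \<rho>_def by (rule someI[of _ t]) (use that in simp)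
    have finK: "finite K" by (simp add: K_def)
    have zero: "(\<Sum>t | t \<in> K \<and> \<mu> t = m. lookup p t) = 0" for m
    proof -
      have "subst F p = (\<Sum>t\<in>keys p. if good t then single (\<mu> t) (lookup p t) else 0)"
        by (subst poly_mapping_sum_single) (simp add: subst_sum subst_F)
      also have "\<dots> = (\<Sum>t\<in>K. single (\<mu> t) (lookup p t))"
        unfolding K_def by (rule sum.inter_filter[symmetric]) simp
      finally have "lookup (\<Sum>t\<in>K. single (\<mu> t) (lookup p t)) m = 0" using p0 by simp
      then have "(\<Sum>t\<in>K. if \<mu> t = m then lookup p t else 0) = 0"
        by (simp add: lookup_sum lookup_single when_def)
      then show ?thesis using finK by (simp add: sum.inter_filter)
    qed
    have "(\<Sum>t\<in>K. single (\<rho> (\<mu> t)) (lookup p t))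
      = (\<Sum>m\<in>\<mu> ` K. \<Sum>t | t \<in> K \<and> \<mu> t = m. single (\<rho> (\<mu> t)) (lookup p t))"
      by (rule sum.image_gen[OF finK])
    also have "\<dots> = (\<Sum>m\<in>\<mu> ` K. single (\<rho> m) (\<Sum>t | t \<in> K \<and> \<mu> t = m. lookup p t))"
      by (simp add: single_sum)
    finally have "(\<Sum>t\<in>K. single (\<rho> (\<mu> t)) (lookup p t)) = 0" by (simp add: zero)
    then have "(\<Sum>t\<in>K. single t (lookup p t))
      = (\<Sum>t\<in>K. single t (lookup p t) - single (\<rho> (\<mu> t)) (lookup p t))"
      by (simp add: sum_subtractf)
    also have "\<dots> \<in> det_ideal D R"
      using \<rho> by (intro det_ideal_sum exchange) (auto simp: K_def)
    finally have 1: "(\<Sum>t\<in>K. single t (lookup p t)) \<in> det_ideal D R" .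
    have 2: "(\<Sum>t\<in>keys p - K. single t (lookup p t)) \<in> det_ideal D R"
    proof (rule det_ideal_sum)
      fix t
      assume "t \<in> keys p - K"
      then obtain v where v: "vertex v \<in> D" "lookup t v \<noteq> 0" by (auto simp: K_def good_def)
      have "Var v \<in> det_ideal D R"
        using v(1) by (cases v) (auto simp: Var_in_det_ideal)
      then show "single t (lookup p t) \<in> det_ideal D R"
        by (subst single_eq_Var_mult[OF v(2)], subst mult.commute) (rule det_ideal_scale)
    qed
    have "p = (\<Sum>t\<in>keys p - K. single t (lookup p t)) + (\<Sum>t\<in>K. single t (lookup p t))"
      by (subst (1) poly_mapping_sum_single, rule sum.subset_diff) (auto simp: K_def)
    then show ?thesis using det_ideal_add[OF 2 1] by simp
  qed
  have subset: "subst F p = 0" if "p \<in> det_ideal D R" for p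
    using that unfolding det_ideal_def
  proof (induction rule: im.span_induct_alt)
    case base
    then show ?case by simp
  next
    case (step c x y)
    have "subst F (det_poly i j) = 0" if "(i, j) \<in> R" for i j
    proof (cases "i \<in> D \<or> j \<in> D")
      case True
      then show ?thesis by (auto simp: det_poly_def F_def)
    next
      case False
      then have "rep i = rep j" using rep_eq that by simp
      then show ?thesis using False
        by (simp add: det_poly_def F_def E_def mult_single ac_simps)
    qed
    then have "subst F x = 0" using step(1) by (auto simp: F_def)
    then show ?case using step(2) by simp
  qed
  \<comment> \<open>The two monomials in the image differ in the exponent of the class variable of
    \<open>a\<close>, so they cannot cancel, whatever the characteristic.\<close>
  have "subst F (dot_poly a b) = single (E (Inl a) + E (Inl b)) 1 + single (E (Inr a) + E (Inr b)) 1"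
    using ab by (simp add: dot_poly_def F_def mult_single)
  moreover have "lookup (E (Inl a) + E (Inl b)) (idx (Inr (rep a))) \<noteq> lookup (E (Inr a) + E (Inr b)) (idx (Inr (rep a)))"
    by (simp add: E_def lookup_add lookup_single)
  then have "E (Inl a) + E (Inl b) \<noteq> E (Inr a) + E (Inr b)" by metis
  ultimately have "lookup (subst F (dot_poly a b)) (E (Inr a) + E (Inr b)) \<noteq> 0"
    by (simp add: lookup_add lookup_single)
  then have "subst F (dot_poly a b) \<noteq> 0" by auto
  moreover have "subst F (dot_poly a b) * subst F h = 0"
    using subset[OF h] by simp
  ultimately have "subst F h = 0" by simp
  then show ?thesis by (rule kernel)
qed

text \<open>Induction on the number of non-simplicial vertices. Completing the neighbourhood of such
  a \<open>q\<close> and deleting \<open>q\<close> both lower it, and \<open>det_ideal_Int\<close>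
  combines the two results. As \<open>a\<close> and \<open>b\<close> are simplicial, they are never
  the deleted vertex. When all vertices are simplicial, \<open>R\<close> is transitive outside
  \<open>D\<close>.\<close>

lemma dot_poly_nzd:
  fixes h :: "('n::finite + 'n, 'k::field) mpoly"
  assumes "Id \<subseteq> R" "sym R" "a \<notin> D" "b \<notin> D" "simplicial D R a" "simplicial D R b"
    and "dot_poly a b * h \<in> det_ideal D R"
  shows "h \<in> det_ideal D R"
  using assms
proof (induction "card {q. q \<notin> D \<and> \<not> simplicial D R q}" arbitrary: D R rule: less_induct)
  case less
  note refl = less.prems(1) and sym = less.prems(2)
  have sub: "x \<in> det_ideal D R \<Longrightarrow> x \<in> det_ideal D' R'" if "D \<subseteq> D'" "R \<subseteq> R'" for D' R' x
    using det_ideal_mono[OF that] by blast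
  show ?case
  proof (cases "\<exists>q. q \<notin> D \<and> \<not> simplicial D R q")
    case True
    then obtain q where q: "q \<notin> D" "\<not> simplicial D R q" by blast
    let ?N = "nbrs D R q"
    let ?R = "R \<union> ?N \<times> ?N"
    have qN: "q \<in> ?N" using refl q by (auto simp: nbrs_def)
    \<comment> \<open>A simplicial neighbour of \<open>q\<close> has its whole neighbourhood inside
      that of \<open>q\<close>, which becomes a clique; other vertices keep their
      neighbourhoods.\<close>
    have simp_N: "simplicial D ?R i" if i: "i \<notin> D" "simplicial D R i \<or> i = q" for i
    proof (cases "i \<in> ?N")
      case True
      have "nbrs D R i \<subseteq> ?N"
      proof (cases "i = q")
        case False
        have "q \<in> nbrs D R i" using True q sym by (auto simp: nbrs_def dest: symD)
        then have "{q} \<times> nbrs D R i \<subseteq> R" using i False by (auto simp: simplicial_def)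
        then show ?thesis by (auto simp: nbrs_def)
      qed simp
      then have "nbrs D ?R i \<subseteq> ?N" by (auto simp: nbrs_def)
      then show ?thesis by (auto simp: simplicial_def)
    next
      case False
      then have "nbrs D ?R i = nbrs D R i" by (auto simp: nbrs_def)
      then show ?thesis using i False qN by (auto simp: simplicial_def)
    qed
    have simp_D: "simplicial (insert q D) R i" if "simplicial D R i" for i
      using that by (auto simp: simplicial_def nbrs_def)
    have "card {p. p \<notin> D \<and> \<not> simplicial D ?R p} < card {p. p \<notin> D \<and> \<not> simplicial D R p}"
      by (rule psubset_card_mono) (use q simp_N in auto)
    then have 1: "h \<in> det_ideal D ?R"
    proof (rule less.hyps)
      show "Id \<subseteq> ?R" using refl by blast
      show "sym ?R" using sym by (auto simp: sym_def)
      show "dot_poly a b * h \<in> det_ideal D ?R" by (rule sub[OF _ _ less.prems(7)]) auto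
    qed (use less.prems simp_N in auto)
    have "card {p. p \<notin> insert q D \<and> \<not> simplicial (insert q D) R p} < card {p. p \<notin> D \<and> \<not> simplicial D R p}"
      by (rule psubset_card_mono) (use q simp_D in auto)
    then have 2: "h \<in> det_ideal (insert q D) R"
    proof (rule less.hyps)
      show "dot_poly a b * h \<in> det_ideal (insert q D) R" by (rule sub[OF _ _ less.prems(7)]) auto
    qed (use less.prems simp_D q in auto)
    show ?thesis by (rule det_ideal_Int[OF sym 1 2])
  next
    case False
    show ?thesis
    proof (rule dot_poly_nzd_equiv[OF refl sym _ less.prems(3,4,7)])
      fix i j k
      assume "i \<notin> D" "j \<notin> D" "k \<notin> D" "(i, j) \<in> R" "(j, k) \<in> R"
      then have "i \<in> nbrs D R j" "k \<in> nbrs D R j" "simplicial D R j"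
        using sym False by (auto simp: nbrs_def dest: symD)
      then show "(i, k) \<in> R" by (auto simp: simplicial_def)
    qed
  qed
qed

text \<open>The relation is enlarged just enough to make \<open>a\<close> and \<open>b\<close>
  simplicial. Since they are distinct and not adjacent, neither lies in the clique completed around
  the other, so each keeps a clique as its neighbourhood.\<close>

lemma dot_poly_colon_det_ideal:
  fixes h :: "('n::finite + 'n, 'k::field) mpoly"
  assumes Q: "sym Q" and ab: "a \<noteq> b" "(a, b) \<notin> Q"
    and h: "dot_poly a b * h \<in> det_ideal {} Q"
  shows "h \<in> det_ideal {} (Q \<union> (insert a (Q `` {a})) \<times> (insert a (Q `` {a}))
    \<union> (insert b (Q `` {b})) \<times> (insert b (Q `` {b})) \<union> Id)" (is "_ \<in> det_ideal {} ?R")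
proof (rule dot_poly_nzd)
  have ba: "(b, a) \<notin> Q" using ab Q by (auto dest: symD)
  show "Id \<subseteq> ?R" by blast
  show "sym ?R" using Q by (auto simp: sym_def)
  have "nbrs {} ?R a = insert a (Q `` {a}) \<union> (if a \<in> Q `` {b} then insert b (Q `` {b}) else {})"
    using ab ba by (auto simp: nbrs_def)
  moreover have "a \<notin> Q `` {b}" using ba by simp
  ultimately show "simplicial {} ?R a" unfolding simplicial_def by auto
  have "nbrs {} ?R b = insert b (Q `` {b})"
    using ab ba by (auto simp: nbrs_def)
  then show "simplicial {} ?R b" unfolding simplicial_def by auto
  show "dot_poly a b * h \<in> det_ideal {} ?R"
    using h det_ideal_mono[of "{}" "{}" Q ?R] by blast
qed auto

text \<open>Rotating the vectors \<open>(x\<^sub>i, y\<^sub>i)\<close> with \<open>c i\<close> by a right angle turns the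
  scalar products along bichromatic edges into determinants.\<close>

lemma dot_poly_colon:
  fixes h :: "('n::finite + 'n, 'k::field) mpoly" and c :: "'n \<Rightarrow> bool"
  assumes Q: "sym Q" and c: "\<And>i j. (i, j) \<in> Q \<Longrightarrow> c i \<noteq> c j" and ab: "a \<noteq> b" "c a = c b"
    and h: "dot_poly a b * h \<in> im.span ((\<lambda>(i, j). dot_poly i j) ` Q)"
  shows "h \<in> im.span ((\<lambda>(i, j). dot_poly i j) ` Q
    \<union> (\<lambda>(i, j). det_poly i j) ` (Q `` {a} \<times> Q `` {a} \<union> Q `` {b} \<times> Q `` {b}))" (is "h \<in> im.span ?B")
proof -
  \<comment> \<open>Mutually inverse right-angle rotations of the vertices with colour
    \<open>True\<close>. Bichromatic pairs exchange scalar product and determinant up to sign;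
    equally coloured pairs keep theirs.\<close>
  define f g :: "'n + 'n \<Rightarrow> ('n + 'n, 'k) mpoly" where
    "f v = (case v of Inl i \<Rightarrow> if c i then y_var i else x_var i | Inr i \<Rightarrow> if c i then - x_var i else y_var i)"
    and "g v = (case v of Inl i \<Rightarrow> if c i then - y_var i else x_var i | Inr i \<Rightarrow> if c i then x_var i else y_var i)" for v
  have fg: "subst f (subst g p) = p" for p
    by (subst subst_subst[where h' = Var]) (auto simp: f_def g_def split: sum.splits)
  let ?P = "Q \<union> (insert a (Q `` {a})) \<times> (insert a (Q `` {a}))
    \<union> (insert b (Q `` {b})) \<times> (insert b (Q `` {b})) \<union> Id"
  have g_dot: "subst g (dot_poly i j) = (if c j then - det_poly i j else det_poly i j)" if "c i \<noteq> c j" for i j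
    using that by (auto simp: dot_poly_def det_poly_def g_def algebra_simps)
  have f_det: "subst f (det_poly i j) = (if c j then - dot_poly i j else dot_poly i j)" if "c i \<noteq> c j" for i j
    using that by (auto simp: dot_poly_def det_poly_def f_def algebra_simps)
  have f_det': "subst f (det_poly i j) = det_poly i j" if "c i = c j" for i j
    using that by (auto simp: det_poly_def f_def algebra_simps)
  have g_ab: "subst g (dot_poly a b) = dot_poly a b"
    using ab(2) by (auto simp: dot_poly_def g_def algebra_simps)
  have "subst g (dot_poly a b * h) \<in> im.span (subst g ` (\<lambda>(i, j). dot_poly i j) ` Q)"
    by (rule subst_in_span[OF h])
  also have "\<dots> \<subseteq> det_ideal {} Q"
  proof (rule im.span_minimal[OF _ det_ideal_subspace], clarsimp)
    fix i j
    assume "(i, j) \<in> Q"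
    then show "subst g (dot_poly i j) \<in> det_ideal {} Q"
      using det_poly_in_det_ideal[of i j Q "{}"] im.subspace_neg[OF det_ideal_subspace]
      by (auto simp: g_dot[OF c])
  qed
  finally have "dot_poly a b * subst g h \<in> det_ideal {} Q" by (simp add: g_ab)
  then have "subst g h \<in> det_ideal {} ?P"
    using ab c by (intro dot_poly_colon_det_ideal[OF Q]) auto
  then have "subst f (subst g h) \<in> im.span (subst f ` (\<lambda>(i, j). det_poly i j) ` ?P)"
    unfolding det_ideal_def by (intro subst_in_span) simp
  also have "\<dots> \<subseteq> im.span ?B"
  proof -
    have "subst f (det_poly i j) \<in> im.span ?B" if ij: "(i, j) \<in> ?P" for i j
    proof -
      have dot: "subst f (det_poly i j) \<in> im.span ?B" if "(i, j) \<in> Q"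
      proof -
        have "dot_poly i j \<in> im.span ?B" using that by (intro im.span_base) force
        then show ?thesis using f_det[OF c[OF that]] im.span_neg by auto
      qed
      have det: "subst f (det_poly i j) \<in> im.span ?B" if "c i = c j"
          "(i, j) \<in> Q `` {a} \<times> Q `` {a} \<union> Q `` {b} \<times> Q `` {b}"
        using that(2) by (subst f_det'[OF that(1)]) (intro im.span_base, force)
      \<comment> \<open>The new cliques contain \<open>a\<close> and \<open>b\<close> themselves,
        but such pairs are edges of \<open>Q\<close> or diagonal. The remaining pairs are two
        neighbours of one vertex, hence equally coloured, and \<open>f\<close> fixes their
        determinants.\<close>
      consider "(i, j) \<in> Q" | "(j, i) \<in> Q" | "i = j"
        | "(i, j) \<in> Q `` {a} \<times> Q `` {a} \<union> Q `` {b} \<times> Q `` {b}"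
        using ij by blast
      then show ?thesis
      proof cases
        case 2
        then show ?thesis using dot Q by (auto dest: symD)
      next
        case 4
        then have "c i = c j" using c by blast
        then show ?thesis using det 4 by blast
      next
        case 1
        then show ?thesis by (rule dot)
      next
        case 3
        then show ?thesis by (simp add: im.span_zero)
      qed
    qed
    note mem = this
    have image: "subst f ` (\<lambda>(i, j). det_poly i j) ` P \<subseteq> V"
      if "\<And>i j. (i, j) \<in> P \<Longrightarrow> subst f (det_poly i j) \<in> V" for P V
      using that by auto
    show ?thesis by (rule im.span_minimal[OF image[OF mem] im.subspace_span])
  qed
  finally show ?thesis by (simp add: fg)
qed

section \<open>Graded submodules of free modules\<close>

text \<open>Elements of a free module of rank \<open>p\<close> are represented by functions on \<open>nat\<close> that vanish
  from \<open>p\<close> on.\<close>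

definition vscale :: "'a::comm_ring_1 \<Rightarrow> (nat \<Rightarrow> 'a) \<Rightarrow> nat \<Rightarrow> 'a" where
  "vscale c u = (\<lambda>k. c * u k)"

interpretation fm: module vscale
  by unfold_locales (auto simp: vscale_def algebra_simps)

declare fm.scale_scale [simp del]

lemma vscale_apply [simp]: "vscale c u k = c * u k"
  by (simp add: vscale_def)

lemma sum_fun_apply: "(\<Sum>x\<in>A. f x) k = (\<Sum>x\<in>A. f x k)"
  by (induction A rule: infinite_finite_induct) auto

text \<open>\<open>s k\<close> is the degree of the k-th basis element, so a nonzero entry at
  \<open>k\<close> must have degree \<open>d - s k\<close>.\<close>

definition vhomog :: "(nat \<Rightarrow> nat) \<Rightarrow> nat \<Rightarrow> (nat \<Rightarrow> ('v, 'k::field) mpoly) \<Rightarrow> bool" where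
  "vhomog s d u \<longleftrightarrow> (\<forall>k. homog_map_entry (u k) (s k) d)"

definition vcomp :: "(nat \<Rightarrow> nat) \<Rightarrow> nat \<Rightarrow> (nat \<Rightarrow> ('v, 'k::field) mpoly) \<Rightarrow> nat \<Rightarrow> ('v, 'k) mpoly" where
  "vcomp s d u = (\<lambda>k. if s k \<le> d then hcomp (d - s k) (u k) else 0)"

definition graded_submodule :: "nat \<Rightarrow> (nat \<Rightarrow> nat) \<Rightarrow> (nat \<Rightarrow> ('v, 'k::field) mpoly) set \<Rightarrow> bool" where
  "graded_submodule p s U \<longleftrightarrow> fm.subspace U \<and> (\<forall>u\<in>U. \<forall>k\<ge>p. u k = 0) \<and> (\<forall>u\<in>U. \<forall>d. vcomp s d u \<in> U)"

lemma vhomog_vcomp: "vhomog s d (vcomp s d u)"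
  by (auto simp: vhomog_def vcomp_def homog_map_entry_iff homog_hcomp)

lemma vhomogD: "vhomog s d u \<Longrightarrow> t \<in> keys (u k) \<Longrightarrow> s k + mdeg t = d"
  by (auto simp: vhomog_def homog_map_entry_def)

lemma sum_vcomp:
  assumes "\<And>k. k \<ge> p \<Longrightarrow> u k = 0"
  shows "\<exists>N. u = (\<Sum>d\<le>N. vcomp s d u)"
proof -
  define T where "T = (\<Union>k<p. (\<lambda>t. s k + mdeg t) ` keys (u k))"
  define N where "N = Max (insert 0 T)"
  have "finite T" by (simp add: T_def)
  then have N: "s k + mdeg t \<le> N" if "t \<in> keys (u k)" for k t
  proof -
    have "k < p" using assms[of k] that by (force simp: not_less)
    then have "s k + mdeg t \<in> T" using that by (auto simp: T_def)
    then show ?thesis using \<open>finite T\<close> by (simp add: N_def)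
  qed
  have "u k = (\<Sum>d\<le>N. vcomp s d u) k" for k
  proof (rule poly_mapping_eqI)
    fix t
    have "lookup (vcomp s d u k) t = (if d = s k + mdeg t then lookup (u k) t else 0)" for d
      by (auto simp: vcomp_def lookup_hcomp)
    then have "lookup ((\<Sum>d\<le>N. vcomp s d u) k) t = (\<Sum>d\<le>N. if d = s k + mdeg t then lookup (u k) t else 0)"
      by (simp add: sum_fun_apply lookup_sum)
    also have "\<dots> = lookup (u k) t"
      using N[of t k] by (auto simp: in_keys_iff)
    finally show "lookup (u k) t = lookup ((\<Sum>d\<le>N. vcomp s d u) k) t" ..
  qed
  then show ?thesis by (intro exI[of _ N] ext)
qed

lemma graded_submoduleD_subset:
  assumes U: "graded_submodule p s U" and V: "fm.subspace V"
    and sub: "\<And>u d. u \<in> U \<Longrightarrow> vhomog s d u \<Longrightarrow> u \<in> V"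
  shows "U \<subseteq> V"
proof
  fix u
  assume u: "u \<in> U"
  obtain N where N: "u = (\<Sum>d\<le>N. vcomp s d u)"
    using sum_vcomp[of p u s] U u by (auto simp: graded_submodule_def)
  have "(\<Sum>d\<le>N. vcomp s d u) \<in> V"
    using U u by (intro fm.subspace_sum[OF V] sub[OF _ vhomog_vcomp]) (auto simp: graded_submodule_def)
  then show "u \<in> V" using N by simp
qed

subsection \<open>Finite generation\<close>

lemma nat_seq_mono_subseq:
  fixes g :: "nat \<Rightarrow> nat"
  shows "\<exists>r. strict_mono (r :: nat \<Rightarrow> nat) \<and> mono (\<lambda>n. g (r n))"
proof -
  obtain r :: "nat \<Rightarrow> nat" where r: "strict_mono r" "monoseq (\<lambda>n. g (r n))"
    using seq_monosub[of g] by blast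
  show ?thesis
  proof (cases "incseq (\<lambda>n. g (r n))")
    case True
    then show ?thesis using r by blast
  next
    case False
    then have dec: "decseq (\<lambda>n. g (r n))" using r(2) by (simp add: monoseq_iff)
    \<comment> \<open>A decreasing sequence of naturals is constant from the place of its minimum
      on.\<close>
    define n0 where "n0 = arg_min (\<lambda>n. g (r n)) (\<lambda>_. True)"
    have n0: "g (r n0) \<le> g (r n)" for n
      unfolding n0_def by (rule arg_min_nat_le) simp
    have "g (r (n0 + n)) = g (r n0)" for n
      using n0[of "n0 + n"] decseqD[OF dec, of n0 "n0 + n"] by simp
    then have "mono (\<lambda>n. g (r (n0 + n)))" by (simp add: mono_def)
    moreover have "strict_mono (\<lambda>n. r (n0 + n))"
      using r(1) by (simp add: strict_mono_def)
    ultimately show ?thesis by (intro exI[of _ "\<lambda>n. r (n0 + n)"]) simp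
  qed
qed

text \<open>Subsequences are refined coordinate by coordinate; monotonicity in earlier coordinates
  survives refinement.\<close>

lemma dickson:
  fixes f :: "nat \<Rightarrow> 'a \<Rightarrow> nat"
  assumes "finite A"
  shows "\<exists>r. strict_mono (r :: nat \<Rightarrow> nat) \<and> (\<forall>a\<in>A. mono (\<lambda>n. f (r n) a))"
  using assms
proof (induction A rule: finite_induct)
  case empty
  then show ?case by (auto intro: strict_mono_id)
next
  case (insert x A)
  then obtain r :: "nat \<Rightarrow> nat" where r: "strict_mono r" "\<forall>a\<in>A. mono (\<lambda>n. f (r n) a)" by blast
  obtain q :: "nat \<Rightarrow> nat" where q: "strict_mono q" "mono (\<lambda>n. f (r (q n)) x)"
    using nat_seq_mono_subseq[of "\<lambda>n. f (r n) x"] by blast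
  have "strict_mono (\<lambda>n. r (q n))"
    using r(1) q(1) by (simp add: strict_mono_def)
  moreover have "mono (\<lambda>n. f (r (q n)) a)" if "a \<in> A" for a
    using r(2) q(1) that by (auto simp: mono_def dest!: strict_mono_mono)
  ultimately show ?case using q(2) by (intro exI[of _ "\<lambda>n. r (q n)"]) auto
qed

lemma single_mult_eq_sum:
  fixes q :: "('v, 'k::field) mpoly"
  shows "single m c * q = (\<Sum>s\<in>keys q. single (m + s) (c * lookup q s))"
  by (subst (1) poly_mapping_sum_single[of q]) (simp add: sum_distrib_left mult_single)

lemma lookup_single_mult:
  fixes q :: "('v, 'k::field) mpoly"
  shows "lookup (single m c * q) (m + t) = c * lookup q t"
proof -
  have "lookup (single m c * q) (m + t) = (\<Sum>s\<in>keys q. if s = t then c * lookup q s else 0)"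
    by (simp add: single_mult_eq_sum lookup_sum lookup_single when_def)
  also have "\<dots> = c * lookup q t" by (auto simp: in_keys_iff)
  finally show ?thesis .
qed

lemma keys_single_mult:
  fixes q :: "('v, 'k::field) mpoly"
  shows "t \<in> keys (single m c * q) \<Longrightarrow> \<exists>s\<in>keys q. t = m + s"
  using keys_mult[of "single m c" q] by (auto split: if_splits)

text \<open>Hilbert's basis theorem. If \<open>U\<close> were not finitely generated, choose successively homogeneous
  elements outside the span of the previous ones, of minimal degree and then with minimal leading
  monomial. By Dickson's lemma some leading monomial divides a later one, and the later element can
  be reduced, contradicting minimality.\<close>

lemma graded_submodule_fg:
  fixes U :: "(nat \<Rightarrow> ('v::finite, 'k::field) mpoly) set"
  assumes U: "graded_submodule p s U"
  shows "\<exists>G. finite G \<and> G \<subseteq> U \<and> (\<forall>g\<in>G. \<exists>d. vhomog s d g) \<and> fm.span G = U"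
proof (rule ccontr)
  assume contr: "\<not> ?thesis"
  have subsp: "fm.subspace U" and supp: "u \<in> U \<Longrightarrow> k \<ge> p \<Longrightarrow> u k = 0" for u k
    using U by (auto simp: graded_submodule_def)
  define H where "H = {u \<in> U. \<exists>d. vhomog s d u}"
  have ex_outside: "\<exists>u. u \<in> H - fm.span G" if "finite G" "G \<subseteq> H" for G
  proof (rule ccontr)
    assume "\<not> ?thesis"
    then have "U \<subseteq> fm.span G"
      by (intro graded_submoduleD_subset[OF U fm.subspace_span]) (auto simp: H_def)
    moreover have "fm.span G \<subseteq> U"
      using that by (intro fm.span_minimal subsp) (auto simp: H_def)
    ultimately have "finite G \<and> G \<subseteq> U \<and> (\<forall>g\<in>G. \<exists>d. vhomog s d g) \<and> fm.span G = U"
      using that by (auto simp: H_def)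
    then show False using contr by blast
  qed
  obtain idx :: "'v \<Rightarrow> nat" and N where idx: "inj idx" "\<And>v. idx v < N"
    using finite_imp_inj_to_nat_seg[of "UNIV :: 'v set"] by (metis finite UNIV_I image_eqI mem_Collect_eq)
  define \<kappa> :: "('v \<Rightarrow>\<^sub>0 nat) \<Rightarrow> nat \<Rightarrow>\<^sub>0 nat" where
    "\<kappa> t = (\<Sum>v\<in>UNIV. single (idx v) (lookup t v))" for t
  have \<kappa>_add: "\<kappa> (t + t') = \<kappa> t + \<kappa> t'" for t t'
    by (simp add: \<kappa>_def lookup_add single_add sum.distrib)
  have lookup_\<kappa>: "lookup (\<kappa> t) (idx v) = lookup t v" for t v
    using idx(1) by (simp add: \<kappa>_def lookup_sum lookup_single when_def inj_eq)
  have lookup_\<kappa>': "lookup (\<kappa> t) m = 0" if "m \<ge> N" for t m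
    using idx(2) that by (auto simp: \<kappa>_def lookup_sum lookup_single when_def not_less[symmetric])
  \<comment> \<open>A term is a position and a monomial. Marking the position by an extra variable
    with index at least \<open>N\<close> codes it as one exponent vector over \<open>nat\<close>;
    the order on these is linear and compatible with addition, so it serves as a term order.\<close>
  define enc :: "nat \<times> ('v \<Rightarrow>\<^sub>0 nat) \<Rightarrow> nat \<Rightarrow>\<^sub>0 nat" where
    "enc x = single (N + fst x) 1 + \<kappa> (snd x)" for x
  have enc_idx: "lookup (enc x) (idx v) = lookup (snd x) v" for x v
    using idx(2)[of v] by (simp add: enc_def lookup_add lookup_\<kappa> lookup_single when_def)
  have enc_pos: "lookup (enc x) (N + k) = (if k = fst x then 1 else 0)" for x k
    by (simp add: enc_def lookup_add lookup_\<kappa>' lookup_single when_def)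
  have inj_enc: "x = y" if "enc x = enc y" for x y
  proof (rule prod_eqI)
    have "lookup (enc y) (N + fst x) = 1" unfolding that[symmetric] by (simp add: enc_pos)
    then show "fst x = fst y" unfolding enc_pos by (metis zero_neq_one)
    show "snd x = snd y"
      by (rule poly_mapping_eqI) (metis that enc_idx)
  qed
  define supp_set :: "(nat \<Rightarrow> ('v, 'k) mpoly) \<Rightarrow> (nat \<times> ('v \<Rightarrow>\<^sub>0 nat)) set" where
    "supp_set u = (SIGMA k:{..<p}. keys (u k))" for u
  have fin_supp: "finite (supp_set u)" for u by (simp add: supp_set_def)
  define M where "M u = Max (enc ` supp_set u)" for u
  have supp_ne: "supp_set u \<noteq> {}" if uU: "u \<in> U" and u0: "u \<noteq> 0" for u
  proof -
    obtain k where k: "u k \<noteq> 0" using u0 by (auto simp: fun_eq_iff)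
    then have "k < p" using supp[OF uU, of k] by (auto simp: not_less[symmetric])
    moreover obtain t where "t \<in> keys (u k)" using k by (metis keys_eq_empty all_not_in_conv)
    ultimately show ?thesis by (auto simp: supp_set_def)
  qed
  have M_in: "\<exists>x\<in>supp_set u. M u = enc x" if "u \<in> U" "u \<noteq> 0" for u
  proof -
    have "M u \<in> enc ` supp_set u"
      unfolding M_def using fin_supp supp_ne[OF that] by (intro Max_in) auto
    then show ?thesis by blast
  qed
  have M_ge: "enc x \<le> M u" if "x \<in> supp_set u" for x u
    using that fin_supp by (simp add: M_def)
  \<comment> \<open>Leading terms are compared only among outsiders of the same degree, which
    suffices because the reduction \<open>w\<close> below has the degree of
    \<open>u j\<close>.\<close>
  define good where "good G u \<longleftrightarrow> u \<in> H - fm.span G \<and>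
    (\<forall>w d. w \<in> H - fm.span G \<longrightarrow> vhomog s d u \<longrightarrow> vhomog s d w \<longrightarrow> M u \<le> M w)" for G u
  have ex_good: "\<exists>u. good G u" if G: "finite G" "G \<subseteq> H" for G
  proof -
    let ?X = "H - fm.span G"
    obtain u0 where u0: "u0 \<in> ?X" using ex_outside[OF G] by blast
    then obtain d where d: "vhomog s d u0" by (auto simp: H_def)
    let ?Y = "{w \<in> ?X. vhomog s d w}"
    have nz: "w \<in> U \<and> w \<noteq> 0" if "w \<in> ?X" for w using that fm.span_zero by (auto simp: H_def)
    have "M ` ?Y \<subseteq> enc ` ({..<p} \<times> (\<Union>e\<le>d. {t. mdeg t = e}))"
    proof (rule image_subsetI)
      fix w
      assume w: "w \<in> ?Y"
      then obtain x where x: "x \<in> supp_set w" "M w = enc x" using M_in nz by blast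
      have "s (fst x) + mdeg (snd x) = d"
        using w x(1) by (intro vhomogD[of s d w]) (auto simp: supp_set_def)
      then show "M w \<in> enc ` ({..<p} \<times> (\<Union>e\<le>d. {t. mdeg t = e}))"
        using x by (intro image_eqI[of _ _ x]) (auto simp: supp_set_def)
    qed
    then have fin: "finite (M ` ?Y)"
      by (rule finite_subset) (simp add: finite_mdeg_eq)
    have "M ` ?Y \<noteq> {}" using u0 d by blast
    then have "Min (M ` ?Y) \<in> M ` ?Y" using fin by (rule Min_in[rotated])
    then obtain u where u': "Min (M ` ?Y) = M u" "u \<in> ?Y" by (rule imageE)
    note u = u'(2) u'(1)[symmetric]
    have "M u \<le> M w" if "w \<in> ?X" "vhomog s e u" "vhomog s e w" for w e
    proof -
      obtain x where x: "x \<in> supp_set u" using supp_ne nz u(1) by blast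
      then have "snd x \<in> keys (u (fst x))" by (auto simp: supp_set_def)
      then have "e = d" using that(2) u(1) vhomogD by blast
      then show ?thesis using that fin u(2) by simp
    qed
    then show ?thesis using u(1) unfolding good_def by blast
  qed
  define nxt where "nxt G = (SOME u. good G u)" for G
  define GG where "GG = rec_nat {} (\<lambda>_ G. insert (nxt G) G)"
  have GG_simps: "GG 0 = {}" "GG (Suc n) = insert (nxt (GG n)) (GG n)" for n by (simp_all add: GG_def)
  have GG: "finite (GG n) \<and> GG n \<subseteq> H" for n
  proof (induction n)
    case (Suc n)
    then have "good (GG n) (nxt (GG n))"
      unfolding nxt_def by (intro someI_ex[OF ex_good]) auto
    then show ?case using Suc by (auto simp: GG_simps good_def)
  qed (simp add: GG_simps)
  define u where "u n = nxt (GG n)" for n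
  have good_u: "good (GG n) (u n)" for n
    unfolding u_def nxt_def using GG[of n] by (intro someI_ex[OF ex_good]) auto
  have u_in: "u i \<in> GG j" if "i < j" for i j
    using that by (induction j) (auto simp: GG_simps u_def less_Suc_eq)
  have uU: "u n \<in> U" "u n \<noteq> 0" for n
    using good_u[of n] fm.span_zero[of "GG n"] by (auto simp: good_def H_def)
  obtain x where x: "\<And>n. x n \<in> supp_set (u n)" "\<And>n. M (u n) = enc (x n)"
    using M_in[OF uU] by metis
  \<comment> \<open>The first \<open>N + p\<close> coordinates comprise all variables and all
    position markers.\<close>
  obtain r :: "nat \<Rightarrow> nat" where r: "strict_mono r" "\<forall>a\<in>{..<N + p}. mono (\<lambda>n. lookup (enc (x (r n))) a)"
    using dickson[of "{..<N + p}" "\<lambda>n. lookup (enc (x n))"] by auto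
  define i j where "i = r 0" and "j = r 1"
  have ij: "i < j" using r(1) by (simp add: i_def j_def strict_mono_def)
  have le: "lookup (enc (x i)) a \<le> lookup (enc (x j)) a" if "a < N + p" for a
    using r(2) that by (auto simp: i_def j_def mono_def)
  define k where "k = fst (x i)"
  have kp: "k < p" using x(1)[of i] by (auto simp: k_def supp_set_def)
  \<comment> \<open>The marker coordinate of \<open>x i\<close> is 1 and cannot decrease, so
    \<open>x j\<close> carries the same marker.\<close>
  have kj: "fst (x j) = k"
    using le[of "N + k"] kp enc_pos[of "x i" k] enc_pos[of "x j" k] by (simp add: k_def split: if_splits)
  define ti tj where "ti = snd (x i)" and "tj = snd (x j)"
  have t_le: "lookup ti v \<le> lookup tj v" for v
    using le[of "idx v"] idx(2)[of v] by (simp add: enc_idx ti_def tj_def)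
  define m where "m = tj - ti"
  have tj: "tj = m + ti"
    using t_le by (intro poly_mapping_eqI) (simp add: m_def lookup_add lookup_minus)
  have ti_key: "ti \<in> keys (u i k)" and tj_key: "tj \<in> keys (u j k)"
    using x(1)[of i] x(1)[of j] kj by (auto simp: supp_set_def k_def ti_def tj_def)
  \<comment> \<open>Chosen so that the leading term of \<open>u j\<close> cancels in
    \<open>w\<close>.\<close>
  define c where "c = lookup (u j k) tj / lookup (u i k) ti"
  define w where "w = u j - vscale (single m c) (u i)"
  obtain di dj where hom: "vhomog s di (u i)" "vhomog s dj (u j)"
    using good_u[of i] good_u[of j] unfolding good_def H_def by blast
  have deg: "di + mdeg m = dj"
    using vhomogD[OF hom(1) ti_key] vhomogD[OF hom(2) tj_key] tj by simp
  have w_keys: "t \<in> keys (u j l) \<or> (\<exists>t'\<in>keys (u i l). t = m + t')" if "t \<in> keys (w l)" for t l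
    using that keys_diff[of "u j l" "single m c * u i l"] keys_single_mult[of t m c "u i l"]
    by (auto simp: w_def)
  have w_hom: "vhomog s dj w"
    unfolding vhomog_def homog_map_entry_def
  proof (intro allI ballI)
    fix l t
    assume "t \<in> keys (w l)"
    then show "s l + mdeg t = dj"
      using w_keys[of t l] vhomogD[OF hom(1)] vhomogD[OF hom(2)] deg by fastforce
  qed
  have wU: "w \<in> U"
    unfolding w_def using uU by (intro fm.subspace_diff[OF subsp] fm.subspace_scale[OF subsp])
  have w_span: "w \<notin> fm.span (GG j)"
  proof
    assume "w \<in> fm.span (GG j)"
    moreover have "vscale (single m c) (u i) \<in> fm.span (GG j)"
      using u_in[OF ij] by (intro fm.span_scale fm.span_base)
    ultimately have "w + vscale (single m c) (u i) \<in> fm.span (GG j)" by (rule fm.span_add)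
    then show False using good_u[of j] by (simp add: w_def good_def)
  qed
  then have "M (u j) \<le> M w"
    using good_u[of j] hom(2) w_hom wU unfolding good_def H_def by blast
  moreover have "w \<noteq> 0" using w_span fm.span_zero[of "GG j"] by auto
  then obtain y where y: "y \<in> supp_set w" "M w = enc y" using M_in[OF wU] by blast
  \<comment> \<open>Terms of \<open>w\<close> come from \<open>u j\<close> or from the multiple of
    \<open>u i\<close>, and multiplication by \<open>m\<close> preserves the order and moves the
    leading term of \<open>u i\<close> to that of \<open>u j\<close>. Minimality forces equality,
    although that term has been cancelled.\<close>
  have "enc y \<le> M (u j)"
  proof (cases "snd y \<in> keys (u j (fst y))")
    case True
    then have "y \<in> supp_set (u j)" using y(1) by (auto simp: supp_set_def)
    then show ?thesis by (rule M_ge)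
  next
    case False
    then obtain t' where t': "t' \<in> keys (u i (fst y))" "snd y = m + t'"
      using w_keys[of "snd y" "fst y"] y(1) by (auto simp: supp_set_def)
    then have "(fst y, t') \<in> supp_set (u i)" using y(1) by (auto simp: supp_set_def)
    then have "enc (fst y, t') \<le> enc (x i)" using M_ge x(2) by metis
    then have "\<kappa> m + enc (fst y, t') \<le> \<kappa> m + enc (x i)" by (rule add_left_mono)
    moreover have "\<kappa> m + enc (fst y, t') = enc y" using t'(2) by (simp add: enc_def \<kappa>_add ac_simps)
    moreover have "\<kappa> m + enc (x i) = enc (x j)"
      using kj tj by (simp add: enc_def \<kappa>_add ac_simps k_def ti_def tj_def)
    ultimately show ?thesis using x(2) by simp
  qed
  ultimately have "enc y = enc (x j)" using y(2) x(2)[of j] by simp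
  then have "y = x j" by (rule inj_enc)
  then have "tj \<in> keys (w k)" using y(1) kj by (auto simp: supp_set_def tj_def)
  moreover have "lookup (w k) tj = 0"
    using ti_key by (simp add: w_def lookup_minus tj lookup_single_mult c_def in_keys_iff)
  ultimately show False by (simp add: in_keys_iff)
qed

subsection \<open>Minimal generators\<close>

definition lincomb :: "nat \<Rightarrow> (nat \<Rightarrow> nat \<Rightarrow> 'a::comm_ring_1) \<Rightarrow> (nat \<Rightarrow> 'a) \<Rightarrow> nat \<Rightarrow> 'a" where
  "lincomb q g c = (\<lambda>k. \<Sum>l<q. c l * g l k)"

text \<open>Vanishing from \<open>q\<close> on makes a syzygy determined by its \<open>q\<close>
  coefficients and comparable with a vector of that length.\<close>

definition syz :: "nat \<Rightarrow> (nat \<Rightarrow> nat \<Rightarrow> 'a::comm_ring_1) \<Rightarrow> (nat \<Rightarrow> 'a) set" where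
  "syz q g = {c. (\<forall>l\<ge>q. c l = 0) \<and> lincomb q g c = 0}"

lemma lincomb_eq_sum: "lincomb q g c = (\<Sum>l<q. vscale (c l) (g l))"
  by (rule ext) (simp add: lincomb_def sum_fun_apply)

lemma span_eq_lincomb: "fm.span (g ` {..<q}) = range (lincomb q g)"
proof safe
  fix u
  assume "u \<in> fm.span (g ` {..<q})"
  then show "u \<in> range (lincomb q g)"
  proof (induction rule: fm.span_induct_alt)
    case base
    have "0 = lincomb q g 0" by (rule ext) (simp add: lincomb_def)
    then show ?case by (metis rangeI)
  next
    case (step c x y)
    then obtain l b where l: "l < q" "x = g l" "y = lincomb q g b" by auto
    have "lincomb q g (b(l := b l + c)) k = c * x k + y k" for k
    proof -
      have "lincomb q g (b(l := b l + c)) k = (\<Sum>i<q. b i * g i k + (if i = l then c * g i k else 0))"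
        unfolding lincomb_def by (rule sum.cong) (auto simp: distrib_right)
      also have "\<dots> = c * x k + y k"
        using l by (simp add: sum.distrib lincomb_def)
      finally show ?thesis .
    qed
    then have "vscale c x + y = lincomb q g (b(l := b l + c))" by (intro ext) simp
    then show ?case by (metis rangeI)
  qed
next
  fix c
  show "lincomb q g c \<in> fm.span (g ` {..<q})"
    unfolding lincomb_eq_sum by (intro fm.span_sum fm.span_scale fm.span_base) auto
qed

lemma vcomp_lincomb:
  fixes g :: "nat \<Rightarrow> nat \<Rightarrow> ('v::finite, 'k::field) mpoly"
  assumes "\<And>l. l < q \<Longrightarrow> vhomog s (ds l) (g l)"
  shows "vcomp s e (lincomb q g c) = lincomb q g (vcomp ds e c)"
proof
  fix k
  have *: "(if s k \<le> e then hcomp (e - s k) (c l * g l k) else 0) = vcomp ds e c l * g l k" if "l < q" for l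
  proof (cases "g l k = 0")
    case False
    have *: "s k \<le> ds l" "homog (ds l - s k) (g l k)"
      using assms[OF that] False by (auto simp: vhomog_def homog_map_entry_iff)
    show ?thesis using *(1) by (auto simp: hcomp_mult[OF *(2)] vcomp_def)
  qed simp
  have "vcomp s e (lincomb q g c) k = (\<Sum>l<q. if s k \<le> e then hcomp (e - s k) (c l * g l k) else 0)"
    by (simp add: vcomp_def lincomb_def hcomp_sum)
  also have "\<dots> = lincomb q g (vcomp ds e c) k"
    unfolding lincomb_def by (rule sum.cong) (simp_all only: * lessThan_iff)
  finally show "vcomp s e (lincomb q g c) k = lincomb q g (vcomp ds e c) k" .
qed

lemma graded_submodule_syz:
  fixes g :: "nat \<Rightarrow> nat \<Rightarrow> ('v::finite, 'k::field) mpoly"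
  assumes "\<And>l. l < q \<Longrightarrow> vhomog s (ds l) (g l)"
  shows "graded_submodule q ds (syz q g)"
  unfolding graded_submodule_def
proof (intro conjI ballI allI impI)
  show "fm.subspace (syz q g)"
    by (rule fm.subspaceI)
       (auto simp: syz_def lincomb_def fun_eq_iff distrib_right sum.distrib mult.assoc simp flip: sum_distrib_left)
  show "u k = 0" if "u \<in> syz q g" "k \<ge> q" for u k
    using that by (simp add: syz_def)
  fix u d
  assume u: "u \<in> syz q g"
  then have "vcomp s d (lincomb q g u) = 0"
    by (auto simp: syz_def vcomp_def)
  then have "lincomb q g (vcomp ds d u) = 0"
    by (simp only: vcomp_lincomb[OF assms])
  then show "vcomp ds d u \<in> syz q g"
    using u by (simp add: syz_def) (simp add: vcomp_def)
qed

text \<open>The last clause is minimality in the form of Nakayama's lemma: a relation with a nonzero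
  constant coefficient would express one generator by the others. It also says that the next
  differential has entries in the irrelevant ideal.\<close>

definition min_gens :: "(nat \<Rightarrow> nat) \<Rightarrow> (nat \<Rightarrow> ('v, 'k::field) mpoly) set
    \<Rightarrow> nat \<Rightarrow> (nat \<Rightarrow> nat) \<Rightarrow> (nat \<Rightarrow> nat \<Rightarrow> ('v, 'k) mpoly) \<Rightarrow> bool" where
  "min_gens s U q ds g \<longleftrightarrow> (\<forall>l<q. vhomog s (ds l) (g l)) \<and> U = range (lincomb q g)
     \<and> (\<forall>c\<in>syz q g. \<forall>l. lookup (c l) 0 = 0)"

text \<open>A homogeneous system of least size works: a syzygy with nonzero constant term at
  \<open>l\<close> would let \<open>g l\<close> be removed.\<close>

lemma ex_min_gens:
  fixes U :: "(nat \<Rightarrow> ('v::finite, 'k::field) mpoly) set"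
  assumes U: "graded_submodule p s U"
  shows "\<exists>q ds g. min_gens s U q ds g"
proof -
  define P where "P q \<longleftrightarrow> (\<exists>ds g. (\<forall>l<q. vhomog s (ds l) (g l)) \<and> U = range (lincomb q g))" for q
  have "\<exists>q. P q"
  proof -
    obtain G where G: "finite G" "\<And>g. g \<in> G \<Longrightarrow> \<exists>d. vhomog s d g" "fm.span G = U"
      using graded_submodule_fg[OF U] by blast
    obtain gs where gs: "set gs = G" using finite_list[OF G(1)] by blast
    obtain dd where dd: "\<And>g. g \<in> G \<Longrightarrow> vhomog s (dd g) g" using G(2) by metis
    have "G = (!) gs ` {..<length gs}" using gs by (auto simp: set_conv_nth)
    then have "U = range (lincomb (length gs) ((!) gs))"
      using G(3) span_eq_lincomb by metis
    then have "P (length gs)"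
      unfolding P_def using dd gs by (intro exI[of _ "\<lambda>l. dd (gs ! l)"] exI[of _ "(!) gs"]) auto
    then show ?thesis ..
  qed
  define q where "q = (LEAST q. P q)"
  have "P q" unfolding q_def using \<open>\<exists>q. P q\<close> by (rule LeastI_ex)
  then obtain ds g where hom: "\<And>l. l < q \<Longrightarrow> vhomog s (ds l) (g l)" and gen: "U = range (lincomb q g)"
    unfolding P_def by blast
  have "lookup (c l) 0 = 0" if c: "c \<in> syz q g" for c l
  proof (rule ccontr)
    assume nz: "lookup (c l) 0 \<noteq> 0"
    then have l: "l < q" using c by (cases "l < q") (auto simp: syz_def)
    \<comment> \<open>In the component of degree \<open>ds l\<close> the entry at \<open>l\<close>
      is a nonzero constant, hence invertible.\<close>
    define c' where "c' = vcomp ds (ds l) c"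
    have "c' \<in> syz q g"
      using graded_submodule_syz[of q s ds g] hom c by (simp add: graded_submodule_def c'_def)
    then have zero: "(\<Sum>i<q. c' i * g i k) = 0" for k
      by (auto simp: syz_def lincomb_def fun_eq_iff)
    define a where "a = inverse (lookup (c l) 0)"
    have c'l: "single 0 a * c' l = 1"
      using nz by (simp add: c'_def vcomp_def hcomp_degree_0 mult_single a_def)
    have gl: "g l k = (\<Sum>i\<in>{..<q} - {l}. (- single 0 a * c' i) * g i k)" for k
    proof -
      have "0 = single 0 a * (\<Sum>i<q. c' i * g i k)" using zero by simp
      also have "\<dots> = (\<Sum>i<q. single 0 a * c' i * g i k)"
        by (simp add: sum_distrib_left mult.assoc)
      also have "\<dots> = single 0 a * c' l * g l k + (\<Sum>i\<in>{..<q} - {l}. single 0 a * c' i * g i k)"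
        using l by (intro sum.remove) auto
      finally show ?thesis by (simp add: c'l sum_negf eq_neg_iff_add_eq_0)
    qed
    define g' where "g' i = (if i < l then g i else g (Suc i))" for i
    define ds' where "ds' i = (if i < l then ds i else ds (Suc i))" for i
    have img: "g ` ({..<q} - {l}) \<subseteq> g' ` {..<q - 1}"
    proof (rule image_subsetI)
      fix i
      assume i: "i \<in> {..<q} - {l}"
      show "g i \<in> g' ` {..<q - 1}"
      proof (cases "i < l")
        case True
        then show ?thesis using l by (intro image_eqI[of _ _ i]) (auto simp: g'_def)
      next
        case False
        then show ?thesis using i by (intro image_eqI[of _ _ "i - 1"]) (auto simp: g'_def)
      qed
    qed
    have "g l = (\<Sum>i\<in>{..<q} - {l}. vscale (- single 0 a * c' i) (g i))"
      by (rule ext) (simp only: sum_fun_apply vscale_apply gl[symmetric])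
    also have "\<dots> \<in> fm.span (g' ` {..<q - 1})"
      using img by (intro fm.span_sum fm.span_scale fm.span_base) auto
    finally have gl_span: "g l \<in> fm.span (g' ` {..<q - 1})" .
    have "g ` {..<q} \<subseteq> fm.span (g' ` {..<q - 1})"
    proof (rule image_subsetI)
      fix i
      assume "i \<in> {..<q}"
      then show "g i \<in> fm.span (g' ` {..<q - 1})"
        using gl_span img fm.span_superset[of "g' ` {..<q - 1}"] by (cases "i = l") blast+
    qed
    then have "fm.span (g ` {..<q}) \<subseteq> fm.span (g' ` {..<q - 1})"
      by (rule fm.span_minimal[OF _ fm.subspace_span])
    moreover have "fm.span (g' ` {..<q - 1}) \<subseteq> fm.span (g ` {..<q})"
      by (rule fm.span_mono) (auto simp: g'_def)
    ultimately have "U = range (lincomb (q - 1) g')"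
      unfolding gen by (simp add: span_eq_lincomb)
    moreover have "vhomog s (ds' i) (g' i)" if "i < q - 1" for i
      using that hom l by (auto simp: g'_def ds'_def)
    ultimately have "P (q - 1)" unfolding P_def by blast
    then have "q \<le> q - 1" unfolding q_def by (rule Least_le)
    then show False using l by simp
  qed
  then show ?thesis using hom gen unfolding min_gens_def by blast
qed

section \<open>Minimal graded free resolutions\<close>

definition vec_fun :: "'a::zero vec \<Rightarrow> nat \<Rightarrow> 'a" where
  "vec_fun v k = (if k < dim_vec v then v $ k else 0)"

text \<open>The column index comes first: \<open>mat_fun A l\<close> is the image of the l-th basis
  vector.\<close>

definition mat_fun :: "'a::zero mat \<Rightarrow> nat \<Rightarrow> nat \<Rightarrow> 'a" where
  "mat_fun A l k = (if k < dim_row A \<and> l < dim_col A then A $$ (k, l) else 0)"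

lemma vec_vec_fun: "v \<in> carrier_vec n \<Longrightarrow> vec n (vec_fun v) = v"
  by (rule eq_vecI) (auto simp: vec_fun_def)

lemma vec_fun_vec: "(\<And>k. k \<ge> n \<Longrightarrow> u k = 0) \<Longrightarrow> vec_fun (vec n u) = u"
  by (rule ext) (auto simp: vec_fun_def not_less)

lemma vec_fun_image_vec:
  assumes "\<And>u k. u \<in> V \<Longrightarrow> k \<ge> n \<Longrightarrow> u k = 0"
  shows "vec_fun ` vec n ` V = V"
proof -
  have "vec_fun (vec n u) = u" if "u \<in> V" for u
    using assms[OF that] by (rule vec_fun_vec)
  then show ?thesis by (simp add: image_image)
qed

lemma lincomb_cong: "(\<And>l. l < q \<Longrightarrow> c l = c' l) \<Longrightarrow> (\<And>l. l < q \<Longrightarrow> g l = g' l) \<Longrightarrow> lincomb q g c = lincomb q g' c'"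
  unfolding lincomb_def by (intro ext sum.cong) auto

lemma lincomb_lincomb: "lincomb p (\<lambda>l. lincomb q b (P l)) c = lincomb q b (lincomb p P c)"
proof
  fix k
  have "lincomb p (\<lambda>l. lincomb q b (P l)) c k = (\<Sum>l<p. \<Sum>j<q. c l * P l j * b j k)"
    by (simp add: lincomb_def sum_distrib_left mult.assoc)
  also have "\<dots> = (\<Sum>j<q. \<Sum>l<p. c l * P l j * b j k)" by (rule sum.swap)
  also have "\<dots> = lincomb q b (lincomb p P c) k"
    by (simp add: lincomb_def sum_distrib_right)
  finally show "lincomb p (\<lambda>l. lincomb q b (P l)) c k = lincomb q b (lincomb p P c) k" .
qed

lemma lincomb_diff: "lincomb q g (\<lambda>l. c l - d l) k = lincomb q g c k - lincomb q g d k"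
  by (simp add: lincomb_def left_diff_distrib sum_subtractf)

lemma lincomb_unit: "l < q \<Longrightarrow> lincomb q g (\<lambda>m. if m = l then 1 else 0) = g l"
  by (rule ext) (simp add: lincomb_def if_distrib[where f = "\<lambda>x. x * _"] cong: if_cong)

lemma mult_mat_vec_lincomb:
  assumes "A \<in> carrier_mat p q" "v \<in> carrier_vec q"
  shows "A *\<^sub>v v = vec p (lincomb q (mat_fun A) (vec_fun v))"
  by (rule eq_vecI)
     (use assms in \<open>auto simp: lincomb_def scalar_prod_def mat_fun_def vec_fun_def lessThan_atLeast0
        mult.commute intro!: sum.cong\<close>)

lemma image_mat_lincomb:
  assumes A: "A \<in> carrier_mat p q"
  shows "(\<lambda>v. A *\<^sub>v v) ` carrier_vec q = vec p ` range (lincomb q (mat_fun A))"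
proof safe
  fix v :: "'a vec"
  assume "v \<in> carrier_vec q"
  then show "A *\<^sub>v v \<in> vec p ` range (lincomb q (mat_fun A))"
    by (subst mult_mat_vec_lincomb[OF A]) auto
next
  fix c :: "nat \<Rightarrow> 'a"
  have "lincomb q (mat_fun A) c = lincomb q (mat_fun A) (vec_fun (vec q c))"
    by (rule lincomb_cong) (auto simp: vec_fun_def)
  then have "vec p (lincomb q (mat_fun A) c) = A *\<^sub>v vec q c"
    by (subst mult_mat_vec_lincomb[OF A]) auto
  then show "vec p (lincomb q (mat_fun A) c) \<in> (\<lambda>v. A *\<^sub>v v) ` carrier_vec q"
    by auto
qed

lemma vec_eq_0_iff:
  assumes "\<And>k. k \<ge> p \<Longrightarrow> u k = 0"
  shows "vec p u = 0\<^sub>v p \<longleftrightarrow> u = 0"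
proof
  assume "vec p u = 0\<^sub>v p"
  then have "vec p u $ k = 0" if "k < p" for k using that by simp
  then show "u = 0" using assms by (intro ext) (metis index_vec not_less zero_fun_apply)
qed auto

lemma mat_kernel_syz:
  assumes A: "A \<in> carrier_mat p q"
  shows "mat_kernel A = vec q ` syz q (mat_fun A)"
proof safe
  have zero: "vec p (lincomb q (mat_fun A) c) = 0\<^sub>v p \<longleftrightarrow> lincomb q (mat_fun A) c = 0" for c
    using A by (intro vec_eq_0_iff) (auto simp: lincomb_def mat_fun_def)
  fix v
  assume "v \<in> mat_kernel A"
  then have v: "v \<in> carrier_vec q" "A *\<^sub>v v = 0\<^sub>v p" using A by (auto simp: mat_kernel_def)
  then have "lincomb q (mat_fun A) (vec_fun v) = 0"
    using zero by (simp add: mult_mat_vec_lincomb[OF A])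
  then have "vec_fun v \<in> syz q (mat_fun A)"
    using v(1) by (simp add: syz_def) (simp add: vec_fun_def)
  then show "v \<in> vec q ` syz q (mat_fun A)"
    using vec_vec_fun[OF v(1)] by (metis imageI)
next
  fix c
  assume c: "c \<in> syz q (mat_fun A)"
  then have "vec_fun (vec q c) = c" by (intro vec_fun_vec) (simp add: syz_def)
  then have "A *\<^sub>v vec q c = 0\<^sub>v p"
    using c by (subst mult_mat_vec_lincomb[OF A]) (auto simp: syz_def)
  then show "vec q c \<in> mat_kernel A"
    using A by (auto simp: mat_kernel_def)
qed

lemma min_gens_mem: "min_gens s U q ds g \<Longrightarrow> l < q \<Longrightarrow> g l \<in> U"
  unfolding min_gens_def using lincomb_unit by (metis rangeI)

lemma min_gens_cong:
  assumes "min_gens s U q ds g" "\<And>l. l < q \<Longrightarrow> ds l = ds' l"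
  shows "min_gens s U q ds' g"
  using assms by (simp add: min_gens_def)

definition ideal_module :: "'a::zero set \<Rightarrow> (nat \<Rightarrow> 'a) set" where
  "ideal_module I = {u. u 0 \<in> I \<and> (\<forall>k\<ge>1. u k = 0)}"

lemma graded_submodule_ideal_module:
  assumes "im.subspace I" "\<And>h d. h \<in> I \<Longrightarrow> hcomp d h \<in> I"
  shows "graded_submodule 1 ((!) [0]) (ideal_module I)"
  unfolding graded_submodule_def
proof (intro conjI ballI allI impI)
  show "fm.subspace (ideal_module I)"
    using im.subspace_0[OF assms(1)] im.subspace_add[OF assms(1)] im.subspace_scale[OF assms(1)]
    by (intro fm.subspaceI) (auto simp: ideal_module_def)
qed (use assms in \<open>auto simp: ideal_module_def vcomp_def\<close>)

lemma vec_1_ideal_module: "vec 1 ` ideal_module I = {v \<in> carrier_vec 1. v $ 0 \<in> I}"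
proof safe
  fix v
  assume v: "v \<in> carrier_vec 1" "v $ 0 \<in> I"
  have "vec_fun v \<in> ideal_module I" using v by (auto simp: ideal_module_def vec_fun_def)
  then show "v \<in> vec 1 ` ideal_module I" using vec_vec_fun[OF v(1)] by (metis imageI)
qed (auto simp: ideal_module_def)

text \<open>Minimal generators of the successive syzygy modules are chosen forever. The state of the
  recursion is a list of shifts together with the submodule that the next differential has to
  cover.\<close>

theorem ex_minimal_graded_free_resolution:
  fixes I :: "('v::finite, 'k::field) mpoly set"
  assumes I: "im.subspace I" "\<And>h d. h \<in> I \<Longrightarrow> hcomp d h \<in> I" "I \<subseteq> irrelevant_ideal"
  shows "\<exists>F. minimal_graded_free_resolution I F"
proof -
  define P where "P n x \<longleftrightarrow> graded_submodule (length (fst x)) ((!) (fst x)) (snd x)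
    \<and> (n = 0 \<longrightarrow> x = ([0], ideal_module I))" for n :: nat and x :: "nat list \<times> (nat \<Rightarrow> ('v, 'k) mpoly) set"
  define Q where "Q x y \<longleftrightarrow> (\<exists>g. min_gens ((!) (fst x)) (snd x) (length (fst y)) ((!) (fst y)) g
    \<and> snd y = syz (length (fst y)) g)" for x y :: "nat list \<times> (nat \<Rightarrow> ('v, 'k) mpoly) set"
  have "\<exists>f. \<forall>n. P n (f n) \<and> Q (f n) (f (Suc n))"
  proof (rule dependent_nat_choice)
    show "\<exists>x. P 0 x"
      using graded_submodule_ideal_module[OF I(1,2)] by (auto simp: P_def)
  next
    fix x n
    assume "P n x"
    then obtain q ds g where g: "min_gens ((!) (fst x)) (snd x) q ds g"
      unfolding P_def using ex_min_gens by blast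
    let ?y = "(map ds [0..<q], syz q g)"
    have g': "min_gens ((!) (fst x)) (snd x) (length (fst ?y)) ((!) (fst ?y)) g"
      using min_gens_cong[OF g, of "(!) (map ds [0..<q])"] by simp
    have "graded_submodule q ((!) (map ds [0..<q])) (syz q g)"
      by (rule graded_submodule_syz[where s = "(!) (fst x)"]) (use g in \<open>simp add: min_gens_def\<close>)
    then have "P (Suc n) ?y \<and> Q x ?y" using g' by (auto simp: P_def Q_def)
    then show "\<exists>y. P (Suc n) y \<and> Q x y" ..
  qed
  then obtain f where f: "\<And>n. P n (f n)" "\<And>n. Q (f n) (f (Suc n))" by blast
  define ss U where "ss n = fst (f n)" and "U n = snd (f n)" for n
  obtain g where g: "\<And>n. min_gens ((!) (ss n)) (U n) (length (ss (Suc n))) ((!) (ss (Suc n))) (g n)"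
      "\<And>n. U (Suc n) = syz (length (ss (Suc n))) (g n)"
    using f(2) unfolding Q_def ss_def U_def by metis
  have 0: "ss 0 = [0]" "U 0 = ideal_module I" using f(1)[of 0] by (auto simp: P_def ss_def U_def)
  have supp: "u k = 0" if "u \<in> U n" "k \<ge> length (ss n)" for u n k
    using f(1)[of n] that by (auto simp: P_def graded_submodule_def ss_def U_def)
  define D where "D n = mat (length (ss n)) (length (ss (Suc n))) (\<lambda>(k, l). g n l k)" for n
  have D: "D n \<in> carrier_mat (length (ss n)) (length (ss (Suc n)))" for n by (simp add: D_def)
  have lincomb_D: "lincomb (length (ss (Suc n))) (mat_fun (D n)) = lincomb (length (ss (Suc n))) (g n)" for n
  proof (rule ext, rule lincomb_cong[OF refl])
    fix l
    assume l: "l < length (ss (Suc n))"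
    show "mat_fun (D n) l = g n l"
      using l supp[OF min_gens_mem[OF g(1)[of n] l]] by (auto simp: mat_fun_def D_def not_less fun_eq_iff)
  qed
  define F :: "('v, 'k) free_complex"
    where "F = \<lparr>shifts = ss, aug = vec 1 (\<lambda>_. 1), differential = D\<rparr>"
  have F_simps [simp]: "shifts F = ss" "aug F = vec 1 (\<lambda>_. 1)" "differential F = D" by (simp_all add: F_def)
  have image: "image_diff F n = vec (length (ss n)) ` U n" for n
    using image_mat_lincomb[OF D[of n]] g(1)[of n] unfolding lincomb_D
    by (simp add: image_diff_def free_module_def min_gens_def)
  have kernel: "mat_kernel (D n) = vec (length (ss (Suc n))) ` U (Suc n)" for n
    using mat_kernel_syz[OF D[of n]] g(2)[of n] by (simp add: syz_def lincomb_D)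
  have aug: "vec 1 (\<lambda>_. 1) \<bullet> v = v $ 0" if "v \<in> carrier_vec 1" for v :: "('v, 'k) mpoly vec"
    using that by (simp add: scalar_prod_def)
  have "graded_complex_data F"
    using D g(1) unfolding graded_complex_data_def
    by (auto simp: free_module_def 0 homog_map_entry_def D_def min_gens_def vhomog_def)
  moreover have "\<exists>v\<in>free_module F 0. p - aug F \<bullet> v \<in> I" for p
    using im.subspace_0[OF I(1)]
    by (intro bexI[of _ "vec 1 (\<lambda>_. p)"]) (simp_all add: free_module_def 0 aug del: One_nat_def)
  moreover have "{v \<in> free_module F 0. aug F \<bullet> v \<in> I} = image_diff F 0"
  proof -
    have "{v \<in> free_module F 0. aug F \<bullet> v \<in> I} = {v \<in> carrier_vec 1. v $ 0 \<in> I}"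
      using aug by (auto simp: free_module_def 0)
    then show ?thesis unfolding image 0 using vec_1_ideal_module[of I] by simp
  qed
  moreover have "v $ k \<in> irrelevant_ideal" if v: "v \<in> image_diff F i" and k: "k < length (ss i)" for i v k
  proof -
    obtain u where u: "u \<in> U i" "v = vec (length (ss i)) u" using v unfolding image by blast
    \<comment> \<open>In position 0 this is \<open>I \<subseteq> irrelevant_ideal\<close>; later it
      is the last clause of \<open>min_gens\<close> one step earlier.\<close>
    have "u k \<in> irrelevant_ideal"
    proof (cases i)
      case 0
      then show ?thesis using u(1) k I(3) 0 \<open>ss 0 = [0]\<close> \<open>U 0 = ideal_module I\<close>
        by (auto simp: ideal_module_def)
    next
      case (Suc j)
      then show ?thesis using u(1) g(1)[of j] g(2)[of j] by (simp add: irrelevant_ideal_iff min_gens_def)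
    qed
    then show ?thesis using u(2) k by simp
  qed
  ultimately have "minimal_graded_free_resolution I F"
    unfolding minimal_graded_free_resolution_def graded_free_resolution_def
    by (simp add: image kernel)
  then show ?thesis ..
qed

subsection \<open>Uniqueness of the shifts\<close>

text \<open>If \<open>q < p\<close>, padding with zeros gives square matrices with
  \<open>A * B = 1\<close>, hence \<open>B * A = 1\<close>; but row \<open>q\<close> of
  \<open>B\<close> is zero.\<close>

lemma right_inverse_le:
  fixes P Q :: "nat \<Rightarrow> nat \<Rightarrow> 'k::field"
  assumes PQ: "\<And>i j. i < p \<Longrightarrow> j < p \<Longrightarrow> (\<Sum>k<q. P i k * Q k j) = (if i = j then 1 else 0)"
  shows "p \<le> q"
proof (rule ccontr)
  assume "\<not> p \<le> q"
  then have qp: "q < p" by simp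
  define A B where "A = mat p p (\<lambda>(i, j). if j < q then P i j else 0)"
    and "B = mat p p (\<lambda>(i, j). if i < q then Q i j else 0)"
  have AB: "A \<in> carrier_mat p p" "B \<in> carrier_mat p p" by (simp_all add: A_def B_def)
  have "A * B = 1\<^sub>m p"
  proof (rule eq_matI)
    fix i j
    assume ij: "i < dim_row (1\<^sub>m p :: 'k mat)" "j < dim_col (1\<^sub>m p :: 'k mat)"
    have "(A * B) $$ (i, j) = (\<Sum>k<p. if k < q then P i k * Q k j else 0)"
      using ij by (auto simp: A_def B_def scalar_prod_def lessThan_atLeast0 intro!: sum.cong)
    also have "\<dots> = (\<Sum>k<q. P i k * Q k j)"
      using qp by (intro sum.mono_neutral_cong_right) auto
    finally show "(A * B) $$ (i, j) = 1\<^sub>m p $$ (i, j)"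
      using ij PQ by simp
  qed (auto simp: A_def B_def)
  then have "B * A = 1\<^sub>m p" by (rule mat_mult_left_right_inverse[OF AB])
  then have "(B * A) $$ (q, q) = 1" using qp by simp
  moreover have "(B * A) $$ (q, q) = 0"
    using qp by (auto simp: A_def B_def scalar_prod_def)
  ultimately show False by simp
qed

lemma lookup_lincomb_0:
  fixes g :: "nat \<Rightarrow> nat \<Rightarrow> ('v::finite, 'k::field) mpoly"
  shows "lookup (lincomb q g c k) 0 = (\<Sum>l<q. lookup (c l) 0 * lookup (g l k) 0)"
  by (simp add: lincomb_def lookup_sum lookup_mult_0)

text \<open>Substituting \<open>Q\<close> into \<open>P\<close> expresses \<open>a l\<close> through
  the \<open>a m\<close>. The difference to the unit vector at \<open>l\<close> is a syzygy, so it
  has no constant terms.\<close>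

lemma min_gens_inverse:
  fixes a b :: "nat \<Rightarrow> nat \<Rightarrow> ('v::finite, 'k::field) mpoly"
  assumes A: "min_gens s U p ds a"
    and P: "\<And>l. l < p \<Longrightarrow> a l = lincomb q b (P l)" and Q: "\<And>k. k < q \<Longrightarrow> b k = lincomb p a (Q k)"
    and lm: "l < p" "m < p"
  shows "(\<Sum>k<q. lookup (P l k) 0 * lookup (Q k m) 0) = (if l = m then 1 else 0)"
proof -
  define c where "c m = (if m < p then lincomb q Q (P l) m - (if m = l then 1 else 0) else 0)" for m
  have "lincomb p a (lincomb q Q (P l)) = lincomb q (\<lambda>k. lincomb p a (Q k)) (P l)"
    by (rule lincomb_lincomb[symmetric])
  also have "\<dots> = lincomb q b (P l)" by (rule lincomb_cong) (simp_all add: Q)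
  also have "\<dots> = a l" using P[OF lm(1)] ..
  finally have 1: "lincomb p a (lincomb q Q (P l)) = a l" .
  have "lincomb p a c = lincomb p a (\<lambda>m. lincomb q Q (P l) m - (if m = l then 1 else 0))"
    by (rule lincomb_cong) (simp_all add: c_def)
  also have "\<dots> = 0"
    by (rule ext) (simp add: lincomb_diff 1 lincomb_unit[OF lm(1)])
  finally have "c \<in> syz p a" by (simp add: syz_def c_def)
  then have "lookup (c m) 0 = 0" using A by (simp add: min_gens_def)
  then show ?thesis using lm(2) by (simp add: c_def lookup_minus lookup_lincomb_0 lookup_one split: if_splits)
qed

text \<open>The constant terms of the two transition matrices are mutually inverse. As
  \<open>b\<close> lives in the single degree \<open>\<delta>\<close>, so does \<open>a\<close>, and
  its transition matrix to \<open>b\<close> can be taken constant.\<close>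

lemma min_gens_unique:
  fixes a b :: "nat \<Rightarrow> nat \<Rightarrow> ('v::finite, 'k::field) mpoly"
  assumes A: "min_gens s U p ds a" and B: "min_gens s U q (\<lambda>_. \<delta>) b"
  shows "p = q" and "\<forall>l<p. ds l = \<delta>"
    and "\<exists>P Q. (\<forall>l<p. a l = lincomb q b (\<lambda>k. single 0 (P l k))) \<and>
      (\<forall>i<p. \<forall>j<p. (\<Sum>k<q. P i k * Q k j) = (if i = j then 1 else 0)) \<and>
      (\<forall>i<q. \<forall>j<q. (\<Sum>k<p. Q i k * P k j) = (if i = j then 1 else 0))"
proof -
  have "\<exists>P. a l = lincomb q b P" if "l < p" for l
    using min_gens_mem[OF A that] B unfolding min_gens_def by auto
  then obtain P0 where P0: "\<And>l. l < p \<Longrightarrow> a l = lincomb q b (P0 l)" by metis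
  have "\<exists>Q. b k = lincomb p a Q" if "k < q" for k
    using min_gens_mem[OF B that] A unfolding min_gens_def by auto
  then obtain Q where Q: "\<And>k. k < q \<Longrightarrow> b k = lincomb p a (Q k)" by metis
  \<comment> \<open>Only coefficients of degree \<open>ds l - \<delta>\<close> are kept. A nonzero
    constant term, which invertibility supplies in each row, is then possible only for
    \<open>ds l = \<delta>\<close>.\<close>
  define P where "P l = vcomp (\<lambda>_. \<delta>) (ds l) (P0 l)" for l
  have P: "a l = lincomb q b (P l)" if l: "l < p" for l
  proof -
    have "vhomog s (ds l) (a l)" using A l by (simp add: min_gens_def)
    then have "vcomp s (ds l) (a l) = a l"
      by (auto simp: vcomp_def vhomog_def homog_map_entry_iff fun_eq_iff hcomp_homog)
         (metis hcomp_0 hcomp_homog)+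
    moreover have "vcomp s (ds l) (a l) = lincomb q b (P l)"
      unfolding P_def P0[OF l] by (rule vcomp_lincomb) (use B in \<open>simp add: min_gens_def\<close>)
    ultimately show ?thesis by simp
  qed
  have PQ: "(\<Sum>k<q. lookup (P l k) 0 * lookup (Q k m) 0) = (if l = m then 1 else 0)" if "l < p" "m < p" for l m
    by (rule min_gens_inverse[OF A P Q that])
  have QP: "(\<Sum>k<p. lookup (Q l k) 0 * lookup (P k m) 0) = (if l = m then 1 else 0)" if "l < q" "m < q" for l m
    by (rule min_gens_inverse[OF B Q P that])
  have "p \<le> q"
    by (rule right_inverse_le[where P = "\<lambda>l k. lookup (P l k) 0" and Q = "\<lambda>k m. lookup (Q k m) 0"])
      (rule PQ)
  moreover have "q \<le> p"
    by (rule right_inverse_le[where P = "\<lambda>l k. lookup (Q l k) 0" and Q = "\<lambda>k m. lookup (P k m) 0"])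
      (rule QP)
  ultimately show "p = q" by simp
  show ds: "\<forall>l<p. ds l = \<delta>"
  proof (intro allI impI)
    fix l
    assume l: "l < p"
    have "(\<Sum>k<q. lookup (P l k) 0 * lookup (Q k l) 0) \<noteq> 0" using PQ[OF l l] by simp
    then obtain k where "lookup (P l k) 0 \<noteq> 0" by (metis (no_types, lifting) mult_zero_left sum.neutral)
    then show "ds l = \<delta>" by (auto simp: P_def vcomp_def lookup_hcomp split: if_splits)
  qed
  have "P l = (\<lambda>k. single 0 (lookup (P l k) 0))" if "l < p" for l
    using ds that by (auto simp: P_def vcomp_def hcomp_degree_0 fun_eq_iff)
  then have "a l = lincomb q b (\<lambda>k. single 0 (lookup (P l k) 0))" if "l < p" for l
    using P[OF that] that by metis
  then show "\<exists>P Q. (\<forall>l<p. a l = lincomb q b (\<lambda>k. single 0 (P l k))) \<and>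
      (\<forall>i<p. \<forall>j<p. (\<Sum>k<q. P i k * Q k j) = (if i = j then 1 else 0)) \<and>
      (\<forall>i<q. \<forall>j<q. (\<Sum>k<p. Q i k * P k j) = (if i = j then 1 else 0))"
    using PQ QP
    by (intro exI[of _ "\<lambda>l k. lookup (P l k) 0"] exI[of _ "\<lambda>l k. lookup (Q l k) 0"]) auto
qed

text \<open>Translates matrices into the function setting: exactness gives the generation clause,
  minimality of the following differential the clause on constant terms.\<close>

lemma min_gens_of_resolution:
  fixes F :: "('v::finite, 'k::field) free_complex"
  assumes F: "minimal_graded_free_resolution I F"
  defines "g i \<equiv> mat_fun (differential F i)"
  shows "range (lincomb (length (shifts F (Suc i))) (g i)) = U \<Longrightarrow>
    min_gens ((!) (shifts F i)) U (length (shifts F (Suc i))) ((!) (shifts F (Suc i))) (g i)"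
    and "range (lincomb (length (shifts F (Suc (Suc i)))) (g (Suc i))) = syz (length (shifts F (Suc i))) (g i)"
proof -
  have D: "\<And>i. differential F i \<in> carrier_mat (length (shifts F i)) (length (shifts F (Suc i)))"
    and hom: "\<And>i k l. k < length (shifts F i) \<Longrightarrow> l < length (shifts F (Suc i)) \<Longrightarrow>
      homog_map_entry (differential F i $$ (k, l)) (shifts F i ! k) (shifts F (Suc i) ! l)"
    and ker: "\<And>i. mat_kernel (differential F i) = image_diff F (Suc i)"
    and min: "\<And>i v k. v \<in> image_diff F i \<Longrightarrow> k < length (shifts F i) \<Longrightarrow> v $ k \<in> irrelevant_ideal"
    using F by (simp_all add: minimal_graded_free_resolution_def graded_free_resolution_def graded_complex_data_def)
  have supp: "u k = 0" if "u \<in> range (lincomb (length (shifts F (Suc i))) (g i))" "k \<ge> length (shifts F i)" for u i k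
    using that D[of i] by (auto simp: lincomb_def g_def mat_fun_def)
  have ker': "vec (length (shifts F (Suc i))) ` syz (length (shifts F (Suc i))) (g i)
    = vec (length (shifts F (Suc i))) ` range (lincomb (length (shifts F (Suc (Suc i)))) (g (Suc i)))" for i
    using ker[of i] mat_kernel_syz[OF D[of i]] image_mat_lincomb[OF D[of "Suc i"]]
    by (simp add: image_diff_def free_module_def g_def)
  have "vec_fun ` vec (length (shifts F (Suc i))) ` syz (length (shifts F (Suc i))) (g i)
    = syz (length (shifts F (Suc i))) (g i)"
    by (rule vec_fun_image_vec) (simp add: syz_def)
  moreover have "vec_fun ` vec (length (shifts F (Suc i))) ` range (lincomb (length (shifts F (Suc (Suc i)))) (g (Suc i)))
    = range (lincomb (length (shifts F (Suc (Suc i)))) (g (Suc i)))"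
    by (rule vec_fun_image_vec) (rule supp)
  ultimately show "range (lincomb (length (shifts F (Suc (Suc i)))) (g (Suc i))) = syz (length (shifts F (Suc i))) (g i)"
    using ker'[of i] by metis
  assume U: "range (lincomb (length (shifts F (Suc i))) (g i)) = U"
  have "lookup (c l) 0 = 0" if c: "c \<in> syz (length (shifts F (Suc i))) (g i)" for c l
  proof (cases "l < length (shifts F (Suc i))")
    case True
    have "vec (length (shifts F (Suc i))) c \<in> image_diff F (Suc i)"
      using c ker[of i] mat_kernel_syz[OF D[of i]] by (auto simp: g_def)
    from min[OF this True] show ?thesis using True by (simp add: irrelevant_ideal_iff)
  next
    case False
    then show ?thesis using c by (simp add: syz_def)
  qed
  moreover have "vhomog ((!) (shifts F i)) (shifts F (Suc i) ! l) (g i l)" if "l < length (shifts F (Suc i))" for l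
    using hom[of _ i l] that D[of i] by (auto simp: vhomog_def g_def mat_fun_def homog_map_entry_iff)
  ultimately show "min_gens ((!) (shifts F i)) U (length (shifts F (Suc i))) ((!) (shifts F (Suc i))) (g i)"
    using U by (simp add: min_gens_def)
qed

text \<open>Surjectivity gives an entry of \<open>aug F\<close> with nonzero constant term, and
  minimality leaves no room for a second basis element. That entry is a unit, so the augmentation
  kernel is \<open>I\<close>.\<close>

lemma resolution_shifts_0:
  fixes F :: "('v::finite, 'k::field) free_complex"
  assumes F: "minimal_graded_free_resolution I F" and I: "im.subspace I" "I \<subseteq> irrelevant_ideal"
  shows "shifts F 0 = [0]"
    and "range (lincomb (length (shifts F 1)) (mat_fun (differential F 0))) = ideal_module I"
proof -
  let ?r = "length (shifts F 0)"
  have augc: "aug F \<in> carrier_vec ?r" and D: "differential F 0 \<in> carrier_mat ?r (length (shifts F 1))"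
    and augh: "\<And>k. k < ?r \<Longrightarrow> homog_map_entry (aug F $ k) 0 (shifts F 0 ! k)"
    and surj: "\<And>p. \<exists>v\<in>carrier_vec ?r. p - aug F \<bullet> v \<in> I"
    and ker: "{v \<in> carrier_vec ?r. aug F \<bullet> v \<in> I} = image_diff F 0"
    and min: "\<And>v k. v \<in> image_diff F 0 \<Longrightarrow> k < ?r \<Longrightarrow> v $ k \<in> irrelevant_ideal"
    using F by (auto simp: minimal_graded_free_resolution_def graded_free_resolution_def
        graded_complex_data_def free_module_def)
  obtain v where v: "v \<in> carrier_vec ?r" "1 - aug F \<bullet> v \<in> I" using surj by blast
  then have "lookup (1 - aug F \<bullet> v) 0 = 0" using I(2) by (auto simp: irrelevant_ideal_iff)
  then have "(\<Sum>k<?r. lookup (aug F $ k) 0 * lookup (v $ k) 0) \<noteq> 0"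
    using v(1) by (simp add: scalar_prod_def lookup_minus lookup_sum lookup_mult_0 lessThan_atLeast0)
  then obtain k0 where k0: "k0 < ?r" "lookup (aug F $ k0) 0 \<noteq> 0"
    by (metis (no_types, lifting) lessThan_iff mult_zero_left sum.neutral)
  have only: "k = k0" if k: "k < ?r" for k
  proof (rule ccontr)
    assume ne: "k \<noteq> k0"
    \<comment> \<open>The Koszul relation between the entries \<open>k\<close> and \<open>k0\<close>
      lies in the augmentation kernel, yet has nonzero constant term at \<open>k\<close>.\<close>
    define w where "w = vec ?r (\<lambda>i. if i = k then aug F $ k0 else if i = k0 then - (aug F $ k) else 0)"
    have "aug F \<bullet> w = (\<Sum>i<?r. aug F $ i * w $ i)"
      by (simp add: scalar_prod_def w_def lessThan_atLeast0)
    also have "\<dots> = (\<Sum>i<?r. (if i = k then aug F $ k * aug F $ k0 else 0)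
      + (if i = k0 then - (aug F $ k0 * aug F $ k) else 0))"
      by (rule sum.cong) (use ne in \<open>auto simp: w_def\<close>)
    also have "\<dots> = 0" using k k0(1) by (simp add: sum.distrib mult.commute)
    finally have "w \<in> {v \<in> carrier_vec ?r. aug F \<bullet> v \<in> I}"
      using im.subspace_0[OF I(1)] by (simp add: w_def)
    then have "w $ k \<in> irrelevant_ideal" using min k unfolding ker by blast
    then show False using k k0 by (simp add: w_def irrelevant_ideal_iff)
  qed
  have r: "?r = 1"
  proof (rule ccontr)
    assume "?r \<noteq> 1"
    then have "0 < ?r" "1 < ?r" using k0(1) by auto
    then show False using only[of 0] only[of 1] by simp
  qed
  have k00: "k0 = 0" using k0(1) r by simp
  have key: "0 \<in> keys (aug F $ 0)" using k0(2) k00 by (simp add: in_keys_iff)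
  have sh: "shifts F 0 ! 0 = 0" using augh[of 0] key r by (auto simp: homog_map_entry_def)
  then show "shifts F 0 = [0]" using r by (cases "shifts F 0") auto
  have const: "aug F $ 0 = single 0 (lookup (aug F $ 0) 0)"
    using augh[of 0] sh r by (auto simp: homog_map_entry_iff hcomp_degree_0[symmetric] hcomp_homog)
  have unit: "single 0 (inverse (lookup (aug F $ 0) 0)) * (aug F $ 0) = 1"
    by (subst (2) const) (use k0(2) k00 in \<open>simp add: mult_single\<close>)
  have aug_iff: "aug F \<bullet> v \<in> I \<longleftrightarrow> v $ 0 \<in> I" if "v \<in> carrier_vec 1" for v
  proof -
    have "aug F \<bullet> v = (aug F $ 0) * v $ 0" using that by (simp add: scalar_prod_def)
    moreover have "v $ 0 = single 0 (inverse (lookup (aug F $ 0) 0)) * ((aug F $ 0) * v $ 0)"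
      using unit by (simp flip: mult.assoc)
    ultimately show ?thesis using im.subspace_scale[OF I(1)] by metis
  qed
  have "vec 1 ` range (lincomb (length (shifts F 1)) (mat_fun (differential F 0))) = image_diff F 0"
    using image_mat_lincomb[OF D] r by (simp add: image_diff_def free_module_def)
  also have "\<dots> = vec 1 ` ideal_module I"
    unfolding ker[symmetric] vec_1_ideal_module using aug_iff r by auto
  finally have eq: "vec 1 ` range (lincomb (length (shifts F 1)) (mat_fun (differential F 0))) = vec 1 ` ideal_module I" .
  have supp1: "u k = 0" if "u \<in> range (lincomb (length (shifts F 1)) (mat_fun (differential F 0)))" "k \<ge> 1" for u k
    using that D r by (auto simp: lincomb_def mat_fun_def)
  have supp2: "u k = 0" if "u \<in> ideal_module I" "k \<ge> 1" for u k
    using that by (auto simp: ideal_module_def)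
  show "range (lincomb (length (shifts F 1)) (mat_fun (differential F 0))) = ideal_module I"
  proof -
    let ?V = "range (lincomb (length (shifts F 1)) (mat_fun (differential F 0)))"
    have "vec_fun ` vec 1 ` ?V = ?V" by (rule vec_fun_image_vec) (rule supp1)
    moreover have "vec_fun ` vec 1 ` ideal_module I = ideal_module I" by (rule vec_fun_image_vec) (rule supp2)
    ultimately show ?thesis using eq by metis
  qed
qed

text \<open>The first differential differs from \<open>f\<close> by an invertible matrix of
  constants. Applied to coefficient vectors, it carries the syzygies of one system bijectively and
  degree by degree to those of the other, so \<open>min_gens_unique\<close> applies a second
  time.\<close>

theorem resolution_shifts_2:
  fixes F :: "('v::finite, 'k::field) free_complex"
  assumes F: "minimal_graded_free_resolution I F" and I: "im.subspace I" "I \<subseteq> irrelevant_ideal"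
    and f: "min_gens (\<lambda>_. 0) (ideal_module I) n (\<lambda>_. \<delta>) f"
    and z: "min_gens (\<lambda>_. \<delta>) (syz n f) N (\<lambda>_. \<epsilon>) z"
  shows "shifts F 2 = replicate N \<epsilon>"
proof -
  let ?h = "mat_fun (differential F 0)" and ?a = "mat_fun (differential F 1)"
  let ?r = "length (shifts F 1)" and ?q = "length (shifts F 2)"
  note sh0 = resolution_shifts_0[OF F I]
  have h0: "min_gens ((!) [0]) (ideal_module I) ?r ((!) (shifts F 1)) ?h"
    using min_gens_of_resolution(1)[OF F, of 0] sh0 by simp
  have "vhomog (\<lambda>_. 0) (shifts F 1 ! l) (?h l)" if l: "l < ?r" for l
    unfolding vhomog_def
  proof
    fix k
    have all: "homog_map_entry (?h l k) ([0] ! k) (shifts F 1 ! l)" for k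
      using h0 l by (simp add: min_gens_def vhomog_def)
    \<comment> \<open>\<open>[0] ! k\<close> is unspecified for positive \<open>k\<close>, but the
      entries there vanish, so the shift may be taken as 0 throughout.\<close>
    show "homog_map_entry (?h l k) 0 (shifts F 1 ! l)"
    proof (cases "k = 0")
      case True
      then show ?thesis using all[of 0] by simp
    next
      case False
      then have "?h l k = 0" using min_gens_mem[OF h0 l] by (simp add: ideal_module_def)
      then show ?thesis by (simp add: homog_map_entry_iff)
    qed
  qed
  then have h: "min_gens (\<lambda>_. 0) (ideal_module I) ?r ((!) (shifts F 1)) ?h"
    using h0 by (simp add: min_gens_def)
  have rn: "?r = n" and sh1: "\<forall>l<?r. shifts F 1 ! l = \<delta>"
    using min_gens_unique(1,2)[OF h f] by simp_all
  obtain P Q where P: "\<And>l. l < n \<Longrightarrow> ?h l = lincomb n f (\<lambda>k. single 0 (P l k))"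
    and PQ: "\<And>i j. i < n \<Longrightarrow> j < n \<Longrightarrow> (\<Sum>k<n. P i k * Q k j) = (if i = j then 1 else 0)"
    and QP: "\<And>i j. i < n \<Longrightarrow> j < n \<Longrightarrow> (\<Sum>k<n. Q i k * P k j) = (if i = j then 1 else 0)"
    using min_gens_unique(3)[OF h f] unfolding rn by blast
  \<comment> \<open>The cut-off at \<open>n\<close> keeps images supported below \<open>n\<close>,
    as membership in \<open>syz\<close> demands.\<close>
  define T T' :: "(nat \<Rightarrow> ('v, 'k) mpoly) \<Rightarrow> nat \<Rightarrow> ('v, 'k) mpoly" where
    "T = lincomb n (\<lambda>l k. if k < n then single 0 (P l k) else 0)"
    and "T' = lincomb n (\<lambda>l k. if k < n then single 0 (Q l k) else 0)"
  have inv: "lincomb n (\<lambda>l k. if k < n then single 0 (B l k) else 0)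
      (lincomb n (\<lambda>l k. if k < n then single 0 (A l k) else 0) u) = u"
    if AB: "\<And>i j. i < n \<Longrightarrow> j < n \<Longrightarrow> (\<Sum>k<n. A i k * B k j) = (if i = j then 1 else 0)"
      and u: "\<And>k. k \<ge> n \<Longrightarrow> u k = 0" for A B :: "nat \<Rightarrow> nat \<Rightarrow> 'k" and u :: "nat \<Rightarrow> ('v, 'k) mpoly"
  proof -
    have AB': "(\<Sum>l<n. single 0 (A i l) * single 0 (B l k)) = (if i = k then 1 else 0 :: ('v, 'k) mpoly)"
      if "i < n" "k < n" for i k
    proof -
      have "(\<Sum>l<n. single 0 (A i l) * single 0 (B l k)) = single 0 (\<Sum>l<n. A i l * B l k)"
        by (induction n) (simp_all add: mult_single single_add)
      then show ?thesis unfolding AB[OF that] by (cases "i = k") simp_all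
    qed
    have "lincomb n (\<lambda>l k. if k < n then single 0 (B l k) else 0)
      (lincomb n (\<lambda>l k. if k < n then single 0 (A l k) else 0) u)
      = lincomb n (\<lambda>l. lincomb n (\<lambda>l k. if k < n then single 0 (B l k) else 0)
          (\<lambda>k. if k < n then single 0 (A l k) else 0)) u"
      by (rule lincomb_lincomb[symmetric])
    also have "\<dots> = lincomb n (\<lambda>l k. if k = l then 1 else 0) u"
    proof (rule lincomb_cong[OF refl], rule ext)
      fix l k
      assume l: "l < n"
      show "lincomb n (\<lambda>l k. if k < n then single 0 (B l k) else 0)
          (\<lambda>k. if k < n then single 0 (A l k) else 0) k = (if k = l then 1 else 0 :: ('v, 'k) mpoly)"
        using AB'[OF l, of k] l by (cases "k < n") (auto simp: lincomb_def)
    qed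
    also have "\<dots> = u"
    proof
      fix k
      show "lincomb n (\<lambda>l k. if k = l then 1 else 0) u k = u k"
        using u[of k] by (simp add: lincomb_def if_distrib[where f = "(*) _"] cong: if_cong)
    qed
    finally show ?thesis .
  qed
  have T'T: "T' (T u) = u" if "\<And>k. k \<ge> n \<Longrightarrow> u k = 0" for u
    unfolding T_def T'_def by (rule inv[OF PQ that])
  have TT': "T (T' u) = u" if "\<And>k. k \<ge> n \<Longrightarrow> u k = 0" for u
    unfolding T_def T'_def by (rule inv[OF QP that])
  have lin_h: "lincomb n ?h c = lincomb n f (T c)" for c
  proof -
    have "lincomb n ?h c = lincomb n (\<lambda>l. lincomb n f (\<lambda>k. if k < n then single 0 (P l k) else 0)) c"
      by (rule lincomb_cong[OF refl]) (subst P, simp, rule lincomb_cong, simp_all)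
    then show ?thesis by (simp only: lincomb_lincomb T_def)
  qed
  have T_supp: "T u k = 0" "T' u k = 0" if "k \<ge> n" for u k
    using that by (simp_all add: T_def T'_def lincomb_def)
  have T_image: "T ` syz n ?h = syz n f"
  proof (intro equalityI subsetI)
    fix c
    assume "c \<in> T ` syz n ?h"
    then show "c \<in> syz n f" using lin_h T_supp by (auto simp: syz_def)
  next
    fix c
    assume c: "c \<in> syz n f"
    then have "T (T' c) = c" by (intro TT') (simp add: syz_def)
    moreover from this have "T' c \<in> syz n ?h" using c lin_h T_supp by (auto simp: syz_def)
    ultimately show "c \<in> T ` syz n ?h" by (metis imageI)
  qed
  have ra: "range (lincomb ?q ?a) = syz n ?h"
    using min_gens_of_resolution(2)[OF F, of 0] rn by (simp add: numeral_2_eq_2)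
  have a: "min_gens ((!) (shifts F 1)) (syz n ?h) ?q ((!) (shifts F 2)) ?a"
    using min_gens_of_resolution(1)[OF F, of 1] ra by (simp add: numeral_2_eq_2)
  have lin_Ta: "lincomb ?q (\<lambda>l. T (?a l)) c = T (lincomb ?q ?a c)" for c
    unfolding T_def by (rule lincomb_lincomb)
  have Ta: "min_gens (\<lambda>_. \<delta>) (syz n f) ?q ((!) (shifts F 2)) (\<lambda>l. T (?a l))"
    unfolding min_gens_def
  proof (intro conjI allI impI ballI)
    fix l
    assume l: "l < ?q"
    show "vhomog (\<lambda>_. \<delta>) (shifts F 2 ! l) (T (?a l))"
      unfolding vhomog_def
    proof
      fix k
      have "homog_map_entry (?a l i * single 0 (P i k)) \<delta> (shifts F 2 ! l)" if "i < n" for i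
      proof -
        have "homog_map_entry (?a l i) (shifts F 1 ! i) (shifts F 2 ! l)"
          using a l by (simp add: min_gens_def vhomog_def)
        then have "homog_map_entry (?a l i) \<delta> (shifts F 2 ! l)" using sh1 rn that by simp
        moreover have "homog (d + 0) (?a l i * single 0 (P i k))" if "homog d (?a l i)" for d
          by (rule homog_mult[OF that]) (simp add: homog_single)
        ultimately show ?thesis by (auto simp: homog_map_entry_iff)
      qed
      then have entries: "\<forall>i<n. \<forall>t\<in>keys (?a l i * single 0 (P i k)). \<delta> + mdeg t = shifts F 2 ! l"
        by (simp add: homog_map_entry_def)
      show "homog_map_entry (T (?a l) k) \<delta> (shifts F 2 ! l)"
      proof (cases "k < n")
        case True
        then have "T (?a l) k = (\<Sum>i<n. ?a l i * single 0 (P i k))" by (simp add: T_def lincomb_def)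
        then show ?thesis
          unfolding homog_map_entry_def using entries keys_sum[of "\<lambda>i. ?a l i * single 0 (P i k)" "{..<n}"]
          by (metis (no_types, lifting) UN_E lessThan_iff subsetD)
      qed (simp add: T_supp homog_map_entry_def)
    qed
  next
    show "syz n f = range (lincomb ?q (\<lambda>l. T (?a l)))"
      unfolding lin_Ta T_image[symmetric] ra[symmetric] by (simp add: image_image)
  next
    fix c l
    assume c: "c \<in> syz ?q (\<lambda>l. T (?a l))"
    then have 1: "T (lincomb ?q ?a c) = 0" unfolding lin_Ta[symmetric] by (simp add: syz_def)
    have "lincomb ?q ?a c \<in> syz n ?h" using ra by blast
    then have "lincomb ?q ?a c = T' (T (lincomb ?q ?a c))"
      by (intro T'T[symmetric]) (simp add: syz_def)
    also have "\<dots> = 0" unfolding 1 by (rule ext) (simp add: T'_def lincomb_def)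
    finally have "c \<in> syz ?q ?a" using c by (simp add: syz_def)
    then show "lookup (c l) 0 = 0" using a by (simp add: min_gens_def)
  qed
  have "?q = N" "\<forall>l<?q. shifts F 2 ! l = \<epsilon>"
    using min_gens_unique(1,2)[OF Ta z] by simp_all
  then show ?thesis by (intro nth_equalityI) auto
qed

section \<open>Odd unicyclic graphs\<close>

lemma rtrancl_simple_path:
  assumes "(a, b) \<in> r\<^sup>*"
  shows "\<exists>vs. vs \<noteq> [] \<and> hd vs = a \<and> last vs = b \<and> distinct vs
    \<and> (\<forall>i. Suc i < length vs \<longrightarrow> (vs ! i, vs ! Suc i) \<in> r)"
  using assms
proof (induction rule: rtrancl_induct)
  case base
  show ?case by (intro exI[of _ "[a]"]) simp
next
  case (step y z)
  then obtain vs where vs: "vs \<noteq> []" "hd vs = a" "last vs = y" "distinct vs"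
    "\<forall>i. Suc i < length vs \<longrightarrow> (vs ! i, vs ! Suc i) \<in> r" by blast
  show ?case
  proof (cases "z \<in> set vs")
    case True
    then obtain i where i: "i < length vs" "vs ! i = z" by (auto simp: in_set_conv_nth)
    \<comment> \<open>If the walk returns to \<open>z\<close>, the detour after the first visit is
      dropped.\<close>
    then have "last (take (Suc i) vs) = z" by (simp add: take_Suc_conv_app_nth)
    then show ?thesis using vs i by (intro exI[of _ "take (Suc i) vs"]) (auto simp: hd_take)
  next
    case False
    have "((vs @ [z]) ! i, (vs @ [z]) ! Suc i) \<in> r" if "Suc i < length (vs @ [z])" for i
    proof (cases "Suc i < length vs")
      case True
      then show ?thesis using vs(5) by (simp add: nth_append)
    next
      case False
      then have "Suc i = length vs" using that by simp
      then have "vs ! i = y" using vs(1,3) by (metis diff_Suc_1 last_conv_nth)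
      then show ?thesis using \<open>Suc i = length vs\<close> step(2) by (simp add: nth_append)
    qed
    then show ?thesis using vs False by (intro exI[of _ "vs @ [z]"]) auto
  qed
qed

text \<open>Two positions with equal edges would each have to be the cyclic successor of the other,
  which needs length at most 2.\<close>

lemma card_closed_edges:
  assumes "distinct vs" "3 \<le> length vs"
  shows "card (closed_edges vs) = length vs"
proof -
  let ?l = "length vs"
  let ?e = "\<lambda>i. {vs ! i, vs ! (Suc i mod ?l)}"
  have "closed_edges vs = ?e ` {..<?l}" by (auto simp: closed_edges_def)
  moreover have "inj_on ?e {..<?l}"
  proof (rule inj_onI)
    fix i j
    assume ij: "i \<in> {..<?l}" "j \<in> {..<?l}" and eq: "?e i = ?e j"
    have "0 < ?l" using assms(2) by linarith
    then have s: "Suc i mod ?l < ?l" "Suc j mod ?l < ?l" by simp_all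
    have "vs ! i = vs ! j \<or> vs ! i = vs ! (Suc j mod ?l) \<and> vs ! (Suc i mod ?l) = vs ! j"
      using eq by (auto simp: doubleton_eq_iff)
    then have "i = j \<or> i = Suc j mod ?l \<and> Suc i mod ?l = j"
      using assms(1) ij s by (simp add: nth_eq_iff_index_eq)
    then show "i = j"
      using ij assms(2) by (auto simp: mod_Suc split: if_splits)
  qed
  ultimately show ?thesis by (simp add: card_image)
qed

text \<open>Colours alternate along the list, and the closing edge forces the last index to be
  odd.\<close>

lemma even_card_cycle:
  assumes C: "C \<in> cycles E" and c: "\<And>i j. {i, j} \<in> E \<Longrightarrow> c i \<noteq> (c j :: bool)"
  shows "even (card C)"
proof -
  obtain vs where vs: "C = closed_edges vs" "3 \<le> length vs" "distinct vs" "closed_edges vs \<subseteq> E"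
    using C by (auto simp: cycles_def)
  have step: "c (vs ! i) \<noteq> c (vs ! (Suc i mod length vs))" if "i < length vs" for i
    using that vs(4) by (intro c) (auto simp: closed_edges_def)
  have alt: "c (vs ! i) = (c (vs ! 0) \<noteq> odd i)" if "i < length vs" for i
    using that
  proof (induction i)
    case (Suc i)
    then show ?case using step[of i] by auto
  qed simp
  have "Suc (length vs - 1) = length vs" using vs(2) by linarith
  then have "Suc (length vs - 1) mod length vs = 0" by (metis mod_self)
  then have "c (vs ! (length vs - 1)) \<noteq> c (vs ! 0)"
    using step[of "length vs - 1"] vs(2) by auto
  moreover have "length vs - 1 < length vs" using vs(2) by linarith
  ultimately have "odd (length vs - 1)" using alt by blast
  then show ?thesis using vs card_closed_edges[OF vs(3,2)] by (cases "length vs") auto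
qed

lemma odd_unicyclic_cycle:
  assumes "odd_unicyclic E" "C \<in> cycles E"
  shows "odd (card C)" and "C' \<in> cycles E \<Longrightarrow> C' = C"
proof -
  show *: "C' = C" if "C' \<in> cycles E" for C'
    using assms that by (auto simp: odd_unicyclic_def unicyclic_def)
  have "girth E = card C"
    unfolding girth_def
  proof (rule Least_equality)
    show "\<exists>D\<in>cycles E. card D = card C" using assms(2) by blast
    show "card C \<le> l" if "\<exists>D\<in>cycles E. card D = l" for l using that * by blast
  qed
  then show "odd (card C)" using assms by (simp add: odd_unicyclic_def)
qed

text \<open>Otherwise the four edges would form a cycle of even length, while the only cycle is
  odd.\<close>

lemma odd_unicyclic_no_4_cycle:
  assumes E: "simple_graph E" "odd_unicyclic E"
    and "{a, i} \<in> E" "{i, b} \<in> E" "{b, j} \<in> E" "{j, a} \<in> E" "a \<noteq> b"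
  shows "i = j"
proof (rule ccontr)
  assume "i \<noteq> j"
  have "u \<noteq> v" if "{u, v} \<in> E" for u v using E(1) that by (force simp: simple_graph_def)
  then have d: "distinct [a, i, b, j]" using assms \<open>i \<noteq> j\<close> by auto
  have "closed_edges [a, i, b, j] \<subseteq> E"
  proof
    fix e
    assume "e \<in> closed_edges [a, i, b, j]"
    moreover have len: "length [a, i, b, j] = 4" by simp
    ultimately obtain k where k: "k < 4" "e = {[a, i, b, j] ! k, [a, i, b, j] ! (Suc k mod 4)}"
      unfolding closed_edges_def len by blast
    then have "k = 0 \<or> k = 1 \<or> k = 2 \<or> k = 3" by linarith
    then show "e \<in> E" using k(2) assms(3-6) by (auto simp: insert_commute)
  qed
  then have "closed_edges [a, i, b, j] \<in> cycles E" using d by (auto simp: cycles_def)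
  then have "odd (card (closed_edges [a, i, b, j]))" by (rule odd_unicyclic_cycle(1)[OF E(2)])
  then show False using card_closed_edges[OF d] by simp
qed

section \<open>Orders of the edges along a spanning tree\<close>

definition bichromatic :: "('n \<Rightarrow> bool) \<Rightarrow> ('n \<times> 'n) list \<Rightarrow> bool" where
  "bichromatic c es \<longleftrightarrow> (\<forall>(i, j)\<in>set es. c i \<noteq> c j)"

text \<open>The colouring may depend on \<open>k\<close>; these are the hypotheses of
  \<open>dot_poly_colon\<close> for the k-th edge and its predecessors.\<close>

definition monochromatic_extension :: "('n \<times> 'n) list \<Rightarrow> bool" where
  "monochromatic_extension es \<longleftrightarrow> (\<forall>k<length es. fst (es ! k) \<noteq> snd (es ! k)
    \<and> (\<exists>c. bichromatic c (take k es) \<and> c (fst (es ! k)) = c (snd (es ! k))))"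

definition edge_rel :: "('n \<times> 'n) list \<Rightarrow> ('n \<times> 'n) set" where
  "edge_rel es = set es \<union> (set es)\<inverse>"

lemma monochromatic_extension_snoc:
  "monochromatic_extension (es @ [(a, b)]) \<longleftrightarrow>
    monochromatic_extension es \<and> a \<noteq> b \<and> (\<exists>c. bichromatic c es \<and> c a = c b)"
  by (auto simp: monochromatic_extension_def nth_append less_Suc_eq)

text \<open>A new leaf \<open>w\<close> lies on no earlier edge, so its colour is free: equal to
  that of \<open>u\<close> to make the new edge monochromatic, opposite to it to carry the
  bichromatic colouring on.\<close>

lemma spanning_tree:
  fixes E :: "'n::finite set set"
  assumes E: "simple_graph E" "connected_graph E" and m: "1 \<le> m" "m \<le> CARD('n)"
  shows "\<exists>V es c. card V = m \<and> Suc (length es) = m \<and> (\<forall>(i, j)\<in>set es. i \<in> V \<and> j \<in> V \<and> {i, j} \<in> E)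
    \<and> bichromatic c es \<and> monochromatic_extension es \<and> V \<times> V \<subseteq> (edge_rel es)\<^sup>*"
  using m
proof (induction m rule: dec_induct)
  case base
  show ?case
    by (rule exI[of _ "{undefined}"], rule exI[of _ "[]"])
       (simp add: bichromatic_def monochromatic_extension_def)
next
  case (step m)
  then obtain V es c where IH: "card V = m" "Suc (length es) = m"
    "\<forall>(i, j)\<in>set es. i \<in> V \<and> j \<in> V \<and> {i, j} \<in> E" "bichromatic c es" "monochromatic_extension es"
    "V \<times> V \<subseteq> (edge_rel es)\<^sup>*" by auto
  have "\<exists>u w. u \<in> V \<and> w \<notin> V \<and> {u, w} \<in> E"
  proof (rule ccontr)
    assume no: "\<not> ?thesis"
    obtain v where v: "v \<in> V" using IH(1) step(1) by fastforce
    have "x \<in> V" for x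
    proof -
      have "(v, x) \<in> {(a, b). {a, b} \<in> E}\<^sup>*" using E(2) by (simp add: connected_graph_def)
      then show "x \<in> V" by (induction rule: rtrancl_induct) (use v no in auto)
    qed
    then have "V = UNIV" by blast
    then show False using IH(1) step(4) by simp
  qed
  then obtain u w where uw: "u \<in> V" "w \<notin> V" "{u, w} \<in> E" by blast
  let ?es = "es @ [(u, w)]"
  have new: "bichromatic (c(w := x)) es" for x
    using IH(3,4) uw(2) by (fastforce simp: bichromatic_def)
  have "u \<noteq> w" using uw by auto
  have bi: "bichromatic (c(w := \<not> c u)) ?es"
    using new[of "\<not> c u"] \<open>u \<noteq> w\<close> by (simp add: bichromatic_def)
  have mono: "monochromatic_extension ?es"
    unfolding monochromatic_extension_snoc using IH(5) new[of "c u"] \<open>u \<noteq> w\<close>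
    by (intro conjI exI[of _ "c(w := c u)"]) auto
  have sub: "(edge_rel es)\<^sup>* \<subseteq> (edge_rel ?es)\<^sup>*"
    by (rule rtrancl_mono) (auto simp: edge_rel_def)
  have uw_rel: "(u, w) \<in> (edge_rel ?es)\<^sup>*" "(w, u) \<in> (edge_rel ?es)\<^sup>*"
    by (auto simp: edge_rel_def)
  have conn: "insert w V \<times> insert w V \<subseteq> (edge_rel ?es)\<^sup>*"
  proof (rule subsetI, clarify)
    fix x y
    assume xy: "x \<in> insert w V" "y \<in> insert w V"
    have "(x, u) \<in> (edge_rel ?es)\<^sup>*" using xy(1) uw_rel(2) uw(1) IH(6) sub by blast
    moreover have "(u, y) \<in> (edge_rel ?es)\<^sup>*" using xy(2) uw_rel(1) uw(1) IH(6) sub by blast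
    ultimately show "(x, y) \<in> (edge_rel ?es)\<^sup>*" by (rule rtrancl_trans)
  qed
  have "card (insert w V) = Suc m" using uw(2) IH(1) by (simp add: card_insert_if)
  moreover have "Suc (length ?es) = Suc m" using IH(2) by simp
  moreover have "\<forall>(i, j)\<in>set ?es. i \<in> insert w V \<and> j \<in> insert w V \<and> {i, j} \<in> E"
    using IH(3) uw by auto
  ultimately show ?case using bi mono conn by blast
qed

text \<open>The odd cycle prevents the tree colouring from being proper on \<open>E\<close>, so some
  edge \<open>{a, b}\<close> outside the tree is monochromatic; it is placed last. It is the only
  edge outside the tree, since every such edge closes a cycle.\<close>

lemma odd_unicyclic_edge_order:
  fixes E :: "'n::finite set set"
  assumes E: "simple_graph E" "connected_graph E" "odd_unicyclic E"
  shows "\<exists>es. length es = CARD('n) \<and> E = (\<lambda>(i, j). {i, j}) ` set es \<and> monochromatic_extension es"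
proof -
  obtain V es c where T: "card V = CARD('n)" "Suc (length es) = CARD('n)"
    "\<forall>(i, j)\<in>set es. i \<in> V \<and> j \<in> V \<and> {i, j} \<in> E" "bichromatic c es" "monochromatic_extension es"
    "V \<times> V \<subseteq> (edge_rel es)\<^sup>*"
  proof -
    have "1 \<le> CARD('n)" using finite_UNIV_card_ge_0[where 'a = 'n] by simp
    from spanning_tree[OF E(1,2) this le_refl] show thesis using that by blast
  qed
  have V: "V = UNIV" using T(1) by (simp add: card_eq_UNIV_imp_eq_UNIV)
  let ?T = "(\<lambda>(i, j). {i, j}) ` set es"
  have TE: "?T \<subseteq> E" using T(3) by auto
  have rel_iff: "(i, j) \<in> edge_rel es \<Longrightarrow> {i, j} \<in> ?T" for i j
    by (force simp: edge_rel_def insert_commute)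
  obtain C where C: "C \<in> cycles E"
    using E(3) by (auto simp: odd_unicyclic_def unicyclic_def)
  \<comment> \<open>The fundamental cycle of a non-tree edge must be \<open>C\<close>, by
    uniqueness.\<close>
  have fund: "{a, b} \<in> C \<and> C \<subseteq> insert {a, b} ?T" if ab: "{a, b} \<in> E - ?T" for a b
  proof -
    have "a \<noteq> b" using ab E(1) by (force simp: simple_graph_def)
    have "(a, b) \<in> (edge_rel es)\<^sup>*" using T(6) V by auto
    then obtain vs where vs: "vs \<noteq> []" "hd vs = a" "last vs = b" "distinct vs"
      "\<forall>i. Suc i < length vs \<longrightarrow> (vs ! i, vs ! Suc i) \<in> edge_rel es"
      using rtrancl_simple_path by metis
    have ends: "vs ! 0 = a" "vs ! (length vs - 1) = b"
      using vs by (simp_all add: hd_conv_nth last_conv_nth)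
    \<comment> \<open>Length 1 would give \<open>a = b\<close>, and length 2 would make
      \<open>{a, b}\<close> a tree edge.\<close>
    have len: "3 \<le> length vs"
    proof (rule ccontr)
      assume "\<not> 3 \<le> length vs"
      then have "length vs = 0 \<or> length vs = 1 \<or> length vs = 2" by linarith
      then show False
        using vs(1,5) ends \<open>a \<noteq> b\<close> rel_iff[of a b] ab by auto
    qed
    have edges: "{vs ! i, vs ! (Suc i mod length vs)} \<in> insert {a, b} ?T" if "i < length vs" for i
    proof (cases "Suc i < length vs")
      case True
      then show ?thesis using vs(5) rel_iff by simp
    next
      case False
      then have "Suc i = length vs" using that by simp
      then have "Suc i mod length vs = 0" "i = length vs - 1" by simp_all
      then show ?thesis using ends by (simp add: insert_commute)
    qed
    have last: "length vs - 1 < length vs" "Suc (length vs - 1) = length vs" using len by simp_all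
    have "closed_edges vs \<subseteq> insert {a, b} ?T"
      using edges by (auto simp: closed_edges_def)
    moreover have "{a, b} \<in> closed_edges vs"
      unfolding closed_edges_def
    proof (intro CollectI exI[of _ "length vs - 1"] conjI)
      show "{a, b} = {vs ! (length vs - 1), vs ! (Suc (length vs - 1) mod length vs)}"
        unfolding last(2) mod_self ends by (rule insert_commute)
    qed (rule last(1))
    moreover have "closed_edges vs \<in> cycles E"
      using calculation(1) ab TE len vs(4) by (auto simp: cycles_def)
    then have "closed_edges vs = C" by (rule odd_unicyclic_cycle(2)[OF E(3) C])
    ultimately show ?thesis by simp
  qed
  have not_bi: "\<exists>i j. {i, j} \<in> E \<and> c i = c j"
    using even_card_cycle[OF C, of c] odd_unicyclic_cycle(1)[OF E(3) C] by blast
  then obtain a b where ab: "{a, b} \<in> E" "c a = c b" by blast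
  have abT: "{a, b} \<notin> ?T"
  proof
    assume "{a, b} \<in> ?T"
    then obtain i j where "(i, j) \<in> set es" "{a, b} = {i, j}" by auto
    then show False using T(4) ab(2) by (auto simp: bichromatic_def doubleton_eq_iff)
  qed
  have "E \<subseteq> insert {a, b} ?T"
  proof
    fix e
    assume e: "e \<in> E"
    show "e \<in> insert {a, b} ?T"
    proof (rule ccontr)
      \<comment> \<open>A second non-tree edge would lie on \<open>C\<close>, but \<open>C\<close>
        has no edges besides \<open>{a, b}\<close> and tree edges.\<close>
      assume ne: "e \<notin> insert {a, b} ?T"
      obtain i j where ij: "e = {i, j}" using E(1) e by (auto simp: simple_graph_def card_2_iff)
      then have "{i, j} \<in> C" using fund[of i j] e ne by auto
      then show False using fund[of a b] ab(1) abT ne ij by auto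
    qed
  qed
  then have "E = insert {a, b} ?T" using TE ab(1) by blast
  moreover have "a \<noteq> b" using ab(1) E(1) by (force simp: simple_graph_def)
  then have "monochromatic_extension (es @ [(a, b)])"
    unfolding monochromatic_extension_snoc using T(4,5) ab(2) by blast
  ultimately show ?thesis using T(2) by (intro exI[of _ "es @ [(a, b)]"]) auto
qed

section \<open>Syzygies of the generators\<close>

text \<open>A fine invariant of monomials: all monomials of \<open>dot_poly i j\<close> and of
  \<open>det_poly i j\<close> have the value \<open>{i, j}\<close>.\<close>

definition vsupp :: "('n + 'n \<Rightarrow>\<^sub>0 nat) \<Rightarrow> 'n set" where
  "vsupp t = vertex ` keys t"

lemma vsupp_single_add: "vsupp (single u 1 + single w 1) = {vertex u, vertex w}"
proof -
  have "keys (single u 1 + single w (1 :: nat)) = {u, w}"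
    by (auto simp: in_keys_iff lookup_add lookup_single when_def split: if_splits)
  then show ?thesis by (simp add: vsupp_def)
qed

lemma Var_mult_Var: "Var u * Var w = single (single u 1 + single w 1) 1"
  by (simp add: Var_def mult_single)

lemma vsupp_dot_poly: "t \<in> keys (dot_poly i j) \<Longrightarrow> vsupp t = {i, j}"
proof -
  assume "t \<in> keys (dot_poly i j)"
  then have "t = single (Inl i) 1 + single (Inl j) 1 \<or> t = single (Inr i) 1 + single (Inr j) 1"
    unfolding dot_poly_def Var_mult_Var in_keys_iff lookup_add lookup_single when_def by (auto split: if_splits)
  then show ?thesis by (elim disjE) (simp_all only: vsupp_single_add sum.case)
qed

lemma vsupp_det_poly: "t \<in> keys (det_poly i j) \<Longrightarrow> vsupp t = {i, j}"
proof -
  assume "t \<in> keys (det_poly i j)"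
  then have "t = single (Inl i) 1 + single (Inr j) 1 \<or> t = single (Inl j) 1 + single (Inr i) 1"
    unfolding det_poly_def Var_mult_Var in_keys_iff lookup_minus lookup_single when_def by (auto split: if_splits)
  then show ?thesis by (elim disjE) (simp_all only: vsupp_single_add sum.case insert_commute)
qed

lemma dot_poly_neq_0: "dot_poly i j \<noteq> (0 :: ('n + 'n, 'k::field) mpoly)"
proof -
  have "lookup (single (Inl i) 1 + single (Inl j) (1::nat)) (Inl i) \<noteq> lookup (single (Inr i) 1 + single (Inr j) 1) (Inl i)"
    by (simp add: lookup_add lookup_single)
  then have ne: "single (Inl i) 1 + single (Inl j) (1::nat) \<noteq> single (Inr i) 1 + single (Inr j) 1" by metis
  have "lookup (dot_poly i j :: ('n + 'n, 'k) mpoly) (single (Inl i) 1 + single (Inl j) 1) = 1"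
    unfolding dot_poly_def Var_mult_Var lookup_add lookup_single using ne[symmetric] by simp
  then show ?thesis by auto
qed

lemma det_poly_neq_0: "i \<noteq> j \<Longrightarrow> det_poly i j \<noteq> (0 :: ('n + 'n, 'k::field) mpoly)"
proof -
  assume "i \<noteq> j"
  then have "lookup (single (Inl i) 1 + single (Inr j) (1::nat)) (Inl i) \<noteq> lookup (single (Inl j) 1 + single (Inr i) 1) (Inl i)"
    by (simp add: lookup_add lookup_single)
  then have ne: "single (Inl i) 1 + single (Inr j) (1::nat) \<noteq> single (Inl j) 1 + single (Inr i) 1" by metis
  have "lookup (det_poly i j :: ('n + 'n, 'k) mpoly) (single (Inl i) 1 + single (Inr j) 1) = 1"
    unfolding det_poly_def Var_mult_Var lookup_minus lookup_single using ne[symmetric] by simp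
  then show ?thesis by auto
qed

lemma homog_dot_poly: "homog 2 (dot_poly i j :: ('n::finite + 'n, 'k::field) mpoly)"
  using homog_add homog_mult[OF homog_Var homog_Var] unfolding dot_poly_def by (metis one_add_one)

lemma homog_det_poly: "homog 2 (det_poly i j :: ('n::finite + 'n, 'k::field) mpoly)"
  using homog_diff homog_mult[OF homog_Var homog_Var] unfolding det_poly_def by (metis one_add_one)

text \<open>The three-term Pluecker relation after rotating the vector of \<open>u\<close>. It puts
  \<open>det_poly i j\<close> into the colon ideal when \<open>u\<close> is adjacent to
  \<open>i\<close> and \<open>j\<close>.\<close>

lemma claw_identity:
  "det_poly i j * dot_poly u w = det_poly w j * dot_poly u i + det_poly i w * (dot_poly u j :: ('n + 'n, 'k::field) mpoly)"
proof -
  have "(xi * yj - xj * yi) * (xu * xw + yu * yw) = (xw * yj - xj * yw) * (xu * xi + yu * yi)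
    + (xi * yw - xw * yi) * (xu * xj + yu * (yj :: 'a::comm_ring_1))" for xi yi xj yj xu yu xw yw
    by (simp add: algebra_simps)
  then show ?thesis unfolding det_poly_def dot_poly_def .
qed

text \<open>A monomial of \<open>q x\<close> occurs in no other \<open>q y\<close>, so its
  coefficient in the sum is a nonzero multiple of \<open>C x\<close>.\<close>

lemma vsupp_independent:
  fixes q :: "'i \<Rightarrow> ('n + 'n, 'k::field) mpoly"
  assumes fin: "finite A" and supp: "\<And>x t. x \<in> A \<Longrightarrow> t \<in> keys (q x) \<Longrightarrow> vsupp t = p x"
    and inj: "inj_on p A" and nz: "\<And>x. x \<in> A \<Longrightarrow> q x \<noteq> 0"
    and sum: "(\<Sum>x\<in>A. single 0 (C x) * q x) = 0" and x: "x \<in> A"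
  shows "C x = 0"
proof -
  obtain t where t: "t \<in> keys (q x)" using nz[OF x] by (metis keys_eq_empty all_not_in_conv)
  have lk: "lookup (single 0 c * r) t = c * lookup r t" for c and r :: "('n + 'n, 'k) mpoly"
    using lookup_single_mult[of 0 c r t] by simp
  have "lookup (q y) t = 0" if "y \<in> A" "y \<noteq> x" for y
    using supp[OF that(1), of t] supp[OF x t] inj that x by (auto simp: inj_on_def in_keys_iff)
  then have "(\<Sum>y\<in>A. C y * lookup (q y) t) = C x * lookup (q x) t"
    by (subst sum.remove[OF fin x]) simp
  moreover have "lookup (\<Sum>y\<in>A. single 0 (C y) * q y) t = (\<Sum>y\<in>A. C y * lookup (q y) t)"
    by (simp add: lookup_sum lk)
  ultimately show ?thesis using sum t by (simp add: in_keys_iff)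
qed

text \<open>\<open>no_4_cycle\<close> says that two distinct vertices have at most one common
  neighbour.\<close>

locale edge_order =
  fixes es :: "('n::finite \<times> 'n) list"
  assumes mono: "monochromatic_extension es"
    and no_4_cycle: "\<And>a b i j. (a, i) \<in> edge_rel es \<Longrightarrow> (i, b) \<in> edge_rel es \<Longrightarrow> (b, j) \<in> edge_rel es
      \<Longrightarrow> (j, a) \<in> edge_rel es \<Longrightarrow> a \<noteq> b \<Longrightarrow> i = j"
begin

section \<open>Counting the indices of the syzygies\<close>

abbreviation n where "n \<equiv> length es"
abbreviation src where "src k \<equiv> fst (es ! k)"
abbreviation tgt where "tgt k \<equiv> snd (es ! k)"

definition rel :: "nat \<Rightarrow> ('n \<times> 'n) set" where
  "rel k = edge_rel (take k es)"

definition edges :: "nat \<Rightarrow> 'n set set" where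
  "edges k = (\<lambda>(i, j). {i, j}) ` set (take k es)"

definition nb :: "nat \<Rightarrow> 'n \<Rightarrow> 'n set" where
  "nb k v = rel k `` {v}"

definition pairs_at :: "nat \<Rightarrow> 'n \<Rightarrow> 'n set set" where
  "pairs_at k v = {A. A \<subseteq> nb k v \<and> card A = 2}"

text \<open>Indices of the syzygies whose last nonzero entry is at position \<open>k\<close>: one Koszul syzygy for
  each earlier edge, and one for each claw completed by the edge \<open>k\<close>.\<close>

definition pairs :: "nat \<Rightarrow> 'n set set" where
  "pairs k = edges k \<union> pairs_at k (src k) \<union> pairs_at k (tgt k)"

definition gen :: "nat \<Rightarrow> ('n + 'n, 'k::field) mpoly" where
  "gen k = dot_poly (src k) (tgt k)"

definition gen_vec :: "nat \<Rightarrow> nat \<Rightarrow> ('n + 'n, 'k::field) mpoly" where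
  "gen_vec l k = (if k = 0 then gen l else 0)"

lemma rel_sym: "sym (rel k)"
  by (auto simp: rel_def edge_rel_def sym_def)

lemma edges_iff: "{i, j} \<in> edges k \<longleftrightarrow> (i, j) \<in> rel k"
  by (force simp: edges_def rel_def edge_rel_def doubleton_eq_iff)

lemma rel_iff: "k \<le> n \<Longrightarrow> (i, j) \<in> rel k \<longleftrightarrow> (\<exists>m<k. es ! m = (i, j) \<or> es ! m = (j, i))"
  by (auto simp: rel_def edge_rel_def in_set_conv_nth)

lemma earlier_edge: "l < k \<Longrightarrow> k \<le> n \<Longrightarrow> (src l, tgt l) \<in> rel k"
  using rel_iff[of k "src l" "tgt l"] by (metis prod.collapse)

lemma rel_subset: "rel k \<subseteq> edge_rel es"
  by (auto simp: rel_def edge_rel_def dest: in_set_takeD)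

lemma edges_Suc: "k < n \<Longrightarrow> edges (Suc k) = insert {src k, tgt k} (edges k)"
  by (simp add: edges_def take_Suc_conv_app_nth case_prod_beta)

lemma rel_Suc: "k < n \<Longrightarrow> rel (Suc k) = rel k \<union> {(src k, tgt k), (tgt k, src k)}"
  by (cases "es ! k") (auto simp: rel_def edge_rel_def take_Suc_conv_app_nth)

lemma src_neq_tgt: "k < n \<Longrightarrow> src k \<noteq> tgt k"
  using mono by (simp add: monochromatic_extension_def)

lemma colouring:
  assumes "k < n"
  obtains c :: "'n \<Rightarrow> bool" where "\<And>i j. (i, j) \<in> rel k \<Longrightarrow> c i \<noteq> c j" "c (src k) = c (tgt k)"
proof -
  obtain c where c: "bichromatic c (take k es)" "c (src k) = c (tgt k)"
    using mono assms by (auto simp: monochromatic_extension_def)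
  have "c i \<noteq> c j" if "(i, j) \<in> rel k" for i j
    using c(1) that by (auto simp: bichromatic_def rel_def edge_rel_def)
  then show thesis using c(2) that by blast
qed

lemma src_tgt_notin_rel: "k < n \<Longrightarrow> (src k, tgt k) \<notin> rel k"
  using colouring by metis

text \<open>A new edge is monochromatic for a colouring proper on the earlier ones, so no edge is
  repeated.\<close>

lemma card_edges: "k \<le> n \<Longrightarrow> card (edges k) = k"
proof (induction k)
  case (Suc k)
  then have "{src k, tgt k} \<notin> edges k" using src_tgt_notin_rel[of k] by (simp add: edges_iff)
  moreover have "finite (edges k)" by (simp add: edges_def)
  ultimately show ?case using Suc by (simp add: edges_Suc)
qed (simp add: edges_def)

lemma inj_edge: "inj_on (\<lambda>k. {src k, tgt k}) {..<n}"
proof (rule linorder_inj_onI)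
  fix l k
  assume lk: "l < k" "l \<in> {..<n}" "k \<in> {..<n}"
  then have "(src l, tgt l) \<in> rel k" by (intro earlier_edge) auto
  then have "{src l, tgt l} \<in> edges k" by (simp add: edges_iff)
  moreover have "{src k, tgt k} \<notin> edges k" using src_tgt_notin_rel[of k] lk by (simp add: edges_iff)
  ultimately show "{src l, tgt l} \<noteq> {src k, tgt k}" by metis
qed auto

text \<open>Two neighbours of \<open>v\<close> share the colour opposite to \<open>v\<close>, so no
  earlier edge joins them.\<close>

lemma nb_pair_notin_edges:
  assumes "k < n" "A \<in> pairs_at k v"
  shows "A \<notin> edges k"
proof
  assume e: "A \<in> edges k"
  obtain i j where A: "A = {i, j}" using assms(2) by (auto simp: pairs_at_def card_2_iff)
  obtain c :: "'n \<Rightarrow> bool" where c: "\<And>i j. (i, j) \<in> rel k \<Longrightarrow> c i \<noteq> c j" using colouring[OF assms(1)] by metis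
  have "(v, i) \<in> rel k" "(v, j) \<in> rel k" using assms(2) A by (auto simp: pairs_at_def nb_def)
  moreover have "(i, j) \<in> rel k" using e A edges_iff by simp
  ultimately show False using c by metis
qed

text \<open>A common pair of neighbours of both ends would close a 4-cycle.\<close>

lemma pairs_at_disjoint:
  assumes "k < n"
  shows "pairs_at k (src k) \<inter> pairs_at k (tgt k) = {}"
proof (rule ccontr)
  assume "\<not> ?thesis"
  then obtain A where A: "A \<in> pairs_at k (src k)" "A \<in> pairs_at k (tgt k)" by blast
  then obtain i j where ij: "A = {i, j}" "i \<noteq> j" by (auto simp: pairs_at_def card_2_iff)
  have sym: "sym (edge_rel es)" by (auto simp: edge_rel_def sym_def)
  have "(src k, i) \<in> edge_rel es" "(src k, j) \<in> edge_rel es" "(tgt k, i) \<in> edge_rel es" "(tgt k, j) \<in> edge_rel es"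
    using A ij rel_subset[of k] by (auto simp: pairs_at_def nb_def)
  then have "i = j"
    using no_4_cycle[of "src k" i "tgt k" j] sym src_neq_tgt[OF assms] by (metis symD)
  then show False using ij by simp
qed

lemma finite_pairs: "finite (pairs k)"
  by (rule finite_subset[of _ "UNIV"]) auto

lemma card_pairs:
  assumes "k < n"
  shows "card (pairs k) = k + (card (nb k (src k)) choose 2) + (card (nb k (tgt k)) choose 2)"
proof -
  have at: "card (pairs_at k v) = card (nb k v) choose 2" for v
    unfolding pairs_at_def by (rule n_subsets) simp
  have fin: "finite A" for A :: "'n set set" by (rule finite_subset[of _ "UNIV"]) auto
  have "card (pairs k) = card (edges k \<union> pairs_at k (src k)) + card (pairs_at k (tgt k))"
    unfolding pairs_def
    by (rule card_Un_disjoint)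
       (use fin pairs_at_disjoint[OF assms] nb_pair_notin_edges[OF assms] in blast)+
  also have "card (edges k \<union> pairs_at k (src k)) = card (edges k) + card (pairs_at k (src k))"
    by (rule card_Un_disjoint)
       (use fin nb_pair_notin_edges[OF assms] in blast)+
  finally show ?thesis using assms by (simp add: at card_edges)
qed

lemma card_nb_Suc:
  assumes k: "k < n"
  shows "card (nb (Suc k) v) = card (nb k v) + (if v = src k \<or> v = tgt k then 1 else 0)"
proof -
  have "tgt k \<notin> nb k (src k)" using src_tgt_notin_rel[OF k] by (simp add: nb_def)
  moreover have "src k \<notin> nb k (tgt k)" using src_tgt_notin_rel[OF k] rel_sym[of k] by (auto simp: nb_def dest: symD)
  moreover have "nb (Suc k) v = nb k v \<union> (if v = src k then {tgt k} else {}) \<union> (if v = tgt k then {src k} else {})"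
    using k by (cases "es ! k") (auto simp: nb_def rel_Suc)
  ultimately show ?thesis using src_neq_tgt[OF k] by auto
qed

text \<open>Pascal's rule: edge \<open>k\<close> raises the degrees of its two ends by one, so the
  cubic binomials grow by the claws and \<open>k choose 2\<close> by the Koszul syzygies.\<close>

lemma sum_card_pairs:
  "k \<le> n \<Longrightarrow> (\<Sum>l<k. card (pairs l)) = (k choose 2) + (\<Sum>v\<in>UNIV. card (nb k v) choose 3)"
proof (induction k)
  case 0
  have "nb 0 v = {}" for v by (simp add: nb_def rel_def edge_rel_def)
  then show ?case by simp
next
  case (Suc k)
  then have k: "k < n" by simp
  have "card (nb (Suc k) v) choose 3 = (card (nb k v) choose 3)
      + (if v = src k then card (nb k v) choose 2 else 0) + (if v = tgt k then card (nb k v) choose 2 else 0)" for v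
    using src_neq_tgt[OF k] by (auto simp: card_nb_Suc[OF k] numeral_3_eq_3 numeral_2_eq_2)
  then have "(\<Sum>v\<in>UNIV. card (nb (Suc k) v) choose 3) = (\<Sum>v\<in>UNIV. card (nb k v) choose 3)
      + (card (nb k (src k)) choose 2) + (card (nb k (tgt k)) choose 2)"
    by (simp add: sum.distrib)
  moreover have "Suc k choose 2 = (k choose 2) + k" by (simp add: numeral_2_eq_2)
  ultimately show ?case using Suc by (simp add: card_pairs[OF k])
qed

section \<open>Koszul and claw syzygies generate all syzygies\<close>

lemma lincomb_gen_vec: "lincomb n gen_vec c k = (if k = 0 then \<Sum>l<n. c l * gen l else 0)"
  by (simp add: lincomb_def gen_vec_def)

lemma syz_gen_vec_iff: "c \<in> syz n gen_vec \<longleftrightarrow> (\<forall>l\<ge>n. c l = 0) \<and> (\<Sum>l<n. c l * gen l) = 0"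
  by (auto simp: syz_def fun_eq_iff lincomb_gen_vec)

text \<open>Entry \<open>k\<close> is a generator of the colon ideal at \<open>k\<close>. The pair
  \<open>A\<close> is unordered, hence the existential: its determinant is defined up to sign only.
  Entries of degree 2 on generators of degree 2 give total degree 4.\<close>

definition is_syz :: "nat \<Rightarrow> 'n set \<Rightarrow> (nat \<Rightarrow> ('n + 'n, 'k::field) mpoly) \<Rightarrow> bool" where
  "is_syz k A z \<longleftrightarrow> z \<in> syz n gen_vec \<and> (\<forall>i>k. z i = 0) \<and> (\<forall>i. homog 2 (z i))
    \<and> (\<exists>i j. A = {i, j} \<and> i \<noteq> j \<and> z k = (if A \<in> edges k then dot_poly i j else det_poly i j))"

lemma ex_koszul:
  assumes k: "k < n" and A: "A \<in> edges k"
  shows "\<exists>z :: nat \<Rightarrow> ('n + 'n, 'k::field) mpoly. is_syz k A z"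
proof -
  obtain m where m: "m < k" "A = {src m, tgt m}"
    using A k by (auto simp: edges_def in_set_conv_nth)
  define z :: "nat \<Rightarrow> ('n + 'n, 'k) mpoly"
    where "z l = (if l = k then gen m else if l = m then - gen k else 0)" for l
  have "(\<Sum>l<n. z l * gen l) = (\<Sum>l<n. (if l = k then gen m * gen k else 0) + (if l = m then - (gen k * gen m) else 0))"
    using m(1) by (intro sum.cong) (auto simp: z_def)
  also have "\<dots> = 0" using m k by (simp add: sum.distrib mult.commute)
  finally have "z \<in> syz n gen_vec" using m(1) k by (simp add: syz_gen_vec_iff) (simp add: z_def)
  moreover have "homog 2 (z i)" for i
    by (simp add: z_def gen_def homog_dot_poly homog_minus)
  moreover have "\<exists>i j. A = {i, j} \<and> i \<noteq> j \<and> z k = (if A \<in> edges k then dot_poly i j else det_poly i j)"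
    using m A src_neq_tgt[of m] k
    by (intro exI[of _ "src m"] exI[of _ "tgt m"]) (simp add: z_def gen_def)
  moreover have "\<forall>i>k. z i = 0" using m(1) by (simp add: z_def)
  ultimately show ?thesis unfolding is_syz_def by blast
qed

text \<open>\<open>u\<close> and \<open>w\<close> are the ends of edge \<open>k\<close> in either
  order, so that one proof covers the claws at both.\<close>

lemma ex_claw:
  assumes k: "k < n" and uw: "gen k = (dot_poly u w :: ('n + 'n, 'k::field) mpoly)" and A: "A \<in> pairs_at k u"
  shows "\<exists>z :: nat \<Rightarrow> ('n + 'n, 'k) mpoly. is_syz k A z"
proof -
  obtain i j where ij: "A = {i, j}" "i \<noteq> j" using A by (auto simp: pairs_at_def card_2_iff)
  have "\<exists>m<k. es ! m = (u, v) \<or> es ! m = (v, u)" if "v \<in> A" for v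
    using A that rel_iff[of k u v] k by (auto simp: pairs_at_def nb_def)
  then obtain mi mj where m: "mi < k" "es ! mi = (u, i) \<or> es ! mi = (i, u)" "mj < k" "es ! mj = (u, j) \<or> es ! mj = (j, u)"
    using ij(1) by (metis insertI1 insertI2)
  have ne: "mi \<noteq> mj" using m ij(2) by auto
  have gm: "gen mi = (dot_poly u i :: ('n + 'n, 'k) mpoly)" "gen mj = (dot_poly u j :: ('n + 'n, 'k) mpoly)"
    using m(2,4) by (auto simp: gen_def dot_poly_commute)
  define z :: "nat \<Rightarrow> ('n + 'n, 'k) mpoly"
    where "z l = (if l = k then det_poly i j else if l = mi then - det_poly w j else if l = mj then - det_poly i w else 0)" for l
  have "(\<Sum>l<n. z l * gen l) = (\<Sum>l<n. (if l = k then det_poly i j * gen k else 0)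
      + (if l = mi then - (det_poly w j * gen mi) else 0) + (if l = mj then - (det_poly i w * gen mj) else 0))"
    using m ne by (intro sum.cong) (auto simp: z_def)
  also have "\<dots> = det_poly i j * gen k - det_poly w j * gen mi - det_poly i w * gen mj"
    using m k by (simp add: sum.distrib)
  also have "\<dots> = 0" unfolding uw gm claw_identity[of i j u w] by simp
  finally have "z \<in> syz n gen_vec" using m k by (simp add: syz_gen_vec_iff) (simp add: z_def)
  moreover have "homog 2 (z i)" for i
    by (simp add: z_def homog_det_poly homog_minus)
  moreover have "\<exists>i j. A = {i, j} \<and> i \<noteq> j \<and> z k = (if A \<in> edges k then dot_poly i j else det_poly i j)"
    using ij nb_pair_notin_edges[OF k A] by (intro exI[of _ i] exI[of _ j]) (simp add: z_def)
  moreover have "\<forall>i>k. z i = 0" using m by (simp add: z_def)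
  ultimately show ?thesis unfolding is_syz_def by blast
qed

lemma ex_is_syz: "k < n \<Longrightarrow> A \<in> pairs k \<Longrightarrow> \<exists>z :: nat \<Rightarrow> ('n + 'n, 'k::field) mpoly. is_syz k A z"
  using ex_koszul ex_claw[of k "src k" "tgt k"] ex_claw[of k "tgt k" "src k"]
  by (auto simp: pairs_def gen_def dot_poly_commute)

text \<open>The syzygy equation puts \<open>gen k * v k\<close> into the ideal of the earlier
  generators. \<open>dot_poly_colon\<close> then bounds \<open>v k\<close>, and its generators are
  the k-th entries of the chosen syzygies up to sign.\<close>

lemma colon:
  fixes z :: "nat \<times> 'n set \<Rightarrow> nat \<Rightarrow> ('n + 'n, 'k::field) mpoly"
  assumes k: "k < n" and z: "\<And>A. A \<in> pairs k \<Longrightarrow> is_syz k A (z (k, A))"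
    and v: "v \<in> syz n gen_vec" "\<And>i. i > k \<Longrightarrow> v i = 0"
  shows "v k \<in> im.span ((\<lambda>A. z (k, A) k) ` pairs k)"
proof -
  let ?S = "im.span ((\<lambda>A. z (k, A) k) ` pairs k)"
  obtain c :: "'n \<Rightarrow> bool" where c: "\<And>i j. (i, j) \<in> rel k \<Longrightarrow> c i \<noteq> c j" "c (src k) = c (tgt k)"
    using colouring[OF k] by metis
  have "(\<Sum>l<n. v l * gen l) = (\<Sum>l<Suc k. v l * gen l)"
    using k v(2) by (intro sum.mono_neutral_right) auto
  then have "gen k * v k = - (\<Sum>l<k. v l * gen l)"
    using v(1) by (simp add: syz_gen_vec_iff eq_neg_iff_add_eq_0 add.commute mult.commute)
  moreover have "gen l \<in> im.span ((\<lambda>(i, j). dot_poly i j) ` rel k)" if "l < k" for l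
  proof (rule im.span_base)
    have "(src l, tgt l) \<in> rel k" using that k by (intro earlier_edge) auto
    then show "gen l \<in> (\<lambda>(i, j). dot_poly i j) ` rel k" by (force simp: gen_def)
  qed
  ultimately have "gen k * v k \<in> im.span ((\<lambda>(i, j). dot_poly i j) ` rel k)"
    by (auto intro!: im.span_neg im.span_sum im.span_scale)
  then have "v k \<in> im.span ((\<lambda>(i, j). dot_poly i j) ` rel k
    \<union> (\<lambda>(i, j). det_poly i j) ` (rel k `` {src k} \<times> rel k `` {src k} \<union> rel k `` {tgt k} \<times> rel k `` {tgt k}))"
    unfolding gen_def using rel_sym c src_neq_tgt[OF k] by (intro dot_poly_colon[where c = c])
  also have "\<dots> \<subseteq> ?S"
  proof (rule im.span_minimal[OF _ im.subspace_span], rule Un_least; rule image_subsetI; clarify)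
    fix i j
    assume "(i, j) \<in> rel k"
    then have e: "{i, j} \<in> edges k" by (simp add: edges_iff)
    then have p: "{i, j} \<in> pairs k" by (simp add: pairs_def)
    from z[OF p] obtain i' j' where "{i, j} = {i', j'}" "z (k, {i, j}) k = dot_poly i' j'"
      using e by (auto simp: is_syz_def)
    then have "dot_poly i j = z (k, {i, j}) k" by (auto simp: doubleton_eq_iff dot_poly_commute)
    moreover have "z (k, {i, j}) k \<in> ?S" using p by (intro im.span_base) auto
    ultimately show "dot_poly i j \<in> ?S" by metis
  next
    fix i j
    assume ij: "(i, j) \<in> rel k `` {src k} \<times> rel k `` {src k} \<union> rel k `` {tgt k} \<times> rel k `` {tgt k}"
    show "det_poly i j \<in> ?S"
    proof (cases "i = j")
      case True
      then show ?thesis by (simp add: im.span_zero)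
    next
      case False
      then have pa: "{i, j} \<in> pairs_at k (src k) \<union> pairs_at k (tgt k)"
        using ij by (auto simp: pairs_at_def nb_def)
      then have p: "{i, j} \<in> pairs k" and e: "{i, j} \<notin> edges k"
        using nb_pair_notin_edges[OF k] by (auto simp: pairs_def)
      from z[OF p] obtain i' j' where "{i, j} = {i', j'}" "z (k, {i, j}) k = det_poly i' j'"
        using e by (auto simp: is_syz_def)
      then have "det_poly i j = z (k, {i, j}) k \<or> det_poly i j = - z (k, {i, j}) k"
        using det_poly_swap[of i j] by (auto simp: doubleton_eq_iff)
      moreover have "z (k, {i, j}) k \<in> ?S" using p by (intro im.span_base) auto
      ultimately show ?thesis using im.span_neg by metis
    qed
  qed
  finally show ?thesis .
qed

text \<open>Elimination from the top, by induction on a bound for the support.\<close>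

lemma span_syz:
  fixes z :: "nat \<times> 'n set \<Rightarrow> nat \<Rightarrow> ('n + 'n, 'k::field) mpoly"
  assumes z: "\<And>k A. k < n \<Longrightarrow> A \<in> pairs k \<Longrightarrow> is_syz k A (z (k, A))"
  shows "fm.span (z ` (SIGMA k:{..<n}. pairs k)) = syz n gen_vec" (is "fm.span ?Z = _")
proof
  have sub: "fm.subspace (syz n (gen_vec :: nat \<Rightarrow> nat \<Rightarrow> ('n + 'n, 'k) mpoly))"
    by (rule fm.subspaceI)
       (auto simp: syz_gen_vec_iff distrib_right sum.distrib mult.assoc simp flip: sum_distrib_left)
  show "fm.span ?Z \<subseteq> syz n gen_vec"
    by (rule fm.span_minimal[OF _ sub]) (use z in \<open>auto simp: is_syz_def\<close>)
  have "v \<in> fm.span ?Z" if "v \<in> syz n gen_vec" "m \<le> n" "\<And>i. i \<ge> m \<Longrightarrow> v i = 0" for v m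
    using that
  proof (induction m arbitrary: v)
    case 0
    then have "v = 0" by (intro ext) simp
    show ?case unfolding \<open>v = 0\<close> by (rule fm.span_zero)
  next
    case (Suc m)
    then have m: "m < n" by simp
    have "v m \<in> im.span ((\<lambda>A. z (m, A) m) ` pairs m)"
      by (rule colon[OF m z[OF m] Suc.prems(1)]) (use Suc.prems(3) in auto)
    \<comment> \<open>The ideal combination giving \<open>v m\<close> is lifted to the same
      combination of whole syzygies, none of which reaches beyond \<open>m\<close>; subtracting it
      clears entry \<open>m\<close>.\<close>
    then have "\<exists>w\<in>fm.span ?Z. w \<in> syz n gen_vec \<and> (\<forall>i>m. w i = 0) \<and> w m = v m"
    proof (induction rule: im.span_induct_alt)
      case base
      show ?case
      proof (intro bexI[of _ 0] conjI)
        show "0 \<in> syz n (gen_vec :: nat \<Rightarrow> nat \<Rightarrow> ('n + 'n, 'k) mpoly)" by (rule fm.subspace_0[OF sub])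
      qed (simp, simp, rule fm.span_zero)
    next
      case (step c x y)
      then obtain w where w: "w \<in> fm.span ?Z" "w \<in> syz n gen_vec" "\<forall>i>m. w i = 0" "w m = y" by blast
      obtain A where A: "A \<in> pairs m" "x = z (m, A) m" using step(1) by blast
      have zA: "z (m, A) \<in> syz n gen_vec" "\<forall>i>m. z (m, A) i = 0"
        using z[OF m A(1)] by (simp_all add: is_syz_def)
      have "vscale c (z (m, A)) + w \<in> fm.span ?Z"
        by (intro fm.span_add fm.span_scale w(1), rule fm.span_base) (use A(1) m in auto)
      moreover have "vscale c (z (m, A)) + w \<in> syz n gen_vec"
        using fm.subspace_add[OF sub fm.subspace_scale[OF sub zA(1)] w(2)] .
      moreover have "\<forall>i>m. (vscale c (z (m, A)) + w) i = 0" "(vscale c (z (m, A)) + w) m = c * x + y"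
        using w(3,4) zA(2) A(2) by simp_all
      ultimately show ?case by blast
    qed
    then obtain w where w: "w \<in> fm.span ?Z" "w \<in> syz n gen_vec" "\<forall>i>m. w i = 0" "w m = v m" by blast
    have "v - w \<in> fm.span ?Z"
    proof (rule Suc.IH)
      show "v - w \<in> syz n gen_vec" by (rule fm.subspace_diff[OF sub Suc.prems(1) w(2)])
      show "(v - w) i = 0" if "i \<ge> m" for i
        using that w(3,4) Suc.prems(3)[of i] by (cases "i = m") auto
    qed (use m in simp)
    from fm.span_add[OF this w(1)] show ?case unfolding diff_add_cancel .
  qed
  note claim = this
  show "syz n gen_vec \<subseteq> fm.span ?Z"
    by (rule subsetI, rule claim[of _ n]) (auto simp: syz_gen_vec_iff)
qed

section \<open>Minimality and the Betti numbers\<close>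

lemma hcomp_2_mult: "homog 2 q \<Longrightarrow> hcomp 2 (p * q) = single 0 (lookup (p :: ('n + 'n, 'k::field) mpoly) 0) * q"
  by (simp add: hcomp_mult hcomp_degree_0)

text \<open>Generation is \<open>span_syz\<close>. For minimality, a relation with nonzero constant
  terms is examined at the last position \<open>k\<close> it reaches: there it becomes a linear
  relation over the field between entries with distinct vertex supports.\<close>

lemma ex_min_syz:
  "\<exists>z :: nat \<Rightarrow> nat \<Rightarrow> ('n + 'n, 'k::field) mpoly.
    min_gens (\<lambda>_. 2) (syz n gen_vec) (\<Sum>k<n. card (pairs k)) (\<lambda>_. 4) z"
proof -
  let ?X = "SIGMA k:{..<n}. pairs k"
  let ?N = "\<Sum>k<n. card (pairs k)"
  have "\<exists>z :: nat \<Rightarrow> ('n + 'n, 'k) mpoly. is_syz (fst x) (snd x) z" if "x \<in> ?X" for x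
    using that ex_is_syz by auto
  then obtain zz :: "nat \<times> 'n set \<Rightarrow> nat \<Rightarrow> ('n + 'n, 'k) mpoly"
    where "\<And>x. x \<in> ?X \<Longrightarrow> is_syz (fst x) (snd x) (zz x)" by metis
  then have zz: "is_syz k A (zz (k, A))" if "k < n" "A \<in> pairs k" for k A
    using that by fastforce
  have finX: "finite ?X" using finite_pairs by blast
  have "card ?X = ?N" using finite_pairs by simp
  then obtain h where h: "bij_betw h {..<?N} ?X"
    using finX by (metis card_lessThan finite_lessThan finite_same_card_bij)
  define z where "z l = zz (h l)" for l
  have "h l \<in> ?X" if "l < ?N" for l
    using bij_betwE[OF h] that by blast
  then have hX: "fst (h l) < n" "snd (h l) \<in> pairs (fst (h l))" if "l < ?N" for l
    using that by (cases "h l"; force)+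
  have zl: "is_syz (fst (h l)) (snd (h l)) (z l)" if "l < ?N" for l
    using zz[OF hX[OF that]] by (simp add: z_def)
  have "z ` {..<?N} = zz ` h ` {..<?N}" by (simp add: z_def image_image)
  also have "h ` {..<?N} = ?X" by (rule bij_betw_imp_surj_on[OF h])
  finally have "z ` {..<?N} = zz ` ?X" .
  then have gen: "syz n gen_vec = range (lincomb ?N z)"
    using span_syz[OF zz] span_eq_lincomb[of z ?N] by simp
  have "lookup (c l) 0 = 0" if c: "c \<in> syz ?N z" for c l
  proof (rule ccontr)
    assume nz: "lookup (c l) 0 \<noteq> 0"
    define C where "C l = lookup (c l) 0" for l
    let ?B = "{l. l < ?N \<and> C l \<noteq> 0}"
    have "l < ?N" using nz c by (cases "l < ?N") (auto simp: syz_def)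
    then have ne: "?B \<noteq> {}" using nz by (auto simp: C_def)
    \<comment> \<open>The largest position at which a syzygy with nonzero constant coefficient ends;
      the syzygies ending earlier vanish there.\<close>
    define k where "k = Max ((\<lambda>l. fst (h l)) ` ?B)"
    have "k \<in> (\<lambda>l. fst (h l)) ` ?B" unfolding k_def using ne by (intro Max_in) auto
    then obtain l0 where l0: "l0 < ?N" "C l0 \<noteq> 0" "fst (h l0) = k" by auto
    have le: "fst (h l) \<le> k" if "l < ?N" "C l \<noteq> 0" for l
      unfolding k_def using that by (intro Max_ge) auto
    let ?A = "{l. l < ?N \<and> fst (h l) = k}"
    \<comment> \<open>All entries have degree 2, so the component of degree 2 sees only the constant
      terms of \<open>c\<close>.\<close>
    have "0 = hcomp 2 (lincomb ?N z c k)" using c by (simp add: syz_def)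
    also have "\<dots> = (\<Sum>l<?N. single 0 (C l) * z l k)"
      unfolding lincomb_def hcomp_sum using zl
      by (intro sum.cong refl) (auto simp: is_syz_def C_def hcomp_2_mult)
    also have "\<dots> = (\<Sum>l\<in>?A. single 0 (C l) * z l k)"
    proof (rule sum.mono_neutral_right)
      show "\<forall>l\<in>{..<?N} - ?A. single 0 (C l) * z l k = 0"
      proof
        fix l
        assume l: "l \<in> {..<?N} - ?A"
        show "single 0 (C l) * z l k = 0"
        proof (cases "C l = 0")
          case False
          then have "fst (h l) < k" using le[of l] l by auto
          then show ?thesis using zl[of l] l by (simp add: is_syz_def)
        qed simp
      qed
    qed auto
    finally have sum0: "(\<Sum>l\<in>?A. single 0 (C l) * z l k) = 0" ..
    have lead: "\<exists>i j. snd (h l) = {i, j} \<and> i \<noteq> j \<and> z l k = (if snd (h l) \<in> edges k then dot_poly i j else det_poly i j)"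
      if "l \<in> ?A" for l using zl[of l] that by (auto simp: is_syz_def)
    have "C l0 = 0"
    proof (rule vsupp_independent[where A = ?A and q = "\<lambda>l. z l k" and p = "\<lambda>l. snd (h l)" and C = C])
      show "finite ?A" by simp
      show "vsupp t = snd (h l)" if l: "l \<in> ?A" and t: "t \<in> keys (z l k)" for l t
      proof -
        obtain i j where ij: "snd (h l) = {i, j}" "z l k = (if snd (h l) \<in> edges k then dot_poly i j else det_poly i j)"
          using lead[OF l] by blast
        show ?thesis
          using t vsupp_dot_poly[of t i j] vsupp_det_poly[of t i j] unfolding ij
          by (cases "{i, j} \<in> edges k") simp_all
      qed
      show "inj_on (\<lambda>l. snd (h l)) ?A"
        using h by (auto simp: inj_on_def bij_betw_def prod_eq_iff)
      show "z l k \<noteq> 0" if l: "l \<in> ?A" for l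
      proof -
        obtain i j where "i \<noteq> j" "z l k = (if snd (h l) \<in> edges k then dot_poly i j else det_poly i j)"
          using lead[OF l] by blast
        then show ?thesis by (simp add: dot_poly_neq_0 det_poly_neq_0)
      qed
    qed (use sum0 l0 in auto)
    then show False using l0 by simp
  qed
  moreover have "vhomog (\<lambda>_. 2) 4 (z l)" if "l < ?N" for l
    using zl[OF that] by (auto simp: vhomog_def homog_map_entry_iff is_syz_def)
  ultimately have "min_gens (\<lambda>_. 2) (syz n gen_vec) ?N (\<lambda>_. 4) z"
    using gen by (simp add: min_gens_def)
  then show ?thesis by blast
qed

text \<open>Minimality by the same principle: the edges are distinct, so the generators have
  distinct vertex supports.\<close>

lemma min_gens_gen_vec:
  assumes I: "I = im.span (gen ` {..<n} :: ('n + 'n, 'k::field) mpoly set)"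
  shows "min_gens (\<lambda>_. 0) (ideal_module I) n (\<lambda>_. 2) gen_vec"
  unfolding min_gens_def
proof (intro conjI allI impI ballI)
  show "vhomog (\<lambda>_. 0) 2 (gen_vec l :: nat \<Rightarrow> ('n + 'n, 'k) mpoly)" for l
    by (auto simp: vhomog_def gen_vec_def gen_def homog_map_entry_iff homog_dot_poly)
  have "fm.span (gen_vec ` {..<n}) = ideal_module I"
  proof
    have "fm.subspace (ideal_module I)"
      using im.span_zero im.span_add im.span_scale unfolding I
      by (intro fm.subspaceI) (auto simp: ideal_module_def)
    then show "fm.span (gen_vec ` {..<n}) \<subseteq> ideal_module I"
      by (intro fm.span_minimal) (auto simp: ideal_module_def gen_vec_def I im.span_base)
    have *: "(\<lambda>k. if k = 0 then x else 0) \<in> fm.span (gen_vec ` {..<n})" if "x \<in> I" for x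
      using that unfolding I
    proof (induction rule: im.span_induct_alt)
      case base
      have "(\<lambda>k. if k = 0 then 0 else 0) = (0 :: nat \<Rightarrow> ('n + 'n, 'k) mpoly)" by auto
      then show ?case using fm.span_zero by metis
    next
      case (step c x y)
      then obtain l where l: "l < n" "x = gen l" by auto
      have eq: "(\<lambda>k. if k = 0 then c * x + y else 0) = vscale c (gen_vec l) + (\<lambda>k. if k = 0 then y else 0)"
        by (rule ext) (simp add: gen_vec_def l)
      have "gen_vec l \<in> gen_vec ` {..<n}" using l by simp
      then show ?case
        unfolding eq by (intro fm.span_add fm.span_scale fm.span_base step(2))
    qed
    show "ideal_module I \<subseteq> fm.span (gen_vec ` {..<n})"
    proof
      fix u
      assume u: "u \<in> ideal_module I"
      have eq: "u = (\<lambda>k. if k = 0 then u 0 else 0)"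
        using u by (intro ext) (auto simp: ideal_module_def)
      have "u 0 \<in> I" using u by (simp add: ideal_module_def)
      then show "u \<in> fm.span (gen_vec ` {..<n})"
        by (subst eq) (rule *)
    qed
  qed
  then show "ideal_module I = range (lincomb n gen_vec)" by (simp add: span_eq_lincomb)
  fix c :: "nat \<Rightarrow> ('n + 'n, 'k) mpoly" and l
  assume c: "c \<in> syz n gen_vec"
  show "lookup (c l) 0 = 0"
  proof (cases "l < n")
    case True
    have "0 = hcomp 2 (\<Sum>l<n. c l * gen l)" using c by (simp add: syz_gen_vec_iff)
    also have "\<dots> = (\<Sum>l<n. single 0 (lookup (c l) 0) * gen l)"
      by (simp add: hcomp_sum hcomp_2_mult gen_def homog_dot_poly)
    finally have sum0: "(\<Sum>l<n. single 0 (lookup (c l) 0) * gen l) = 0" ..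
    show ?thesis
    proof (rule vsupp_independent[where A = "{..<n}" and q = gen and p = "\<lambda>k. {src k, tgt k}"
          and C = "\<lambda>l. lookup (c l) 0"])
      show "vsupp t = {src k, tgt k}" if "t \<in> keys (gen k :: ('n + 'n, 'k) mpoly)" for t k
        using that unfolding gen_def by (rule vsupp_dot_poly)
    qed (use sum0 True inj_edge in \<open>auto simp: gen_def dot_poly_neq_0\<close>)
  next
    case False
    then show ?thesis using c by (simp add: syz_gen_vec_iff)
  qed
qed

text \<open>Generators of degree 2 make \<open>I\<close> graded and contained in the irrelevant
  ideal, so a minimal resolution exists and the \<open>SOME\<close> in \<open>graded_betti\<close>
  denotes one; \<open>resolution_shifts_2\<close> then determines its shifts.\<close>

theorem graded_betti_2:
  fixes I :: "('n + 'n, 'k::field) mpoly set"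
  assumes I: "I = im.span (gen ` {..<n})"
  shows "graded_betti I 2 j = (if j = 4 then \<Sum>k<n. card (pairs k) else 0)"
proof -
  have sub: "im.subspace I" by (simp add: I)
  have hc: "hcomp d x \<in> I" if "x \<in> I" for d x
    using that unfolding I
  proof (induction rule: im.span_induct_alt)
    case base
    then show ?case by (simp add: im.span_zero)
  next
    case (step c x y)
    then have "homog 2 x" by (auto simp: gen_def homog_dot_poly)
    then have "hcomp d (c * x) \<in> im.span (gen ` {..<n})"
      using im.span_scale[OF im.span_base[OF step(1)]] by (simp add: hcomp_mult im.span_zero)
    then show ?case using step(2) by (simp add: hcomp_add im.span_add)
  qed
  have "lookup x 0 = 0" if "x \<in> I" for x
    using that unfolding I
  proof (induction rule: im.span_induct_alt)
    case (step c x y)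
    then have "homog 2 x" by (auto simp: gen_def homog_dot_poly)
    then have "0 \<notin> keys x" by (auto simp: homog_def)
    then have "lookup x 0 = 0" by (simp add: in_keys_iff)
    then show ?case using step(2) by (simp add: lookup_add lookup_mult_0)
  qed simp
  then have irr: "I \<subseteq> irrelevant_ideal" by (auto simp: irrelevant_ideal_iff)
  let ?F = "SOME F. minimal_graded_free_resolution I F"
  have F: "minimal_graded_free_resolution I ?F"
    by (rule someI_ex[OF ex_minimal_graded_free_resolution[OF sub hc irr]])
  obtain z :: "nat \<Rightarrow> nat \<Rightarrow> ('n + 'n, 'k) mpoly"
    where z: "min_gens (\<lambda>_. 2) (syz n gen_vec) (\<Sum>k<n. card (pairs k)) (\<lambda>_. 4) z"
    using ex_min_syz by blast
  have "shifts ?F 2 = replicate (\<Sum>k<n. card (pairs k)) 4"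
    by (rule resolution_shifts_2[OF F sub irr min_gens_gen_vec[OF I] z])
  moreover have "count_list (replicate m x) y = (if y = x then m else 0)" for m and x y :: nat
    by (induction m) auto
  ultimately show ?thesis by (simp add: graded_betti_def)
qed

end

theorem theorem5p3:
  fixes E :: "'n::finite set set"
    and L :: "('n + 'n, 'k::field) mpoly set"
  assumes "simple_graph E"
    and "connected_graph E"
    and "odd_unicyclic E"
    and "L = LSS_ideal E"
  shows "betti L 2 = graded_betti L 2 4 \<and>
    graded_betti L 2 4 = (CARD('n) choose 2) + (\<Sum>i\<in>UNIV. vertex_deg E i choose 3)"
proof -
  obtain es where es: "length es = CARD('n)" "E = (\<lambda>(i, j). {i, j}) ` set es" "monochromatic_extension es"
    using odd_unicyclic_edge_order[OF assms(1-3)] by blast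
  have rel_E: "(i, j) \<in> edge_rel es \<longleftrightarrow> {i, j} \<in> E" for i j
    by (force simp: es(2) edge_rel_def doubleton_eq_iff)
  interpret edge_order es
    by unfold_locales (use es(3) odd_unicyclic_no_4_cycle[OF assms(1,3)] in \<open>auto simp: rel_E\<close>)
  have "{x_var i * x_var j + y_var i * y_var j | i j. {i, j} \<in> E} = (gen ` {..<n} :: ('n + 'n, 'k) mpoly set)"
  proof (intro equalityI subsetI)
    fix p :: "('n + 'n, 'k) mpoly"
    assume "p \<in> {x_var i * x_var j + y_var i * y_var j | i j. {i, j} \<in> E}"
    then obtain i j where ij: "p = dot_poly i j" "(i, j) \<in> rel n"
      by (auto simp: dot_poly_def rel_E rel_def)
    then obtain m where "m < n" "es ! m = (i, j) \<or> es ! m = (j, i)" using rel_iff by auto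
    then show "p \<in> gen ` {..<n}" using ij(1) by (intro image_eqI[of _ _ m]) (auto simp: gen_def dot_poly_commute)
  next
    fix p :: "('n + 'n, 'k) mpoly"
    assume "p \<in> gen ` {..<n}"
    then obtain m where m: "m < n" "p = gen m" by auto
    then have "{src m, tgt m} \<in> E" unfolding es(2) by (force simp: in_set_conv_nth)
    then show "p \<in> {x_var i * x_var j + y_var i * y_var j | i j. {i, j} \<in> E}"
      using m(2) by (auto simp: gen_def dot_poly_def)
  qed
  then have L: "L = im.span (gen ` {..<n})" by (simp add: assms(4) LSS_ideal_def ideal_gen_def)
  have "card (nb n v) = vertex_deg E v" for v
    by (simp add: nb_def rel_def vertex_deg_def rel_E Image_singleton)
  then have count: "(\<Sum>k<n. card (pairs k)) = (CARD('n) choose 2) + (\<Sum>i\<in>UNIV. vertex_deg E i choose 3)"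
    using sum_card_pairs[of n] es(1) by simp
  have "betti L 2 = graded_betti L 2 4"
    unfolding betti_def graded_betti_2[OF L] by simp
  then show ?thesis using count by (simp add: graded_betti_2[OF L])
qed

end
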